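(* For any $x\in HX$ and any integer $n\ge 0$, if $h_nx\neq 0$ in $HX$, then $h_n^ix\neq 0$ in $HX$ for all $i\ge 1$.
   Context: Let $X=\mathbb{F}_2[R_{ij}: 0\le i<j]$ ($i,j$ integers) be the commutative polynomial algebra over $\mathbb{F}_2$ with the $\mathbb F_2$-linear derivation $d$ determined by $dR_{ij}=\sum_{k=i+1}^{j-1}R_{ik}R_{kj}$; one has $d^2=0$. $HX=\ker d/\operatorname{im} d$ is its homology algebra (it is isomorphic to the $E_2$ page of the May spectral sequence at the prime 2, i.e. to the cohomology of the associated graded algebra of the Steenrod algebra). $h_n\in HX$ denotes the homology class of the cycle $R_{n,n+1}$. *)

theory Defs
  imports "HOL-Library.Poly_Mapping" "HOL-Library.Z2"
begin

section \<open>The polynomial algebra\<close>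

typedef index = "{(i, j). i < (j::nat)}"
  by (rule exI[of _ "(0, 1)"]) simp

text \<open>Exponent vectors are finitely supported functions to \<^typ>\<open>nat\<close>, and polynomials are
  finitely supported functions from exponent vectors to the two-element field \<^typ>\<open>bit\<close>; the
  multiplication of \<^typ>\<open>'a \<Rightarrow>\<^sub>0 'b\<close> is convolution.\<close>

type_synonym X = "(index \<Rightarrow>\<^sub>0 nat) \<Rightarrow>\<^sub>0 bit"

definition scalar :: "bit \<Rightarrow> X" where
  "scalar c = Poly_Mapping.single 0 c"

definition var :: "index \<Rightarrow> X" where
  "var v = Poly_Mapping.single (Poly_Mapping.single v 1) 1"

text \<open>\<open>R i j\<close> is only meaningful for \<open>i < j\<close>; otherwise it is an unspecified variable.\<close>

definition R :: "nat \<Rightarrow> nat \<Rightarrow> X" where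
  "R i j = var (Abs_index (i, j))"

section \<open>The differential\<close>

definition derivation :: "(X \<Rightarrow> X) \<Rightarrow> bool" where
  "derivation D \<longleftrightarrow>
     (\<forall>p q. D (p + q) = D p + D q) \<and>
     (\<forall>c p. D (scalar c * p) = scalar c * D p) \<and>
     (\<forall>p q. D (p * q) = D p * q + p * D q)"

definition dX :: "X \<Rightarrow> X" where
  "dX = (THE D. derivation D \<and> (\<forall>i j. i < j \<longrightarrow> D (R i j) = (\<Sum>k\<in>{i<..<j}. R i k * R k j)))"

subsection \<open>Generation by the variables\<close>

lemma poly_mapping_sum_single:
  "p = (\<Sum>k\<in>Poly_Mapping.keys p. Poly_Mapping.single k (Poly_Mapping.lookup p k))"
proof (rule poly_mapping_eqI)
  fix k
  show "Poly_Mapping.lookup p k =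
    Poly_Mapping.lookup (\<Sum>k\<in>Poly_Mapping.keys p. Poly_Mapping.single k (Poly_Mapping.lookup p k)) k"
    by (simp add: lookup_sum lookup_single when_def in_keys_iff del: add_bit_eq_xor)
qed

lemma scalar_1 [simp]: "scalar 1 = 1"
  by (simp add: scalar_def)

lemma scalar_0 [simp]: "scalar 0 = 0"
  by (simp add: scalar_def)

lemma X_induct [case_names scalar var add mult]:
  assumes scalar: "\<And>c. P (scalar c)"
    and var: "\<And>v. P (var v)"
    and add: "\<And>p q. P p \<Longrightarrow> P q \<Longrightarrow> P (p + q)"
    and mult: "\<And>p q. P p \<Longrightarrow> P q \<Longrightarrow> P (p * q)"
  shows "P (p :: X)"
proof -
  have 1: "P 1" and 0: "P 0"
    using scalar[of 1] scalar[of 0] by simp_all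
  have vpow: "P (Poly_Mapping.single (Poly_Mapping.single v n) 1)" for v n
  proof (induction n)
    case 0
    then show ?case using 1 by simp
  next
    case (Suc n)
    have "Poly_Mapping.single (Poly_Mapping.single v (Suc n)) (1::bit) =
        var v * Poly_Mapping.single (Poly_Mapping.single v n) 1"
      by (simp add: var_def mult_single single_add[symmetric])
    then show ?case using mult[OF var Suc.IH] by simp
  qed
  have mon1: "P (Poly_Mapping.single (\<Sum>v\<in>S. Poly_Mapping.single v (e v)) 1)"
    if "finite S" for S and e :: "index \<Rightarrow> nat"
    using that
  proof (induction S rule: finite_induct)
    case empty
    then show ?case using 1 by simp
  next
    case (insert v S)
    have "Poly_Mapping.single (\<Sum>v\<in>insert v S. Poly_Mapping.single v (e v)) (1::bit) =
        Poly_Mapping.single (Poly_Mapping.single v (e v)) 1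
          * Poly_Mapping.single (\<Sum>v\<in>S. Poly_Mapping.single v (e v)) 1"
      using insert by (simp add: mult_single)
    then show ?case using mult[OF vpow insert.IH] by simp
  qed
  have mon: "P (Poly_Mapping.single m c)" for m c
  proof -
    have "P (Poly_Mapping.single m 1)"
      using mon1[OF finite_keys, of "Poly_Mapping.lookup m" m] poly_mapping_sum_single[of m] by simp
    then show ?thesis
      using mult[OF scalar[of c], of "Poly_Mapping.single m 1"]
      by (simp add: scalar_def mult_single del: mult_bit_eq_and)
  qed
  have "P (\<Sum>m\<in>S. Poly_Mapping.single m (f m))" if "finite S" for S f
    using that by (induction S rule: finite_induct) (auto intro: 0 add mon)
  then show ?thesis
    using poly_mapping_sum_single[of p] finite_keys[of p] by metis
qed

lemma derivation_add: "derivation D \<Longrightarrow> D (p + q) = D p + D q"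
  and derivation_scalar_mult: "derivation D \<Longrightarrow> D (scalar c * p) = scalar c * D p"
  and derivation_mult: "derivation D \<Longrightarrow> D (p * q) = D p * q + p * D q"
  unfolding derivation_def by blast+

lemma derivation_0: "derivation D \<Longrightarrow> D 0 = 0"
  using derivation_add[of D 0 0] by simp

lemma derivation_1: "derivation D \<Longrightarrow> D 1 = 0"
  using derivation_mult[of D 1 1] by simp

lemma derivation_scalar: "derivation D \<Longrightarrow> D (scalar c) = 0"
  using derivation_scalar_mult[of D c 1] by (simp add: derivation_1)

lemma derivation_sum: "derivation D \<Longrightarrow> D (sum f S) = (\<Sum>x\<in>S. D (f x))"
  by (induction S rule: infinite_finite_induct) (simp_all add: derivation_0 derivation_add)

lemma derivation_eqI:
  assumes "derivation D" "derivation E" "\<And>v. D (var v) = E (var v)"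
  shows "D = E"
proof
  fix p
  show "D p = E p"
    by (induction p rule: X_induct)
      (simp_all add: assms derivation_scalar derivation_add derivation_mult)
qed

subsection \<open>Existence of the differential\<close>

definition mono_deriv :: "(index \<Rightarrow> X) \<Rightarrow> (index \<Rightarrow>\<^sub>0 nat) \<Rightarrow> X" where
  "mono_deriv g m = (\<Sum>v\<in>Poly_Mapping.keys m.
     Poly_Mapping.single (m - Poly_Mapping.single v 1) (of_nat (Poly_Mapping.lookup m v)) * g v)"

definition extend_deriv :: "(index \<Rightarrow> X) \<Rightarrow> X \<Rightarrow> X" where
  "extend_deriv g p = (\<Sum>m\<in>Poly_Mapping.keys p. scalar (Poly_Mapping.lookup p m) * mono_deriv g m)"

lemma mono_deriv_superset:
  assumes "finite S" "Poly_Mapping.keys m \<subseteq> S"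
  shows "mono_deriv g m = (\<Sum>v\<in>S.
     Poly_Mapping.single (m - Poly_Mapping.single v 1) (of_nat (Poly_Mapping.lookup m v)) * g v)"
  unfolding mono_deriv_def
  by (rule sum.mono_neutral_left) (use assms in \<open>auto simp: in_keys_iff\<close>)

lemma extend_deriv_superset:
  assumes "finite S" "Poly_Mapping.keys p \<subseteq> S"
  shows "extend_deriv g p = (\<Sum>m\<in>S. scalar (Poly_Mapping.lookup p m) * mono_deriv g m)"
  unfolding extend_deriv_def
  by (rule sum.mono_neutral_left) (use assms in \<open>auto simp: in_keys_iff\<close>)

lemma scalar_add: "scalar (a + b) = scalar a + scalar b"
  unfolding scalar_def by (rule single_add)

lemma scalar_mult: "scalar (a * b) = scalar a * scalar b"
  by (simp add: scalar_def mult_single del: mult_bit_eq_and)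

lemma extend_deriv_add: "extend_deriv g (p + q) = extend_deriv g p + extend_deriv g q"
proof -
  let ?S = "Poly_Mapping.keys p \<union> Poly_Mapping.keys q"
  have "Poly_Mapping.keys (p + q) \<subseteq> ?S"
    by (rule keys_add)
  then show ?thesis
    by (simp add: extend_deriv_superset[of ?S] lookup_add scalar_add distrib_right sum.distrib
        del: add_bit_eq_xor)
qed

lemma extend_deriv_single:
  "extend_deriv g (Poly_Mapping.single m c) = scalar c * mono_deriv g m"
  by (simp add: extend_deriv_superset[of "{m}"])

lemma mono_deriv_add:
  "mono_deriv g (m + n) =
     mono_deriv g m * Poly_Mapping.single n 1 + Poly_Mapping.single m 1 * mono_deriv g n"
proof -
  let ?S = "Poly_Mapping.keys m \<union> Poly_Mapping.keys n"
  let ?e = "\<lambda>v. Poly_Mapping.single v (1::nat)"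
  have part: "Poly_Mapping.single (m + n - ?e v) (of_nat (Poly_Mapping.lookup (m + n) v)) =
      Poly_Mapping.single (m - ?e v) (of_nat (Poly_Mapping.lookup m v)) * Poly_Mapping.single n (1::bit)
      + Poly_Mapping.single m 1 * Poly_Mapping.single (n - ?e v) (of_nat (Poly_Mapping.lookup n v))" for v
  proof -
    have a: "m - ?e v + n = m + n - ?e v" if "Poly_Mapping.lookup m v \<noteq> 0"
      by (rule poly_mapping_eqI) (use that in \<open>auto simp: lookup_add lookup_minus lookup_single when_def\<close>)
    have b: "m + (n - ?e v) = m + n - ?e v" if "Poly_Mapping.lookup n v \<noteq> 0"
      by (rule poly_mapping_eqI) (use that in \<open>auto simp: lookup_add lookup_minus lookup_single when_def\<close>)
    have "Poly_Mapping.single (m - ?e v) (of_nat (Poly_Mapping.lookup m v)) * Poly_Mapping.single n (1::bit)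
        = Poly_Mapping.single (m + n - ?e v) (of_nat (Poly_Mapping.lookup m v))"
      proof (cases "Poly_Mapping.lookup m v = 0")
      case False
      show ?thesis
        by (simp only: mult_single mult_1_right a[OF False])
    qed (simp only: of_nat_0 single_zero mult_zero_left)
    moreover have "Poly_Mapping.single m (1::bit) * Poly_Mapping.single (n - ?e v) (of_nat (Poly_Mapping.lookup n v))
        = Poly_Mapping.single (m + n - ?e v) (of_nat (Poly_Mapping.lookup n v))"
      proof (cases "Poly_Mapping.lookup n v = 0")
      case False
      show ?thesis
        by (simp only: mult_single mult_1_left b[OF False])
    qed (simp only: of_nat_0 single_zero mult_zero_right)
    ultimately show ?thesis
      by (simp only: lookup_add of_nat_add single_add)
  qed
  have "Poly_Mapping.keys (m + n) \<subseteq> ?S"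
    by (rule keys_add)
  then have "mono_deriv g (m + n) = (\<Sum>v\<in>?S.
      Poly_Mapping.single (m + n - ?e v) (of_nat (Poly_Mapping.lookup (m + n) v)) * g v)"
    by (rule mono_deriv_superset[rotated]) simp
  also have "\<dots> = mono_deriv g m * Poly_Mapping.single n 1 + Poly_Mapping.single m 1 * mono_deriv g n"
    unfolding part
    by (simp add: mono_deriv_superset[of ?S] sum_distrib_left sum_distrib_right sum.distrib algebra_simps)
  finally show ?thesis .
qed

lemma scalar_eq_single: "scalar c * Poly_Mapping.single m 1 = Poly_Mapping.single m c"
  by (simp add: scalar_def mult_single)

lemma extend_deriv_mult_single:
  "extend_deriv g (Poly_Mapping.single m a * Poly_Mapping.single n b) =
     extend_deriv g (Poly_Mapping.single m a) * Poly_Mapping.single n b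
     + Poly_Mapping.single m a * extend_deriv g (Poly_Mapping.single n b)"
proof -
  have "extend_deriv g (Poly_Mapping.single m a * Poly_Mapping.single n b) =
      scalar a * scalar b * mono_deriv g (m + n)"
    by (simp only: mult_single extend_deriv_single scalar_mult)
  also have "\<dots> = (scalar a * mono_deriv g m) * (scalar b * Poly_Mapping.single n 1)
      + (scalar a * Poly_Mapping.single m 1) * (scalar b * mono_deriv g n)"
    by (simp add: mono_deriv_add algebra_simps)
  finally show ?thesis
    by (simp only: scalar_eq_single extend_deriv_single)
qed

lemma extend_deriv_0: "extend_deriv g 0 = 0"
  by (simp add: extend_deriv_def)

lemma extend_deriv_sum: "extend_deriv g (sum f S) = (\<Sum>x\<in>S. extend_deriv g (f x))"
  by (induction S rule: infinite_finite_induct) (simp_all add: extend_deriv_0 extend_deriv_add)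

lemma extend_deriv_mult:
  "extend_deriv g (p * q) = extend_deriv g p * q + p * extend_deriv g q"
proof -
  let ?s = "\<lambda>p m. Poly_Mapping.single m (Poly_Mapping.lookup p m) :: X"
  have 1: "extend_deriv g (sum f S * sum h T) =
      extend_deriv g (sum f S) * sum h T + sum f S * extend_deriv g (sum h T)"
    if "\<And>m n. extend_deriv g (f m * h n) = extend_deriv g (f m) * h n + f m * extend_deriv g (h n)"
    for f h :: "(index \<Rightarrow>\<^sub>0 nat) \<Rightarrow> X" and S T
    by (simp add: sum_product extend_deriv_sum that sum.distrib)
  have "extend_deriv g ((\<Sum>m\<in>Poly_Mapping.keys p. ?s p m) * (\<Sum>m\<in>Poly_Mapping.keys q. ?s q m)) =
      extend_deriv g (\<Sum>m\<in>Poly_Mapping.keys p. ?s p m) * (\<Sum>m\<in>Poly_Mapping.keys q. ?s q m)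
      + (\<Sum>m\<in>Poly_Mapping.keys p. ?s p m) * extend_deriv g (\<Sum>m\<in>Poly_Mapping.keys q. ?s q m)"
    by (rule 1) (rule extend_deriv_mult_single)
  then show ?thesis
    by (simp only: poly_mapping_sum_single[symmetric])
qed

lemma extend_deriv_var: "extend_deriv g (var v) = g v"
  by (simp add: var_def extend_deriv_single mono_deriv_def)

lemma derivation_extend_deriv: "derivation (extend_deriv g)"
proof -
  have "extend_deriv g (scalar c) = 0" for c
    by (simp add: scalar_def extend_deriv_single mono_deriv_def)
  then show ?thesis
    by (simp add: derivation_def extend_deriv_add extend_deriv_mult)
qed

lemma dX_ex1:
  "\<exists>!D. derivation D \<and> (\<forall>i j. i < j \<longrightarrow> D (R i j) = (\<Sum>k\<in>{i<..<j}. R i k * R k j))"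
proof (rule ex_ex1I)
  define g where "g v = (case Rep_index v of (i, j) \<Rightarrow> \<Sum>k\<in>{i<..<j}. R i k * R k j)" for v
  have "extend_deriv g (R i j) = (\<Sum>k\<in>{i<..<j}. R i k * R k j)" if "i < j" for i j
    using that by (simp add: R_def[of i j] extend_deriv_var) (simp add: g_def Abs_index_inverse)
  then show "\<exists>D. derivation D \<and> (\<forall>i j. i < j \<longrightarrow> D (R i j) = (\<Sum>k\<in>{i<..<j}. R i k * R k j))"
    using derivation_extend_deriv by blast
next
  fix D E
  assume D: "derivation D \<and> (\<forall>i j. i < j \<longrightarrow> D (R i j) = (\<Sum>k\<in>{i<..<j}. R i k * R k j))"
    and E: "derivation E \<and> (\<forall>i j. i < j \<longrightarrow> E (R i j) = (\<Sum>k\<in>{i<..<j}. R i k * R k j))"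
  have "D (var v) = E (var v)" for v
  proof -
    obtain i j where "i < j" "v = Abs_index (i, j)"
      by (cases v) auto
    then show ?thesis
      using D E by (simp add: R_def[symmetric])
  qed
  then show "D = E"
    using D E derivation_eqI by blast
qed

lemma derivation_dX: "derivation dX"
  and dX_R: "i < j \<Longrightarrow> dX (R i j) = (\<Sum>k\<in>{i<..<j}. R i k * R k j)"
  using theI'[OF dX_ex1] unfolding dX_def[symmetric] by blast+

lemmas dX_add = derivation_add[OF derivation_dX]
  and dX_mult = derivation_mult[OF derivation_dX]
  and dX_0 [simp] = derivation_0[OF derivation_dX]
  and dX_1 [simp] = derivation_1[OF derivation_dX]
  and dX_scalar [simp] = derivation_scalar[OF derivation_dX]
  and dX_sum = derivation_sum[OF derivation_dX]

subsection \<open>The differential squares to zero\<close>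

lemma X_add_self [simp]: "p + p = (0 :: X)"
  by (rule poly_mapping_eqI) (simp only: lookup_add lookup_zero, simp)

lemma X_uminus [simp]: "- p = (p :: X)"
  by (rule minus_unique) simp

lemma X_diff [simp]: "p - q = p + (q :: X)"
  unfolding diff_conv_add_uminus by simp

lemma dX_dX_R:
  assumes "i < j"
  shows "dX (dX (R i j)) = 0"
proof -
  have "dX (dX (R i j)) =
      (\<Sum>k\<in>{i<..<j}. dX (R i k) * R k j) + (\<Sum>k\<in>{i<..<j}. R i k * dX (R k j))"
    using assms by (simp add: dX_R dX_sum dX_mult sum.distrib)
  also have "(\<Sum>k\<in>{i<..<j}. dX (R i k) * R k j) =
      (\<Sum>k\<in>{i<..<j}. \<Sum>l\<in>{i<..<k}. R i l * R l k * R k j)"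
    by (rule sum.cong) (simp_all add: dX_R sum_distrib_right)
  also have "\<dots> = (\<Sum>l\<in>{i<..<j}. \<Sum>k\<in>{l<..<j}. R i l * R l k * R k j)"
    unfolding sum.Sigma[OF finite_greaterThanLessThan ballI[OF finite_greaterThanLessThan]]
    by (rule sum.reindex_bij_witness[of _ prod.swap prod.swap]) auto
  also have "\<dots> = (\<Sum>l\<in>{i<..<j}. R i l * dX (R l j))"
    by (rule sum.cong) (simp_all add: dX_R sum_distrib_left mult.assoc)
  finally show ?thesis
    by simp
qed

lemma dX_dX [simp]: "dX (dX p) = 0"
proof (induction p rule: X_induct)
  case (var v)
  obtain i j where "i < j" "v = Abs_index (i, j)"
    by (cases v) auto
  then show ?case
    using dX_dX_R by (simp add: R_def[symmetric])
qed (simp_all add: dX_add dX_mult)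

section \<open>The homology algebra\<close>

definition homologous :: "X \<Rightarrow> X \<Rightarrow> bool" where
  "homologous p q \<longleftrightarrow> dX p = 0 \<and> dX q = 0 \<and> p - q \<in> range dX"

lemma part_equivp_homologous: "part_equivp homologous"
proof (rule part_equivpI)
  show "\<exists>p. homologous p p"
    by (rule exI[of _ 0]) (auto simp: homologous_def image_iff intro!: exI[of _ 0])
  show "symp homologous"
    by (auto simp: symp_def homologous_def add.commute)
  show "transp homologous"
  proof (rule transpI)
    fix p q r
    assume pq: "homologous p q" and qr: "homologous q r"
    then obtain a b where ab: "p + q = dX a" "q + r = dX b"
      by (auto simp: homologous_def)
    have "p + r = (p + q) + (q + r)"
      using X_add_self[of q] by (metis add.assoc add.right_neutral)
    then have "p + r = dX (a + b)"
      by (simp add: ab dX_add)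
    then show "homologous p r"
      using pq qr by (simp add: homologous_def)
  qed
qed

text \<open>The quotient is taken of the set of cycles only, because \<^const>\<open>homologous\<close> is reflexive
  exactly on the cycles.\<close>

quotient_type HX = X / partial: homologous
  by (rule part_equivp_homologous)

lemma homologousI: "dX p = 0 \<Longrightarrow> dX q = 0 \<Longrightarrow> p + q = dX a \<Longrightarrow> homologous p q"
  by (auto simp: homologous_def)

lemma homologous_refl: "dX p = 0 \<Longrightarrow> homologous p p"
  by (rule homologousI[of _ _ 0]) simp_all

lemma lookup_mult_0:
  fixes p q :: X
  shows "Poly_Mapping.lookup (p * q) 0 = Poly_Mapping.lookup p 0 * Poly_Mapping.lookup q 0"
proof -
  let ?s = "\<lambda>p m. Poly_Mapping.single m (Poly_Mapping.lookup p m) :: X"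
  have add0: "m + n = 0 \<longleftrightarrow> m = 0 \<and> n = 0" for m n :: "index \<Rightarrow>\<^sub>0 nat"
    by (auto simp: poly_mapping_eq_iff fun_eq_iff lookup_add)
  have "Poly_Mapping.lookup ((\<Sum>m\<in>Poly_Mapping.keys p. ?s p m) * (\<Sum>n\<in>Poly_Mapping.keys q. ?s q n)) 0 =
      Poly_Mapping.lookup (\<Sum>m\<in>Poly_Mapping.keys p. ?s p m) 0
      * Poly_Mapping.lookup (\<Sum>n\<in>Poly_Mapping.keys q. ?s q n) 0"
    unfolding sum_product lookup_sum
    by (intro sum.cong refl) (simp add: mult_single lookup_single when_def add0 del: mult_bit_eq_and)
  then show ?thesis
    by (simp only: poly_mapping_sum_single[symmetric])
qed

lemma lookup_dX_0: "Poly_Mapping.lookup (dX p) 0 = 0"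
proof (induction p rule: X_induct)
  case (var v)
  obtain i j where ij: "i < j" "v = Abs_index (i, j)"
    by (cases v) auto
  have "Poly_Mapping.lookup (var v) 0 = 0" for v
  proof -
    have "Poly_Mapping.single v (1::nat) \<noteq> 0"
      by (metis lookup_single_eq lookup_zero zero_neq_one)
    then show ?thesis
      by (simp add: var_def lookup_single when_def)
  qed
  then show ?case
    using ij by (simp add: R_def[symmetric] dX_R lookup_sum lookup_mult_0) (simp add: R_def)
qed (simp_all add: dX_add dX_mult lookup_add lookup_mult_0)

instantiation HX :: comm_ring_1
begin

lift_definition zero_HX :: HX is "0 :: X"
  by (simp add: homologous_refl)

lift_definition one_HX :: HX is "1 :: X"
  by (simp add: homologous_refl)

lift_definition plus_HX :: "HX \<Rightarrow> HX \<Rightarrow> HX" is "(+) :: X \<Rightarrow> X \<Rightarrow> X"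
proof -
  fix p p' q q' :: X
  assume p: "homologous p p'" and q: "homologous q q'"
  then obtain a b where ab: "p + p' = dX a" "q + q' = dX b"
    by (auto simp: homologous_def)
  show "homologous (p + q) (p' + q')"
  proof (rule homologousI)
    have "p + q + (p' + q') = (p + p') + (q + q')" by (simp add: add_ac)
    then show "p + q + (p' + q') = dX (a + b)" by (simp add: ab dX_add)
  qed (use p q in \<open>simp_all add: homologous_def dX_add\<close>)
qed

lift_definition uminus_HX :: "HX \<Rightarrow> HX" is "uminus :: X \<Rightarrow> X"
  by simp

lift_definition minus_HX :: "HX \<Rightarrow> HX \<Rightarrow> HX" is "(-) :: X \<Rightarrow> X \<Rightarrow> X"
proof -
  fix p p' q q' :: X
  assume p: "homologous p p'" and q: "homologous q q'"
  then obtain a b where ab: "p + p' = dX a" "q + q' = dX b"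
    by (auto simp: homologous_def)
  show "homologous (p - q) (p' - q')"
  proof (rule homologousI)
    have "(p - q) + (p' - q') = (p + p') + (q + q')" by (simp add: add_ac)
    then show "(p - q) + (p' - q') = dX (a + b)" by (simp add: ab dX_add)
  qed (use p q in \<open>simp_all add: homologous_def dX_add\<close>)
qed

lift_definition times_HX :: "HX \<Rightarrow> HX \<Rightarrow> HX" is "(*) :: X \<Rightarrow> X \<Rightarrow> X"
proof -
  fix p p' q q' :: X
  assume p: "homologous p p'" and q: "homologous q q'"
  then obtain a b where ab: "p + p' = dX a" "q + q' = dX b"
    by (auto simp: homologous_def)
  show "homologous (p * q) (p' * q')"
  proof (rule homologousI)
    have "p' * q + (p' * q + r) = r" for r
      by (simp add: add.assoc[symmetric])
    then have "p * q + p' * q' = (p + p') * q + p' * (q + q')"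
      by (simp only: distrib_left distrib_right add.assoc)
    also have "\<dots> = dX (a * q + p' * b)"
      using p q by (simp add: ab dX_add dX_mult homologous_def)
    finally show "p * q + p' * q' = dX (a * q + p' * b)" .
  qed (use p q in \<open>simp_all add: homologous_def dX_mult\<close>)
qed

instance
proof
  fix a b c :: HX
  show "a * b * c = a * (b * c)"
    by transfer (simp add: homologous_refl dX_mult homologous_def mult.assoc)
  show "a * b = b * a"
    by transfer (simp add: homologous_refl dX_mult homologous_def mult.commute)
  show "1 * a = a"
    by transfer simp
  show "a + b + c = a + (b + c)"
    by transfer (simp add: homologous_refl dX_add homologous_def add.assoc)
  show "a + b = b + a"
    by transfer (simp add: homologous_refl dX_add homologous_def add.commute)
  show "0 + a = a"
    by transfer simp
  show "- a + a = 0"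
    by transfer (simp add: homologous_refl)
  show "a - b = a + - b"
    by transfer (simp add: homologous_refl dX_add homologous_def)
  show "(a + b) * c = a * c + b * c"
    by transfer (simp add: homologous_refl dX_add dX_mult homologous_def distrib_right)
  show "(0::HX) \<noteq> 1"
  proof transfer
    show "\<not> homologous 0 1"
      by (auto simp: homologous_def) (metis lookup_dX_0 lookup_one_zero zero_neq_one)
  qed
qed

end

lift_definition h :: "nat \<Rightarrow> HX" is "\<lambda>n. R n (n + 1)"
  by (rule homologous_refl) (simp add: dX_R atLeastSucLessThan_greaterThanLessThan[symmetric])

end

theory Submission
  imports Defs "HOL-Computational_Algebra.Polynomial"
begin

text \<open>
  Arrange the variables in a strictly upper triangular matrix \<open>M\<close>; then the differential is \<open>d M = M\<^sup>2\<close>. This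
  equation is invariant under conjugation, and the proof exploits, for each \<open>k\<close>, the conjugations that only
  involve the rows and columns \<open>k\<close> and \<open>k + 1\<close>: the shears by \<open>1 + t E\<close> with the matrix unit \<open>E\<close> in position
  \<open>(k, k + 1)\<close>, and the transposition of \<open>k\<close> and \<open>k + 1\<close>, which is only available modulo \<open>h\<^sub>k = R k (k + 1)\<close>.
  At \<open>t = 1\<close> they generate the symmetric group on three letters. The algebra is graded by degree, height (the
  sum of the \<open>j - i\<close>) and by a weight for each index, and the wall weight at \<open>k\<close> is the difference of the
  weights at \<open>k\<close> and \<open>k + 1\<close>. A shear lowers wall weights and the transposition reverses them.

  Comparing the two sides of the braid relation in one grade yields a division theorem (\<open>division\<close>): a cycle of
  positive wall weight whose higher shear coefficients bound is homologous to a multiple of \<open>h\<^sub>k\<close>. It has two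
  consequences. First, a cycle whose degree and height have opposite parity is a boundary (\<open>parity\<close>), by induction
  on the height. Secondly, for even nonnegative wall weight, \<open>h\<^sub>k u = 0\<close> in homology implies \<open>u = 0\<close>, again if the
  higher shear coefficients of \<open>u\<close> bound (\<open>even_hh_cancel\<close>). Homology classes of odd wall weight,
  on the contrary, are annihilated by \<open>h\<^sub>k\<close> (\<open>odd_hh_boundary\<close>).

  The theorem says that \<open>h\<^sub>n\<^sup>2 x = 0\<close> implies \<open>h\<^sub>n x = 0\<close>, and this is proved by induction on the height of \<open>x\<close>. The
  shear coefficients of \<open>h\<^sub>n x\<close> are \<open>h\<^sub>n\<close> times polynomials of smaller height, so they bound. There always is a
  wall \<open>k\<close> of positive weight for \<open>h\<^sub>n x\<close>. If the weight is odd, \<open>h\<^sub>n x\<close> is homologous to a multiple of \<open>h\<^sub>k\<close>, hence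
  to \<open>0\<close>. If it is even, it is enough that a power of \<open>h\<^sub>k\<close> annihilates \<open>h\<^sub>n x\<close>. For \<open>k = n\<close> this is the
  assumption, and for \<open>k = n - 1\<close> or \<open>k = n + 1\<close> it holds because \<open>h\<^sub>n h\<^sub>n\<^sub>+\<^sub>1\<close> is the boundary of \<open>R n (n + 2)\<close>. For all
  other \<open>k\<close> one inverts \<open>h\<^sub>k\<close> (\<open>localise\<close>): after a change of variables the complex becomes a tensor product of
  cones, whose homology is generated by squares, with the same complex on the indices other than \<open>k\<close> and \<open>k + 1\<close>.
  The coefficients of \<open>x\<close> there have smaller height, because a monomial of positive wall weight contains a variable
  crossing the wall, and the induction hypothesis applies to them.
\<close>

section \<open>Linear maps on polynomials in characteristic two\<close>

class char2 = comm_ring_1 +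
  assumes add_self [simp]: "x + x = 0"
begin

lemma add_self_left [simp]: "x + (x + y) = y"
  by (simp flip: add.assoc)

end

instance bit :: char2
  by standard simp

instance poly_mapping :: (cancel_comm_monoid_add, char2) char2
proof
  show "x + x = 0" for x :: "'a \<Rightarrow>\<^sub>0 'b"
    by (rule poly_mapping_eqI) (simp only: lookup_add lookup_zero add_self)
qed

instance poly :: (char2) char2
  by standard (rule poly_eqI, simp only: coeff_add coeff_0 add_self)

text \<open>Equations are turned into vanishing statements by adding instead of subtracting; the simplifier
  cancels repeated summands by the two rules of the class.\<close>

lemma char2_eqI: "x + y = 0 \<Longrightarrow> x = (y :: 'a :: char2)"
  by (metis add_self_left add.right_neutral)

type_synonym mon = "index \<Rightarrow>\<^sub>0 nat"

definition lo :: "index \<Rightarrow> nat" where "lo v = fst (Rep_index v)"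
definition hi :: "index \<Rightarrow> nat" where "hi v = snd (Rep_index v)"

abbreviation ix :: "nat \<Rightarrow> nat \<Rightarrow> index" where "ix i j \<equiv> Abs_index (i, j)"

lemma lo_less_hi: "lo v < hi v"
  using Rep_index[of v] by (auto simp: lo_def hi_def)

lemma lo_ix [simp]: "i < j \<Longrightarrow> lo (ix i j) = i"
  and hi_ix [simp]: "i < j \<Longrightarrow> hi (ix i j) = j"
  by (simp_all add: lo_def hi_def Abs_index_inverse)

lemma ix_lo_hi [simp]: "ix (lo v) (hi v) = v"
  by (simp add: lo_def hi_def Rep_index_inverse)

lemma index_eq_iff: "v = w \<longleftrightarrow> lo v = lo w \<and> hi v = hi w"
  by (metis ix_lo_hi)

lemma var_eq_R: "var v = R (lo v) (hi v)"
  by (simp add: R_def)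

lemma var_ix: "var (ix i j) = R i j"
  by (simp add: R_def)

lemma dX_var: "dX (var v) = (\<Sum>l\<in>{lo v<..<hi v}. R (lo v) l * R l (hi v))"
  by (simp add: var_eq_R dX_R lo_less_hi)

definition mnm :: "mon \<Rightarrow> X" where
  "mnm m = Poly_Mapping.single m 1"

lemma keys_mnm [simp]: "Poly_Mapping.keys (mnm m) = {m}"
  by (simp add: mnm_def)

lemma mnm_0 [simp]: "mnm 0 = 1"
  by (simp add: mnm_def)

lemma mnm_add: "mnm (m + n) = mnm m * mnm n"
  by (simp add: mnm_def mult_single)

lemma var_eq_mnm: "var v = mnm (Poly_Mapping.single v 1)"
  by (simp add: var_def mnm_def)

lemma X_eq_sum_mnm: "p = (\<Sum>m\<in>Poly_Mapping.keys p. mnm m)"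
proof -
  have "Poly_Mapping.single m (Poly_Mapping.lookup p m) = mnm m" if "m \<in> Poly_Mapping.keys p" for m
    using that by (cases "Poly_Mapping.lookup p m") (simp_all add: in_keys_iff mnm_def)
  then show ?thesis
    by (subst poly_mapping_sum_single[of p]) (rule sum.cong, simp_all)
qed

lemma X_mono_induct [case_names zero add]:
  assumes "P 0" "\<And>m p. m \<in> Poly_Mapping.keys q \<Longrightarrow> P p \<Longrightarrow> P (mnm m + p)"
  shows "P (q :: X)"
proof -
  have "P (\<Sum>m\<in>S. mnm m)" if "finite S" "S \<subseteq> Poly_Mapping.keys q" for S
    using that by (induction S rule: finite_induct) (auto intro: assms)
  then show ?thesis
    using X_eq_sum_mnm[of q] finite_keys[of q] by (metis order_refl)
qed

text \<open>Additive maps are linear over the field with two elements, hence determined by their values on monomials.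
  Ring homomorphisms, and derivations along them, are even determined by their values on the variables, so
  that identities between them need only be checked there.\<close>

definition additive_map :: "(X \<Rightarrow> 'a :: comm_ring_1) \<Rightarrow> bool" where
  "additive_map F \<longleftrightarrow> (\<forall>p q. F (p + q) = F p + F q)"

lemma additive_add: "additive_map F \<Longrightarrow> F (p + q) = F p + F q"
  by (simp add: additive_map_def)

lemma additive_0: "additive_map F \<Longrightarrow> F 0 = 0"
  using additive_add[of F 0 0] by simp

lemma additive_sum: "additive_map F \<Longrightarrow> F (sum g S) = (\<Sum>x\<in>S. F (g x))"
  by (induction S rule: infinite_finite_induct) (simp_all add: additive_0 additive_add)

lemma additive_ext:
  assumes "additive_map F" "additive_map G" "\<And>m. m \<in> Poly_Mapping.keys p \<Longrightarrow> F (mnm m) = G (mnm m)"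
  shows "F p = G p"
  by (induction p rule: X_mono_induct) (simp_all add: assms additive_0 additive_add)

definition ring_hom :: "(X \<Rightarrow> 'a :: comm_ring_1) \<Rightarrow> bool" where
  "ring_hom F \<longleftrightarrow> additive_map F \<and> (\<forall>p q. F (p * q) = F p * F q) \<and> F 1 = 1"

definition twisted_der :: "(X \<Rightarrow> 'a :: comm_ring_1) \<Rightarrow> (X \<Rightarrow> 'a) \<Rightarrow> bool" where
  "twisted_der g D \<longleftrightarrow> additive_map D \<and> (\<forall>p q. D (p * q) = D p * g q + g p * D q)"

lemma ring_hom_additive: "ring_hom F \<Longrightarrow> additive_map F"
  and ring_hom_mult: "ring_hom F \<Longrightarrow> F (p * q) = F p * F q"
  and ring_hom_1: "ring_hom F \<Longrightarrow> F 1 = 1"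
  by (simp_all add: ring_hom_def)

lemmas ring_hom_add = additive_add[OF ring_hom_additive]
  and ring_hom_0 = additive_0[OF ring_hom_additive]
  and ring_hom_sum = additive_sum[OF ring_hom_additive]

lemma ring_hom_power: "ring_hom F \<Longrightarrow> F (p ^ n) = F p ^ n"
  by (induction n) (simp_all add: ring_hom_1 ring_hom_mult)

lemma twisted_der_additive: "twisted_der g D \<Longrightarrow> additive_map D"
  and twisted_der_mult: "twisted_der g D \<Longrightarrow> D (p * q) = D p * g q + g p * D q"
  by (simp_all add: twisted_der_def)

lemmas twisted_der_add = additive_add[OF twisted_der_additive]
  and twisted_der_0 = additive_0[OF twisted_der_additive]
  and twisted_der_sum = additive_sum[OF twisted_der_additive]

lemma twisted_der_1: "twisted_der g D \<Longrightarrow> ring_hom g \<Longrightarrow> D 1 = 0"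
  using twisted_der_mult[of g D 1 1] by (simp add: ring_hom_1)

lemma ring_hom_ext:
  assumes "ring_hom F" "ring_hom G" "\<And>v. F (var v) = G (var v)"
  shows "F = G"
proof
  fix p show "F p = G p"
  proof (induction p rule: X_induct)
    case (scalar c)
    then show ?case using assms by (cases c) (simp_all add: ring_hom_0 ring_hom_1)
  qed (simp_all add: assms ring_hom_add ring_hom_mult)
qed

lemma twisted_der_ext:
  assumes "twisted_der g D" "twisted_der g E" "ring_hom g" "\<And>v. D (var v) = E (var v)"
  shows "D = E"
proof
  fix p show "D p = E p"
  proof (induction p rule: X_induct)
    case (scalar c)
    then show ?case
      using twisted_der_0[OF assms(1)] twisted_der_0[OF assms(2)] twisted_der_1[OF assms(1,3)] twisted_der_1[OF assms(2,3)]
      by (cases c) simp_all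
  qed (simp_all add: assms twisted_der_add[OF assms(1)] twisted_der_add[OF assms(2)] twisted_der_mult[OF assms(1)] twisted_der_mult[OF assms(2)])
qed

lemma twisted_der_derivation: "derivation D \<Longrightarrow> twisted_der (\<lambda>p. p) D"
  by (simp add: twisted_der_def additive_map_def derivation_def)

lemma ring_hom_id: "ring_hom (\<lambda>p. p)"
  by (simp add: ring_hom_def additive_map_def)

lemma ring_hom_comp: "ring_hom F \<Longrightarrow> ring_hom G \<Longrightarrow> ring_hom (\<lambda>p. F (G p))"
  by (simp add: ring_hom_def additive_map_def)

lemma twisted_der_ring_hom_left: "ring_hom F \<Longrightarrow> twisted_der g D \<Longrightarrow> twisted_der (\<lambda>p. F (g p)) (\<lambda>p. F (D p))"
  by (simp add: ring_hom_def additive_map_def twisted_der_def)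

lemma twisted_der_ring_hom_right: "ring_hom F \<Longrightarrow> twisted_der g D \<Longrightarrow> twisted_der (\<lambda>p. g (F p)) (\<lambda>p. D (F p))"
  by (simp add: ring_hom_def additive_map_def twisted_der_def)

lemma twisted_der_scale: "twisted_der g D \<Longrightarrow> twisted_der g (\<lambda>p. a * D p)"
  by (simp add: additive_map_def twisted_der_def algebra_simps)

text \<open>In characteristic two the anticommutator and the square of a derivation are again derivations.\<close>

lemma twisted_der_commutator:
  fixes D E :: "X \<Rightarrow> X"
  assumes "twisted_der (\<lambda>p. p) D" "twisted_der (\<lambda>p. p) E"
  shows "twisted_der (\<lambda>p. p) (\<lambda>p. D (E p) + E (D p))"
  unfolding twisted_der_def additive_map_def
proof (intro conjI allI)
  fix p q :: X
  have "a + b + (b' + c) + (c' + b + (b' + e)) = a + c' + (c + e)" for a b b' c c' e :: X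
    by (simp add: algebra_simps)
  then show "D (E (p * q)) + E (D (p * q)) = (D (E p) + E (D p)) * q + p * (D (E q) + E (D q))"
    using assms
    by (simp add: twisted_der_mult twisted_der_add algebra_simps)
qed (use assms in \<open>simp add: twisted_der_add algebra_simps\<close>)

lemma twisted_der_square:
  fixes D :: "X \<Rightarrow> X"
  assumes "twisted_der (\<lambda>p. p) D"
  shows "twisted_der (\<lambda>p. p) (\<lambda>p. D (D p))"
  unfolding twisted_der_def additive_map_def
  using assms by (auto simp: twisted_der_mult twisted_der_add algebra_simps)

definition subst_mon :: "(index \<Rightarrow> 'a :: comm_ring_1) \<Rightarrow> mon \<Rightarrow> 'a" where
  "subst_mon \<sigma> m = (\<Prod>v\<in>Poly_Mapping.keys m. \<sigma> v ^ Poly_Mapping.lookup m v)"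

definition linear_ext :: "(mon \<Rightarrow> 'a :: char2) \<Rightarrow> X \<Rightarrow> 'a" where
  "linear_ext f p = (\<Sum>m\<in>Poly_Mapping.keys p. f m)"

definition substitute :: "(index \<Rightarrow> 'a :: char2) \<Rightarrow> X \<Rightarrow> 'a" where
  "substitute \<sigma> = linear_ext (subst_mon \<sigma>)"

lemma subst_mon_superset:
  assumes "finite S" "Poly_Mapping.keys m \<subseteq> S"
  shows "subst_mon \<sigma> m = (\<Prod>v\<in>S. \<sigma> v ^ Poly_Mapping.lookup m v)"
  unfolding subst_mon_def
  by (rule prod.mono_neutral_left) (use assms in \<open>auto simp: in_keys_iff\<close>)

lemma subst_mon_add: "subst_mon \<sigma> (m + n) = subst_mon \<sigma> m * subst_mon \<sigma> n"
proof -
  let ?S = "Poly_Mapping.keys m \<union> Poly_Mapping.keys n"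
  have "Poly_Mapping.keys (m + n) \<subseteq> ?S"
    by (rule keys_add)
  then show ?thesis
    by (simp add: subst_mon_superset[of ?S] lookup_add power_add prod.distrib)
qed

lemma subst_mon_0 [simp]: "subst_mon \<sigma> 0 = 1"
  by (simp add: subst_mon_def)

lemma subst_mon_single [simp]: "subst_mon \<sigma> (Poly_Mapping.single v n) = \<sigma> v ^ n"
  by (cases "n = 0") (simp_all add: subst_mon_def)

lemma mon_induct [case_names zero add]:
  assumes "P 0" "\<And>v m. P m \<Longrightarrow> P (Poly_Mapping.single v 1 + m)"
  shows "P (m :: mon)"
proof -
  have s: "P (Poly_Mapping.single v n + m)" if "P m" for v n m
  proof (induction n)
    case (Suc n)
    have "Poly_Mapping.single v (Suc n) + m = Poly_Mapping.single v 1 + (Poly_Mapping.single v n + m)"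
      by (simp add: single_add[symmetric] add.assoc[symmetric])
    then show ?case using assms(2)[OF Suc] by simp
  qed (use that in simp)
  have "P (\<Sum>v\<in>S. Poly_Mapping.single v (f v))" if "finite S" for S and f :: "index \<Rightarrow> nat"
    using that by (induction S rule: finite_induct) (auto intro: assms(1) s)
  then show ?thesis
    using poly_mapping_sum_single[of m] finite_keys[of m] by metis
qed

lemma linear_ext_additive: "additive_map (linear_ext (f :: mon \<Rightarrow> 'a :: char2))"
  unfolding additive_map_def
proof (intro allI)
  fix p q :: X
  define bt :: "bit \<Rightarrow> 'a" where "bt b = (if b = 1 then 1 else 0)" for b
  have bt_add: "bt (a + b) = bt a + bt b" for a b
    by (cases a; cases b) (simp_all add: bt_def)
  have sup: "linear_ext f r = (\<Sum>m\<in>S. bt (Poly_Mapping.lookup r m) * f m)"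
    if "finite S" "Poly_Mapping.keys r \<subseteq> S" for r :: X and S
  proof -
    have "linear_ext f r = (\<Sum>m\<in>Poly_Mapping.keys r. bt (Poly_Mapping.lookup r m) * f m)"
      unfolding linear_ext_def
      by (rule sum.cong) (auto simp: in_keys_iff bt_def)
    also have "\<dots> = (\<Sum>m\<in>S. bt (Poly_Mapping.lookup r m) * f m)"
      by (rule sum.mono_neutral_left) (use that in \<open>auto simp: in_keys_iff bt_def\<close>)
    finally show ?thesis .
  qed
  let ?S = "Poly_Mapping.keys p \<union> Poly_Mapping.keys q"
  have "Poly_Mapping.keys (p + q) \<subseteq> ?S"
    by (rule keys_add)
  then show "linear_ext f (p + q) = linear_ext f p + linear_ext f q"
    by (simp add: sup[of ?S] lookup_add bt_add distrib_right sum.distrib del: add_bit_eq_xor)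
qed

lemma linear_ext_mnm [simp]: "linear_ext f (mnm m) = f m"
  by (simp add: linear_ext_def)

lemma substitute_additive: "additive_map (substitute \<sigma>)"
  unfolding substitute_def by (rule linear_ext_additive)

lemma substitute_mnm [simp]: "substitute \<sigma> (mnm m) = subst_mon \<sigma> m"
  by (simp add: substitute_def)

lemma ring_hom_substitute: "ring_hom (substitute \<sigma>)"
  unfolding ring_hom_def
proof (intro conjI allI)
  fix p q :: X
  have "substitute \<sigma> (mnm m * q) = subst_mon \<sigma> m * substitute \<sigma> q" for m q
    by (induction q rule: X_mono_induct)
      (simp_all add: additive_0[OF substitute_additive] additive_add[OF substitute_additive] distrib_left subst_mon_add
         flip: mnm_add)
  then show "substitute \<sigma> (p * q) = substitute \<sigma> p * substitute \<sigma> q"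
    by (induction p rule: X_mono_induct)
      (simp_all add: additive_0[OF substitute_additive] additive_add[OF substitute_additive] distrib_right)
  show "substitute \<sigma> 1 = 1"
    using substitute_mnm[of \<sigma> 0] by simp
qed (rule substitute_additive)

lemma substitute_var [simp]: "substitute \<sigma> (var v) = \<sigma> v"
  by (simp add: var_eq_mnm)

lemma extend_deriv_twisted_der: "twisted_der (\<lambda>p. p) (extend_deriv g)"
  by (rule twisted_der_derivation) (rule derivation_extend_deriv)

lemma dX_twisted_der: "twisted_der (\<lambda>p. p) dX"
  by (rule twisted_der_derivation) (rule derivation_dX)

section \<open>Gradings and boundaries\<close>

definition weight :: "(index \<Rightarrow> int) \<Rightarrow> mon \<Rightarrow> int" where
  "weight f m = (\<Sum>v\<in>Poly_Mapping.keys m. int (Poly_Mapping.lookup m v) * f v)"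

lemma weight_superset:
  assumes "finite S" "Poly_Mapping.keys m \<subseteq> S"
  shows "weight f m = (\<Sum>v\<in>S. int (Poly_Mapping.lookup m v) * f v)"
  unfolding weight_def
  by (rule sum.mono_neutral_left) (use assms in \<open>auto simp: in_keys_iff\<close>)

lemma weight_add: "weight f (m + n) = weight f m + weight f n"
proof -
  let ?S = "Poly_Mapping.keys m \<union> Poly_Mapping.keys n"
  have "Poly_Mapping.keys (m + n) \<subseteq> ?S"
    by (rule keys_add)
  then show ?thesis
    by (simp add: weight_superset[of ?S] lookup_add algebra_simps sum.distrib)
qed

lemma weight_0 [simp]: "weight f 0 = 0"
  by (simp add: weight_def)

lemma weight_single [simp]: "weight f (Poly_Mapping.single v n) = int n * f v"
  by (cases "n = 0") (simp_all add: weight_def)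

lemma weight_nonneg: "(\<And>v. f v \<ge> 0) \<Longrightarrow> weight f m \<ge> 0"
  by (simp add: weight_def sum_nonneg)

text \<open>The grading packs three quantities into one function: entry \<open>0\<close> is the polynomial degree, entry
  \<open>1\<close> the height (the sum of \<open>j - i\<close> over the factors \<open>R i j\<close>), and entry \<open>i + 2\<close> the weight at the index
  \<open>i\<close>, the number of factors starting in \<open>i\<close> minus the number of factors ending in \<open>i\<close>. The differential
  raises the degree by one and preserves everything else.\<close>

definition var_grade :: "index \<Rightarrow> nat \<Rightarrow> int" where
  "var_grade v n = (if n = 0 then 1 else if n = 1 then int (hi v) - int (lo v)
     else of_bool (n = lo v + 2) - of_bool (n = hi v + 2))"

definition grade :: "mon \<Rightarrow> nat \<Rightarrow> int" where
  "grade m n = weight (\<lambda>v. var_grade v n) m"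

lemma grade_0 [simp]: "grade 0 = (\<lambda>n. 0)"
  by (simp add: grade_def fun_eq_iff)

lemma grade_add: "grade (m + m') = (\<lambda>n. grade m n + grade m' n)"
  by (simp add: grade_def fun_eq_iff weight_add)

lemma grade_single [simp]: "grade (Poly_Mapping.single v (Suc 0)) = var_grade v"
  by (simp add: grade_def fun_eq_iff)

lemma height_nonneg: "grade m (Suc 0) \<ge> 0"
  unfolding grade_def using lo_less_hi by (intro weight_nonneg) (auto simp: var_grade_def less_imp_le)

abbreviation wt :: "mon \<Rightarrow> nat \<Rightarrow> int" where "wt m i \<equiv> grade m (i + 2)"

text \<open>If the weights were weakly increasing along the indices, then, being nonnegative at \<open>0\<close>, they would
  all be nonnegative; but the largest index that occurs has negative weight.\<close>

lemma exists_descent: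
  assumes "m \<noteq> 0"
  shows "\<exists>k. wt m k > wt m (Suc k)"
proof (rule ccontr)
  assume "\<nexists>k. wt m k > wt m (Suc k)"
  then have mono: "wt m k \<le> wt m (Suc k)" for k
    by (meson not_le)
  have "var_grade v 2 \<ge> 0" for v
    using lo_less_hi[of v] by (auto simp: var_grade_def)
  then have "wt m 0 \<ge> 0"
    unfolding grade_def by (intro weight_nonneg) (simp add: numeral_2_eq_2)
  then have nn: "wt m k \<ge> 0" for k
    using mono by (induction k) (auto intro: order_trans)
  have fin: "finite (hi ` Poly_Mapping.keys m)" "hi ` Poly_Mapping.keys m \<noteq> {}"
    using assms by auto
  define J where "J = Max (hi ` Poly_Mapping.keys m)"
  obtain v where v: "v \<in> Poly_Mapping.keys m" "hi v = J"
    using Max_in[OF fin] by (auto simp: J_def)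
  have le: "hi w \<le> J" if "w \<in> Poly_Mapping.keys m" for w
    using that fin by (simp add: J_def)
  have np: "int (Poly_Mapping.lookup m w) * var_grade w (J + 2) \<le> 0" if "w \<in> Poly_Mapping.keys m" for w
    using le[OF that] lo_less_hi[of w] by (auto simp: var_grade_def)
  have neg: "int (Poly_Mapping.lookup m v) * var_grade v (J + 2) < 0"
    using v lo_less_hi[of v] by (auto simp: var_grade_def in_keys_iff)
  have "weight (\<lambda>v. var_grade v (J + 2)) m < (\<Sum>w\<in>Poly_Mapping.keys m. 0)"
    unfolding weight_def
    by (rule sum_strict_mono_ex1) (use np neg v in auto)
  then show False
    using nn[of J] by (simp add: grade_def)
qed

definition homogeneous :: "(nat \<Rightarrow> int) \<Rightarrow> X \<Rightarrow> bool" where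
  "homogeneous c p \<longleftrightarrow> (\<forall>m\<in>Poly_Mapping.keys p. grade m = c)"

lemma homogeneous_0 [simp]: "homogeneous c 0"
  by (simp add: homogeneous_def)

lemma homogeneous_mnm: "homogeneous (grade m) (mnm m)"
  by (simp add: homogeneous_def)

lemma homogeneous_1: "homogeneous (\<lambda>n. 0) 1"
  using homogeneous_mnm[of 0] by simp

lemma homogeneous_var: "homogeneous (var_grade v) (var v)"
  by (simp add: var_eq_mnm homogeneous_def)

lemma homogeneous_add: "homogeneous c p \<Longrightarrow> homogeneous c q \<Longrightarrow> homogeneous c (p + q)"
  using keys_add[of p q] by (auto simp: homogeneous_def)

lemma homogeneous_sum: "(\<And>x. x \<in> S \<Longrightarrow> homogeneous c (f x)) \<Longrightarrow> homogeneous c (\<Sum>x\<in>S. f x)"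
  by (induction S rule: infinite_finite_induct) (auto intro: homogeneous_add)

lemma homogeneous_mult:
  assumes "homogeneous c p" "homogeneous c' q"
  shows "homogeneous (\<lambda>n. c n + c' n) (p * q)"
  using keys_mult[of p q] assms by (fastforce simp: homogeneous_def grade_add)

lemma homogeneous_cong: "homogeneous c p \<Longrightarrow> (\<And>n. c n = c' n) \<Longrightarrow> homogeneous c' p"
  by (metis ext)

text \<open>The part of a polynomial on which a function of the monomials takes a given value. Besides the
  homogeneous components it yields projections to monomials of a prescribed shape.\<close>

definition slice :: "(mon \<Rightarrow> 'a) \<Rightarrow> 'a \<Rightarrow> X \<Rightarrow> X" where
  "slice f c p = (\<Sum>m | m \<in> Poly_Mapping.keys p \<and> f m = c. mnm m)"

abbreviation component :: "(nat \<Rightarrow> int) \<Rightarrow> X \<Rightarrow> X" where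
  "component \<equiv> slice grade"

lemma lookup_sum_mnm:
  "finite S \<Longrightarrow> Poly_Mapping.lookup (\<Sum>m\<in>S. mnm m) n = (if n \<in> S then 1 else 0)"
  by (induction S rule: finite_induct)
    (auto simp: lookup_add mnm_def lookup_single when_def simp del: add_bit_eq_xor)

lemma keys_sum_mnm: "finite S \<Longrightarrow> Poly_Mapping.keys (\<Sum>m\<in>S. mnm m) = S"
  by (auto simp: in_keys_iff lookup_sum_mnm split: if_splits)

lemma lookup_slice: "Poly_Mapping.lookup (slice f c p) m = (if f m = c then Poly_Mapping.lookup p m else 0)"
proof -
  have fin: "finite {m. m \<in> Poly_Mapping.keys p \<and> f m = c}"
    by simp
  show ?thesis
    unfolding slice_def lookup_sum_mnm[OF fin]
    by (cases "Poly_Mapping.lookup p m") (simp_all add: in_keys_iff)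
qed

lemma keys_slice: "Poly_Mapping.keys (slice f c p) = {m \<in> Poly_Mapping.keys p. f m = c}"
  by (auto simp: in_keys_iff lookup_slice split: if_splits)

lemma slice_additive: "additive_map (slice f c)"
  unfolding additive_map_def
  by (intro allI poly_mapping_eqI) (simp add: lookup_slice lookup_add del: add_bit_eq_xor)

lemmas slice_add = additive_add[OF slice_additive]
  and slice_0 [simp] = additive_0[OF slice_additive]
  and slice_sum = additive_sum[OF slice_additive]

lemma slice_id: "(\<And>m. m \<in> Poly_Mapping.keys p \<Longrightarrow> f m = c) \<Longrightarrow> slice f c p = p"
  by (rule poly_mapping_eqI) (metis lookup_slice in_keys_iff)

lemma slice_other: "(\<And>m. m \<in> Poly_Mapping.keys p \<Longrightarrow> f m \<noteq> c) \<Longrightarrow> slice f c p = 0"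
  by (rule poly_mapping_eqI) (metis lookup_slice in_keys_iff lookup_zero)

lemma X_eq_sum_slice: "p = (\<Sum>c\<in>f ` Poly_Mapping.keys p. slice f c p)"
proof (rule poly_mapping_eqI)
  fix m
  have "(\<Sum>c\<in>f ` Poly_Mapping.keys p. Poly_Mapping.lookup (slice f c p) m) =
      (\<Sum>c\<in>f ` Poly_Mapping.keys p. if c = f m then Poly_Mapping.lookup p m else 0)"
    by (rule sum.cong) (auto simp: lookup_slice)
  then show "Poly_Mapping.lookup p m = Poly_Mapping.lookup (\<Sum>c\<in>f ` Poly_Mapping.keys p. slice f c p) m"
    by (auto simp: lookup_sum in_keys_iff sum.delta)
qed

lemma homogeneous_component: "homogeneous c (component c p)"
  by (simp add: homogeneous_def keys_slice)

lemma component_id: "homogeneous c p \<Longrightarrow> component c p = p"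
  by (rule slice_id) (simp add: homogeneous_def)

lemma component_other: "homogeneous c' p \<Longrightarrow> c' \<noteq> c \<Longrightarrow> component c p = 0"
  by (rule slice_other) (simp add: homogeneous_def)

text \<open>An additive map that sends polynomials of grade \<open>c\<close> to polynomials of grade \<open>s c\<close>. If \<open>s\<close> is injective,
  such a map commutes with taking components.\<close>

definition graded_map :: "((nat \<Rightarrow> int) \<Rightarrow> nat \<Rightarrow> int) \<Rightarrow> (X \<Rightarrow> X) \<Rightarrow> bool" where
  "graded_map s F \<longleftrightarrow> additive_map F \<and> (\<forall>m. homogeneous (s (grade m)) (F (mnm m)))"

lemma graded_map_homogeneous:
  assumes "graded_map s F" "homogeneous c p"
  shows "homogeneous (s c) (F p)"
proof -
  have "F p = (\<Sum>m\<in>Poly_Mapping.keys p. F (mnm m))"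
    using assms by (subst X_eq_sum_mnm[of p]) (simp add: additive_sum graded_map_def)
  then show ?thesis
    using assms by (auto simp: graded_map_def homogeneous_def[of c] intro!: homogeneous_sum)
qed

lemma graded_map_component:
  assumes "graded_map s F" "inj s"
  shows "component (s c) (F p) = F (component c p)"
proof (induction p rule: X_mono_induct)
  case zero
  then show ?case using assms by (simp add: graded_map_def additive_0)
next
  case (add m p)
  have F: "additive_map F" "homogeneous (s (grade m)) (F (mnm m))"
    using assms by (simp_all add: graded_map_def)
  have "component (s c) (F (mnm m)) = F (component c (mnm m))"
  proof (cases "grade m = c")
    case True
    then show ?thesis using F component_id[OF homogeneous_mnm[of m]] component_id[OF F(2)] by simp
  next
    case False
    then have "s (grade m) \<noteq> s c" using assms(2) by (simp add: inj_eq)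
    then show ?thesis
      using False F by (simp add: component_other[OF F(2)] component_other[OF homogeneous_mnm] additive_0)
  qed
  then show ?case
    using F add by (simp add: additive_add slice_add)
qed

lemma graded_map_ring_hom:
  assumes "ring_hom F" "\<And>v. homogeneous (s (var_grade v)) (F (var v))"
    and "s (\<lambda>n. 0) = (\<lambda>n. 0)" "\<And>c c'. s (\<lambda>n. c n + c' n) = (\<lambda>n. s c n + s c' n)"
  shows "graded_map s F"
proof -
  have "homogeneous (s (grade m)) (F (mnm m))" for m
  proof (induction m rule: mon_induct)
    case (add v m)
    have "F (mnm (Poly_Mapping.single v 1 + m)) = F (var v) * F (mnm m)"
      by (simp add: mnm_add var_eq_mnm ring_hom_mult[OF assms(1)])
    then show ?case
      using homogeneous_mult[OF assms(2) add] by (simp add: grade_add assms(4))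
  qed (use assms homogeneous_1 in \<open>simp add: ring_hom_1\<close>)
  then show ?thesis using assms by (simp add: graded_map_def ring_hom_additive)
qed

lemma graded_map_twisted_der:
  assumes "twisted_der (\<lambda>p. p) D" "\<And>v. homogeneous (\<lambda>n. var_grade v n + \<delta> n) (D (var v))"
  shows "graded_map (\<lambda>c n. c n + \<delta> n) D"
proof -
  have "homogeneous (\<lambda>n. grade m n + \<delta> n) (D (mnm m))" for m
  proof (induction m rule: mon_induct)
    case (add v m)
    have D: "D (mnm (Poly_Mapping.single v 1 + m)) = D (var v) * mnm m + var v * D (mnm m)"
      by (simp add: mnm_add var_eq_mnm twisted_der_mult[OF assms(1)])
    have "homogeneous (\<lambda>n. grade (Poly_Mapping.single v 1 + m) n + \<delta> n) (D (var v) * mnm m)"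
      by (rule homogeneous_cong[OF homogeneous_mult[OF assms(2) homogeneous_mnm]]) (simp add: grade_add)
    moreover have "homogeneous (\<lambda>n. grade (Poly_Mapping.single v 1 + m) n + \<delta> n) (var v * D (mnm m))"
      by (rule homogeneous_cong[OF homogeneous_mult[OF homogeneous_var add]]) (simp add: grade_add)
    ultimately show ?case
      unfolding D by (rule homogeneous_add)
  qed (use twisted_der_1[OF assms(1) ring_hom_id] in simp)
  then show ?thesis using assms by (simp add: graded_map_def twisted_der_additive)
qed

lemma inj_sh: "inj (\<lambda>c n. c n + \<delta> n :: int)"
  by (rule injI) (simp add: fun_eq_iff)

abbreviation deg1 :: "nat \<Rightarrow> int" where "deg1 \<equiv> \<lambda>n. of_bool (n = 0)"

lemma homogeneous_R: "i < j \<Longrightarrow> homogeneous (var_grade (ix i j)) (R i j)"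
  using homogeneous_var[of "ix i j"] by (simp add: var_ix)

lemma var_grade_ix: "i < j \<Longrightarrow> var_grade (ix i j) n = (if n = 0 then 1 else if n = 1 then int j - int i
     else of_bool (n = i + 2) - of_bool (n = j + 2))"
  by (simp add: var_grade_def)

lemma homogeneous_RR: "i < l \<Longrightarrow> l < j \<Longrightarrow> homogeneous (\<lambda>n. var_grade (ix i j) n + deg1 n) (R i l * R l j)"
  by (rule homogeneous_cong[OF homogeneous_mult[OF homogeneous_R homogeneous_R]]) (auto simp: var_grade_ix)

lemma graded_map_dX: "graded_map (\<lambda>c n. c n + deg1 n) dX"
proof (rule graded_map_twisted_der[OF dX_twisted_der])
  fix v
  show "homogeneous (\<lambda>n. var_grade v n + deg1 n) (dX (var v))"
    unfolding dX_var by (rule homogeneous_sum) (use homogeneous_RR[of "lo v" _ "hi v"] in simp)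
qed

lemma component_dX: "component (\<lambda>n. c n + deg1 n) (dX p) = dX (component c p)"
  by (rule graded_map_component[OF graded_map_dX inj_sh])

lemma component_dX': "component c (dX p) = dX (component (\<lambda>n. c n - deg1 n) p)"
  using component_dX[of "\<lambda>n. c n - deg1 n" p] by simp

definition boundary :: "X \<Rightarrow> bool" where "boundary p \<longleftrightarrow> (\<exists>y. p = dX y)"

lemma boundary_0 [simp]: "boundary 0"
  using dX_0 by (metis boundary_def)

lemma boundary_add: "boundary p \<Longrightarrow> boundary q \<Longrightarrow> boundary (p + q)"
  unfolding boundary_def by (metis dX_add)

lemma boundary_sum: "(\<And>x. x \<in> S \<Longrightarrow> boundary (f x)) \<Longrightarrow> boundary (\<Sum>x\<in>S. f x)"
  by (induction S rule: infinite_finite_induct) (auto intro: boundary_add)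

lemma boundary_dX [simp]: "boundary (dX p)"
  by (auto simp: boundary_def)

lemma boundary_cycle: "boundary p \<Longrightarrow> dX p = 0"
  by (auto simp: boundary_def)

lemma boundary_mult_cycle: "boundary p \<Longrightarrow> dX c = 0 \<Longrightarrow> boundary (c * p)"
  unfolding boundary_def by (metis dX_mult add.left_neutral mult_zero_left)

text \<open>The differential is homogeneous, so the component of the right grade of any bounding chain bounds.\<close>

lemma boundary_homE:
  assumes "boundary p" "homogeneous c p"
  obtains y where "homogeneous (\<lambda>n. c n - deg1 n) y" "p = dX y"
proof -
  obtain y where "p = dX y" using assms by (auto simp: boundary_def)
  then have "p = dX (component (\<lambda>n. c n - deg1 n) y)"
    using component_id[OF assms(2)] component_dX'[of c y] by simp
  then show ?thesis using that homogeneous_component by blast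
qed

lemma var_mult_eq: "var v * p = (\<Sum>m\<in>(+) (Poly_Mapping.single v 1) ` Poly_Mapping.keys p. mnm m)"
proof -
  have "var v * p = var v * (\<Sum>m\<in>Poly_Mapping.keys p. mnm m)"
    using X_eq_sum_mnm[of p] by simp
  also have "\<dots> = (\<Sum>m\<in>Poly_Mapping.keys p. mnm (Poly_Mapping.single v 1 + m))"
    by (simp add: sum_distrib_left var_eq_mnm mnm_add)
  also have "\<dots> = (\<Sum>m\<in>(+) (Poly_Mapping.single v 1) ` Poly_Mapping.keys p. mnm m)"
    by (subst sum.reindex) (auto intro: inj_onI)
  finally show ?thesis .
qed

lemma keys_var_mult: "Poly_Mapping.keys (var v * p) = (+) (Poly_Mapping.single v 1) ` Poly_Mapping.keys p"
  unfolding var_mult_eq by (rule keys_sum_mnm) simp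

lemma var_mult_cancel: "var v * p = var v * q \<Longrightarrow> p = q"
proof -
  assume "var v * p = var v * q"
  then have "var v * (p + q) = 0" by (simp add: distrib_left)
  then have "Poly_Mapping.keys (p + q) = {}"
    using keys_var_mult[of v "p + q"] by simp
  then have "p + q = 0" by simp
  then show "p = q" by (rule char2_eqI)
qed

lemma homogeneous_heightD: "homogeneous c p \<Longrightarrow> p \<noteq> 0 \<Longrightarrow> c (Suc 0) \<ge> 0"
  using height_nonneg by (metis all_not_in_conv homogeneous_def keys_eq_empty)

section \<open>Conjugation by elementary matrices\<close>

definition const_poly :: "X \<Rightarrow> X poly" where "const_poly a = [:a:]"
definition t_poly :: "X poly" where "t_poly = [:0, 1:]"

lemma const_poly_0 [simp]: "const_poly 0 = 0" and const_poly_1 [simp]: "const_poly 1 = 1"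
  and const_poly_add: "const_poly (a + b) = const_poly a + const_poly b" and const_poly_mult: "const_poly (a * b) = const_poly a * const_poly b"
  by (simp_all add: const_poly_def)

lemma const_poly_sum: "const_poly (sum f S) = (\<Sum>x\<in>S. const_poly (f x))"
  by (induction S rule: infinite_finite_induct) (simp_all add: const_poly_add)

definition d_poly :: "X poly \<Rightarrow> X poly" where "d_poly = map_poly dX"

lemma coeff_d_poly: "coeff (d_poly q) n = dX (coeff q n)"
  by (simp add: d_poly_def coeff_map_poly)

lemma d_poly_add: "d_poly (p + q) = d_poly p + d_poly q"
  by (rule poly_eqI) (simp add: coeff_d_poly dX_add)

lemma d_poly_mult: "d_poly (p * q) = d_poly p * q + p * d_poly q"
  by (rule poly_eqI) (simp add: coeff_d_poly coeff_mult dX_sum dX_mult sum.distrib)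

lemma d_poly_const_poly: "d_poly (const_poly a) = const_poly (dX a)"
  by (rule poly_eqI) (simp add: coeff_d_poly const_poly_def coeff_pCons split: nat.split)

lemma d_poly_t_poly: "d_poly t_poly = 0"
  by (rule poly_eqI) (simp add: coeff_d_poly t_poly_def coeff_pCons split: nat.split)

lemma sum_inner_split:
  fixes f :: "nat \<Rightarrow> 'a :: comm_monoid_add"
  assumes "i < k" "Suc k < j"
  shows "(\<Sum>l\<in>{i<..<j}. f l) = f k + f (Suc k) + (\<Sum>l\<in>{i<..<k}. f l) + (\<Sum>l\<in>{Suc k<..<j}. f l)"
proof -
  have "{i<..<j} = insert k (insert (Suc k) ({i<..<k} \<union> {Suc k<..<j}))"
    using assms by auto
  moreover have "{i<..<k} \<inter> {Suc k<..<j} = {}" by auto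
  ultimately show ?thesis
    by (simp add: sum.union_disjoint add.assoc)
qed

lemma sum_first_split:
  fixes f :: "nat \<Rightarrow> 'a :: comm_monoid_add"
  assumes "Suc k < j"
  shows "(\<Sum>l\<in>{k<..<j}. f l) = f (Suc k) + (\<Sum>l\<in>{Suc k<..<j}. f l)"
proof -
  have "{k<..<j} = insert (Suc k) {Suc k<..<j}"
    using assms by auto
  then show ?thesis by simp
qed

lemma sum_last_split:
  fixes f :: "nat \<Rightarrow> 'a :: comm_monoid_add"
  assumes "i < k"
  shows "(\<Sum>l\<in>{i<..<Suc k}. f l) = f k + (\<Sum>l\<in>{i<..<k}. f l)"
proof -
  have "{i<..<Suc k} = insert k {i<..<k}"
    using assms by auto
  then show ?thesis by simp
qed

text \<open>The position of an entry of a strictly upper triangular matrix relative to the rows and columns \<open>k\<close>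
  and \<open>k + 1\<close>. Identities between maps attached to \<open>k\<close> are checked case by case.\<close>

lemma index_cases:
  fixes k :: nat and v :: index
  obtains (wall) "v = ix k (Suc k)"
  | (row) j where "v = ix k j" "Suc k < j"
  | (row') j where "v = ix (Suc k) j" "Suc k < j"
  | (col) i where "v = ix i k" "i < k"
  | (col') i where "v = ix i (Suc k)" "i < k"
  | (across) i j where "v = ix i j" "i < k" "Suc k < j"
  | (away) i j where "v = ix i j" "i < j" "j < k \<or> Suc k < i"
proof -
  obtain i j where v: "v = ix i j" "i < j"
    using lo_less_hi ix_lo_hi by metis
  consider "i = k \<and> j = Suc k" | "i = k \<and> Suc k < j" | "i = Suc k" | "j = k" | "j = Suc k \<and> i < k"
    | "i < k \<and> Suc k < j" | "j < k \<or> Suc k < i"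
    using v(2) by linarith
  then show ?thesis
    using v that by cases auto
qed

definition on_row :: "nat \<Rightarrow> index \<Rightarrow> bool" where "on_row k v \<longleftrightarrow> lo v = k \<and> Suc k < hi v"
definition on_col :: "nat \<Rightarrow> index \<Rightarrow> bool" where "on_col k v \<longleftrightarrow> hi v = Suc k \<and> lo v < k"

text \<open>Write \<open>M\<close> for the strictly upper triangular matrix of the variables, so that the differential is
  \<open>d M = M\<^sup>2\<close>, and \<open>E\<close> for the matrix unit in position \<open>(k, k + 1)\<close>. The ring homomorphism \<open>shear k\<close> replaces
  \<open>M\<close> by its conjugate under \<open>1 + t E\<close>, where \<open>t\<close> is a polynomial variable. As the equation \<open>d M = M\<^sup>2\<close> is
  invariant under conjugation, it commutes with the differential.\<close>

definition shear :: "nat \<Rightarrow> X \<Rightarrow> X poly" where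
  "shear k = substitute (\<lambda>v. if on_row k v then const_poly (var v) + t_poly * const_poly (R (Suc k) (hi v))
     else if on_col k v then const_poly (var v) + t_poly * const_poly (R (lo v) k) else const_poly (var v))"

text \<open>The coefficient of \<open>t\<close> in the conjugation, that is, the commutator with \<open>E\<close>.\<close>

definition lower :: "nat \<Rightarrow> X \<Rightarrow> X" where
  "lower k = extend_deriv (\<lambda>v. if on_row k v then R (Suc k) (hi v)
     else if on_col k v then R (lo v) k else 0)"

text \<open>The commutator with the transpose of \<open>E\<close>, with the diagonal entries and the entry below the diagonal,
  which are not variables, left out. Leaving them out is why it commutes with the differential only up to
  a multiple of \<open>R k (k + 1)\<close>.\<close>

definition raise :: "nat \<Rightarrow> X \<Rightarrow> X" where
  "raise k = extend_deriv (\<lambda>v. if lo v = Suc k then R k (hi v)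
     else if hi v = k then R (lo v) (Suc k) else 0)"

definition wall_pderiv :: "nat \<Rightarrow> X \<Rightarrow> X" where
  "wall_pderiv k = extend_deriv (\<lambda>v. if v = ix k (Suc k) then 1 else 0)"

text \<open>On a homogeneous polynomial this is multiplication by the parity of the difference of the weights at
  \<open>k\<close> and \<open>k + 1\<close>.\<close>

definition euler :: "nat \<Rightarrow> X \<Rightarrow> X" where
  "euler k = extend_deriv (\<lambda>v. if on_row k v \<or> on_col k v \<or> lo v = Suc k \<or> hi v = k then var v else 0)"

definition kill_wall :: "nat \<Rightarrow> X \<Rightarrow> X" where
  "kill_wall k = substitute (\<lambda>v. if v = ix k (Suc k) then 0 else var v)"

text \<open>Conjugation by the transposition of \<open>k\<close> and \<open>k + 1\<close>. The entry at \<open>(k, k + 1)\<close> would move below the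
  diagonal and is set to zero, so identities that involve this map hold modulo that entry.\<close>

definition swap :: "nat \<Rightarrow> X \<Rightarrow> X" where
  "swap k = substitute (\<lambda>v. if v = ix k (Suc k) then 0 else if on_row k v then R (Suc k) (hi v)
     else if on_col k v then R (lo v) k else if lo v = Suc k then R k (hi v)
     else if hi v = k then R (lo v) (Suc k) else var v)"

definition unit_shear :: "nat \<Rightarrow> X \<Rightarrow> X" where
  "unit_shear k p = poly (shear k p) 1"

lemma twisted_der_lower: "twisted_der (\<lambda>p. p) (lower k)"
  and twisted_der_raise: "twisted_der (\<lambda>p. p) (raise k)"
  and twisted_der_wall_pderiv: "twisted_der (\<lambda>p. p) (wall_pderiv k)"
  and twisted_der_euler: "twisted_der (\<lambda>p. p) (euler k)"
  unfolding lower_def raise_def wall_pderiv_def euler_def by (rule extend_deriv_twisted_der)+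

lemma ring_hom_shear: "ring_hom (shear k)" and ring_hom_kill_wall: "ring_hom (kill_wall k)" and ring_hom_swap: "ring_hom (swap k)"
  unfolding shear_def kill_wall_def swap_def by (rule ring_hom_substitute)+

lemma ix_eq_iff: "i < j \<Longrightarrow> i' < j' \<Longrightarrow> ix i j = ix i' j' \<longleftrightarrow> i = i' \<and> j = j'"
  by (simp add: index_eq_iff)

lemmas on_defs = on_row_def on_col_def

lemma ext_R: "extend_deriv g (R i j) = g (ix i j)"
  by (simp add: extend_deriv_var flip: var_ix)

lemma substitute_R: "substitute \<sigma> (R i j) = \<sigma> (ix i j)"
  by (simp flip: var_ix)

lemma shear_R:
  "shear k (R k (Suc k)) = const_poly (R k (Suc k))"
  "Suc k < j \<Longrightarrow> shear k (R k j) = const_poly (R k j) + t_poly * const_poly (R (Suc k) j)"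
  "Suc k < j \<Longrightarrow> shear k (R (Suc k) j) = const_poly (R (Suc k) j)"
  "i < k \<Longrightarrow> shear k (R i k) = const_poly (R i k)"
  "i < k \<Longrightarrow> shear k (R i (Suc k)) = const_poly (R i (Suc k)) + t_poly * const_poly (R i k)"
  "i < k \<Longrightarrow> Suc k < j \<Longrightarrow> shear k (R i j) = const_poly (R i j)"
  "i < j \<Longrightarrow> j < k \<Longrightarrow> shear k (R i j) = const_poly (R i j)"
  "i < j \<Longrightarrow> Suc k < i \<Longrightarrow> shear k (R i j) = const_poly (R i j)"
  by (auto simp: shear_def substitute_R on_defs var_ix)

lemma lower_R:
  "lower k (R k (Suc k)) = 0"
  "Suc k < j \<Longrightarrow> lower k (R k j) = R (Suc k) j"
  "Suc k < j \<Longrightarrow> lower k (R (Suc k) j) = 0"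
  "i < k \<Longrightarrow> lower k (R i k) = 0"
  "i < k \<Longrightarrow> lower k (R i (Suc k)) = R i k"
  "i < k \<Longrightarrow> Suc k < j \<Longrightarrow> lower k (R i j) = 0"
  "i < j \<Longrightarrow> j < k \<Longrightarrow> lower k (R i j) = 0"
  "i < j \<Longrightarrow> Suc k < i \<Longrightarrow> lower k (R i j) = 0"
  by (auto simp: lower_def ext_R on_defs)

lemma raise_R:
  "raise k (R k (Suc k)) = 0"
  "Suc k < j \<Longrightarrow> raise k (R k j) = 0"
  "Suc k < j \<Longrightarrow> raise k (R (Suc k) j) = R k j"
  "i < k \<Longrightarrow> raise k (R i k) = R i (Suc k)"
  "i < k \<Longrightarrow> raise k (R i (Suc k)) = 0"
  "i < k \<Longrightarrow> Suc k < j \<Longrightarrow> raise k (R i j) = 0"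
  "i < j \<Longrightarrow> j < k \<Longrightarrow> raise k (R i j) = 0"
  "i < j \<Longrightarrow> Suc k < i \<Longrightarrow> raise k (R i j) = 0"
  by (auto simp: raise_def ext_R)

lemma wall_pderiv_R:
  "wall_pderiv k (R k (Suc k)) = 1"
  "Suc k < j \<Longrightarrow> wall_pderiv k (R k j) = 0"
  "Suc k < j \<Longrightarrow> wall_pderiv k (R (Suc k) j) = 0"
  "i < k \<Longrightarrow> wall_pderiv k (R i k) = 0"
  "i < k \<Longrightarrow> wall_pderiv k (R i (Suc k)) = 0"
  "i < k \<Longrightarrow> Suc k < j \<Longrightarrow> wall_pderiv k (R i j) = 0"
  "i < j \<Longrightarrow> j < k \<Longrightarrow> wall_pderiv k (R i j) = 0"
  "i < j \<Longrightarrow> Suc k < i \<Longrightarrow> wall_pderiv k (R i j) = 0"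
  by (auto simp: wall_pderiv_def ext_R ix_eq_iff)

lemma euler_R:
  "euler k (R k (Suc k)) = 0"
  "Suc k < j \<Longrightarrow> euler k (R k j) = R k j"
  "Suc k < j \<Longrightarrow> euler k (R (Suc k) j) = R (Suc k) j"
  "i < k \<Longrightarrow> euler k (R i k) = R i k"
  "i < k \<Longrightarrow> euler k (R i (Suc k)) = R i (Suc k)"
  "i < k \<Longrightarrow> Suc k < j \<Longrightarrow> euler k (R i j) = 0"
  "i < j \<Longrightarrow> j < k \<Longrightarrow> euler k (R i j) = 0"
  "i < j \<Longrightarrow> Suc k < i \<Longrightarrow> euler k (R i j) = 0"
  by (auto simp: euler_def ext_R on_defs var_ix)

lemma kill_wall_R:
  "kill_wall k (R k (Suc k)) = 0"
  "Suc k < j \<Longrightarrow> kill_wall k (R k j) = R k j"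
  "Suc k < j \<Longrightarrow> kill_wall k (R (Suc k) j) = R (Suc k) j"
  "i < k \<Longrightarrow> kill_wall k (R i k) = R i k"
  "i < k \<Longrightarrow> kill_wall k (R i (Suc k)) = R i (Suc k)"
  "i < k \<Longrightarrow> Suc k < j \<Longrightarrow> kill_wall k (R i j) = R i j"
  "i < j \<Longrightarrow> j < k \<Longrightarrow> kill_wall k (R i j) = R i j"
  "i < j \<Longrightarrow> Suc k < i \<Longrightarrow> kill_wall k (R i j) = R i j"
  by (auto simp: kill_wall_def substitute_R ix_eq_iff var_ix)

lemma swap_R:
  "swap k (R k (Suc k)) = 0"
  "Suc k < j \<Longrightarrow> swap k (R k j) = R (Suc k) j"
  "Suc k < j \<Longrightarrow> swap k (R (Suc k) j) = R k j"
  "i < k \<Longrightarrow> swap k (R i k) = R i (Suc k)"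
  "i < k \<Longrightarrow> swap k (R i (Suc k)) = R i k"
  "i < k \<Longrightarrow> Suc k < j \<Longrightarrow> swap k (R i j) = R i j"
  "i < j \<Longrightarrow> j < k \<Longrightarrow> swap k (R i j) = R i j"
  "i < j \<Longrightarrow> Suc k < i \<Longrightarrow> swap k (R i j) = R i j"
  by (auto simp: swap_def substitute_R ix_eq_iff on_defs var_ix)

lemma dX_cases:
  "dX (R k (Suc k)) = 0"
  "Suc k < j \<Longrightarrow> dX (R k j) = R k (Suc k) * R (Suc k) j + (\<Sum>l\<in>{Suc k<..<j}. R k l * R l j)"
  "Suc k < j \<Longrightarrow> dX (R (Suc k) j) = (\<Sum>l\<in>{Suc k<..<j}. R (Suc k) l * R l j)"
  "i < k \<Longrightarrow> dX (R i k) = (\<Sum>l\<in>{i<..<k}. R i l * R l k)"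
  "i < k \<Longrightarrow> dX (R i (Suc k)) = R k (Suc k) * R i k + (\<Sum>l\<in>{i<..<k}. R i l * R l (Suc k))"
  "i < k \<Longrightarrow> Suc k < j \<Longrightarrow> dX (R i j) = R i k * R k j + R i (Suc k) * R (Suc k) j
     + (\<Sum>l\<in>{i<..<k}. R i l * R l j) + (\<Sum>l\<in>{Suc k<..<j}. R i l * R l j)"
  "i < j \<Longrightarrow> j < k \<Longrightarrow> dX (R i j) = (\<Sum>l\<in>{i<..<j}. R i l * R l j)"
  "i < j \<Longrightarrow> Suc k < i \<Longrightarrow> dX (R i j) = (\<Sum>l\<in>{i<..<j}. R i l * R l j)"
proof -
  have "{k<..<Suc k} = {}" by auto
  then show "dX (R k (Suc k)) = 0" by (simp add: dX_R)
  show "i < k \<Longrightarrow> dX (R i (Suc k)) = R k (Suc k) * R i k + (\<Sum>l\<in>{i<..<k}. R i l * R l (Suc k))"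
    by (simp add: dX_R sum_last_split mult.commute)
qed (simp_all add: dX_R sum_inner_split sum_first_split)

lemma d_poly_shear: "d_poly (shear k p) = shear k (dX p)"
proof -
  have 1: "twisted_der (shear k) (\<lambda>p. d_poly (shear k p))"
    by (simp add: twisted_der_def additive_map_def ring_hom_add[OF ring_hom_shear] ring_hom_mult[OF ring_hom_shear] d_poly_add d_poly_mult)
  have 2: "twisted_der (shear k) (\<lambda>p. shear k (dX p))"
    by (rule twisted_der_ring_hom_left[OF ring_hom_shear dX_twisted_der])
  note L = ring_hom_add[OF ring_hom_shear] ring_hom_mult[OF ring_hom_shear] ring_hom_sum[OF ring_hom_shear] d_poly_add d_poly_mult d_poly_const_poly d_poly_t_poly
    const_poly_add const_poly_mult const_poly_sum
  have v: "d_poly (shear k (var v)) = shear k (dX (var v))" for v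
    by (cases v rule: index_cases[of _ k])
      (auto simp: var_ix dX_cases[where k=k] shear_R L ring_hom_0[OF ring_hom_shear] algebra_simps sum.distrib sum_distrib_left
        intro!: sum.cong)
  show ?thesis
    by (rule fun_cong[OF twisted_der_ext[OF 1 2 ring_hom_shear v]])
qed

text \<open>The infinitesimal conjugation is null homotopic: the homotopy is the partial derivative with respect to
  \<open>R k (k + 1)\<close>.\<close>

lemma lower_eq: "lower k p = dX (wall_pderiv k p) + wall_pderiv k (dX p)"
proof -
  have v: "lower k (var v) = dX (wall_pderiv k (var v)) + wall_pderiv k (dX (var v))" for v
    by (cases v rule: index_cases[of _ k])
      (auto simp: var_ix dX_cases[where k=k] lower_R wall_pderiv_R twisted_der_add[OF twisted_der_wall_pderiv] twisted_der_mult[OF twisted_der_wall_pderiv]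
        twisted_der_sum[OF twisted_der_wall_pderiv] twisted_der_0[OF twisted_der_wall_pderiv])
  show ?thesis
    by (rule fun_cong[OF twisted_der_ext[OF twisted_der_lower twisted_der_commutator[OF dX_twisted_der twisted_der_wall_pderiv] ring_hom_id v]])
qed

lemma lower_lower [simp]: "lower k (lower k p) = 0"
proof -
  have 0: "twisted_der (\<lambda>p. p) (\<lambda>p. 0 :: X)" by (simp add: twisted_der_def additive_map_def)
  have v: "lower k (lower k (var v)) = 0" for v
    by (cases v rule: index_cases[of _ k]) (auto simp: var_ix lower_R twisted_der_0[OF twisted_der_lower])
  show ?thesis
    by (rule fun_cong[OF twisted_der_ext[OF twisted_der_square[OF twisted_der_lower] 0 ring_hom_id v]])
qed

lemma raise_dX: "raise k (dX p) + dX (raise k p) = R k (Suc k) * euler k p"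
proof -
  note L = twisted_der_add[OF twisted_der_raise] twisted_der_mult[OF twisted_der_raise] twisted_der_sum[OF twisted_der_raise] twisted_der_0[OF twisted_der_raise]
  have v: "raise k (dX (var v)) + dX (raise k (var v)) = R k (Suc k) * euler k (var v)" for v
    by (cases v rule: index_cases[of _ k])
      (auto simp: var_ix dX_cases[where k=k] raise_R euler_R L algebra_simps)
  show ?thesis
    by (rule fun_cong[OF twisted_der_ext[OF twisted_der_commutator[OF twisted_der_raise dX_twisted_der] twisted_der_scale[OF twisted_der_euler] ring_hom_id v]])
qed

lemma lower_raise: "lower k (raise k p) + raise k (lower k p) = euler k p"
proof -
  have v: "lower k (raise k (var v)) + raise k (lower k (var v)) = euler k (var v)" for v
    by (cases v rule: index_cases[of _ k])
      (auto simp: var_ix lower_R raise_R euler_R twisted_der_0[OF twisted_der_lower] twisted_der_0[OF twisted_der_raise])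
  show ?thesis
    by (rule fun_cong[OF twisted_der_ext[OF twisted_der_commutator[OF twisted_der_lower twisted_der_raise] twisted_der_euler ring_hom_id v]])
qed

lemma kill_wall_swap [simp]: "kill_wall k (swap k p) = swap k p"
proof -
  have v: "kill_wall k (swap k (var v)) = swap k (var v)" for v
    by (cases v rule: index_cases[of _ k]) (auto simp: var_ix kill_wall_R swap_R ring_hom_0[OF ring_hom_kill_wall])
  show ?thesis
    by (rule fun_cong[OF ring_hom_ext[OF ring_hom_comp[OF ring_hom_kill_wall ring_hom_swap] ring_hom_swap v]])
qed

lemma swap_kill_wall [simp]: "swap k (kill_wall k p) = swap k p"
proof -
  have v: "swap k (kill_wall k (var v)) = swap k (var v)" for v
    by (cases v rule: index_cases[of _ k]) (auto simp: var_ix kill_wall_R swap_R ring_hom_0[OF ring_hom_swap])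
  show ?thesis
    by (rule fun_cong[OF ring_hom_ext[OF ring_hom_comp[OF ring_hom_swap ring_hom_kill_wall] ring_hom_swap v]])
qed

lemma swap_swap [simp]: "swap k (swap k p) = kill_wall k p"
proof -
  have v: "swap k (swap k (var v)) = kill_wall k (var v)" for v
    by (cases v rule: index_cases[of _ k]) (auto simp: var_ix kill_wall_R swap_R ring_hom_0[OF ring_hom_swap])
  show ?thesis
    by (rule fun_cong[OF ring_hom_ext[OF ring_hom_comp[OF ring_hom_swap ring_hom_swap] ring_hom_kill_wall v]])
qed

lemma swap_dX: "swap k (dX p) = kill_wall k (dX (swap k p))"
proof -
  note L = ring_hom_add[OF ring_hom_swap] ring_hom_mult[OF ring_hom_swap] ring_hom_sum[OF ring_hom_swap]
    ring_hom_add[OF ring_hom_kill_wall] ring_hom_mult[OF ring_hom_kill_wall] ring_hom_sum[OF ring_hom_kill_wall] ring_hom_0[OF ring_hom_swap] ring_hom_0[OF ring_hom_kill_wall]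
  have v: "swap k (dX (var v)) = kill_wall k (dX (swap k (var v)))" for v
    by (cases v rule: index_cases[of _ k])
      (auto simp: var_ix dX_cases[where k=k] swap_R kill_wall_R L add_ac intro!: sum.cong)
  have t: "twisted_der (swap k) (\<lambda>p. kill_wall k (dX (swap k p)))"
    using twisted_der_ring_hom_left[OF ring_hom_kill_wall[of k] twisted_der_ring_hom_right[OF ring_hom_swap[of k] dX_twisted_der]] by simp
  show ?thesis
    by (rule fun_cong[OF twisted_der_ext[OF twisted_der_ring_hom_left[OF ring_hom_swap dX_twisted_der] t ring_hom_swap v]])
qed

lemma swap_lower_swap: "swap k (lower k (swap k p)) = kill_wall k (raise k p)"
proof -
  note L = ring_hom_0[OF ring_hom_swap] ring_hom_0[OF ring_hom_kill_wall] twisted_der_0[OF twisted_der_lower]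
  have v: "swap k (lower k (swap k (var v))) = kill_wall k (raise k (var v))" for v
    by (cases v rule: index_cases[of _ k]) (auto simp: var_ix lower_R raise_R swap_R kill_wall_R L)
  have t: "twisted_der (kill_wall k) (\<lambda>p. swap k (lower k (swap k p)))"
    using twisted_der_ring_hom_left[OF ring_hom_swap[of k] twisted_der_ring_hom_right[OF ring_hom_swap[of k] twisted_der_lower[of k]]] by simp
  show ?thesis
    by (rule fun_cong[OF twisted_der_ext[OF t twisted_der_ring_hom_left[OF ring_hom_kill_wall twisted_der_raise] ring_hom_kill_wall v]])
qed

lemma ring_hom_unit_shear: "ring_hom (unit_shear k)"
  unfolding ring_hom_def additive_map_def unit_shear_def
  by (simp add: ring_hom_add[OF ring_hom_shear] ring_hom_mult[OF ring_hom_shear] ring_hom_1[OF ring_hom_shear])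

lemma poly_const_poly [simp]: "poly (const_poly a) x = a" "poly t_poly x = x"
  by (simp_all add: const_poly_def t_poly_def)

lemma unit_shear_R:
  "unit_shear k (R k (Suc k)) = R k (Suc k)"
  "Suc k < j \<Longrightarrow> unit_shear k (R k j) = R k j + R (Suc k) j"
  "Suc k < j \<Longrightarrow> unit_shear k (R (Suc k) j) = R (Suc k) j"
  "i < k \<Longrightarrow> unit_shear k (R i k) = R i k"
  "i < k \<Longrightarrow> unit_shear k (R i (Suc k)) = R i (Suc k) + R i k"
  "i < k \<Longrightarrow> Suc k < j \<Longrightarrow> unit_shear k (R i j) = R i j"
  "i < j \<Longrightarrow> j < k \<Longrightarrow> unit_shear k (R i j) = R i j"
  "i < j \<Longrightarrow> Suc k < i \<Longrightarrow> unit_shear k (R i j) = R i j"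
  by (auto simp: unit_shear_def shear_R)

text \<open>Conjugation by \<open>1 + E\<close> and by the transposition are the two generating involutions of the group of
  invertible two by two matrices over the field with two elements. This is the symmetric group on three
  letters, and the identity is its braid relation.\<close>

lemma braid: "unit_shear k (swap k p) = swap k (unit_shear k (swap k (unit_shear k p)))"
proof -
  note L = ring_hom_0[OF ring_hom_swap] ring_hom_0[OF ring_hom_unit_shear] ring_hom_add[OF ring_hom_swap] ring_hom_add[OF ring_hom_unit_shear]
  have v: "unit_shear k (swap k (var v)) = swap k (unit_shear k (swap k (unit_shear k (var v))))" for v
    by (cases v rule: index_cases[of _ k]) (auto simp: var_ix unit_shear_R swap_R L add_ac)
  show ?thesis
    by (rule fun_cong[OF ring_hom_ext[OF ring_hom_comp[OF ring_hom_unit_shear ring_hom_swap]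
      ring_hom_comp[OF ring_hom_swap ring_hom_comp[OF ring_hom_unit_shear ring_hom_comp[OF ring_hom_swap ring_hom_unit_shear]]] v]])
qed

lemma unit_shear_kill_wall: "unit_shear k (kill_wall k p) = kill_wall k (unit_shear k p)"
proof -
  note L = ring_hom_0[OF ring_hom_unit_shear] ring_hom_0[OF ring_hom_kill_wall] ring_hom_add[OF ring_hom_kill_wall]
  have v: "unit_shear k (kill_wall k (var v)) = kill_wall k (unit_shear k (var v))" for v
    by (cases v rule: index_cases[of _ k]) (auto simp: var_ix unit_shear_R kill_wall_R L)
  show ?thesis
    by (rule fun_cong[OF ring_hom_ext[OF ring_hom_comp[OF ring_hom_unit_shear ring_hom_kill_wall] ring_hom_comp[OF ring_hom_kill_wall ring_hom_unit_shear] v]])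
qed

definition shear_coeff :: "nat \<Rightarrow> nat \<Rightarrow> X \<Rightarrow> X" where
  "shear_coeff k j p = coeff (shear k p) j"

lemma shear_coeff_additive: "additive_map (shear_coeff k j)"
  by (simp add: additive_map_def shear_coeff_def ring_hom_add[OF ring_hom_shear])

lemma dX_shear_coeff: "dX (shear_coeff k j p) = shear_coeff k j (dX p)"
  by (simp add: shear_coeff_def coeff_d_poly flip: d_poly_shear)

lemma unit_shear_eq_sum: "unit_shear k p = (\<Sum>j\<le>degree (shear k p). shear_coeff k j p)"
  by (simp add: unit_shear_def shear_coeff_def poly_altdef)

lemma dX_unit_shear: "dX (unit_shear k p) = unit_shear k (dX p)"
proof -
  have "poly (d_poly q) 1 = dX (poly q 1)" for q
  proof -
    have "degree (d_poly q) \<le> degree q"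
      by (rule degree_le) (simp add: coeff_d_poly coeff_eq_0)
    then have "poly (d_poly q) 1 = (\<Sum>j\<le>degree q. coeff (d_poly q) j)"
      unfolding poly_altdef power_one mult_1_right
      by (intro sum.mono_neutral_left) (auto simp: coeff_eq_0)
    then show ?thesis by (simp add: poly_altdef coeff_d_poly dX_sum)
  qed
  then show ?thesis by (simp add: unit_shear_def flip: d_poly_shear)
qed

text \<open>The constant coefficient of a ring homomorphism to polynomials is a ring homomorphism, so it suffices to
  compare the values on variables.\<close>

lemma shear_coeff_0 [simp]: "shear_coeff k 0 p = p"
proof -
  have r: "ring_hom (shear_coeff k 0)"
    unfolding ring_hom_def additive_map_def shear_coeff_def
    by (simp add: ring_hom_add[OF ring_hom_shear] ring_hom_mult[OF ring_hom_shear] ring_hom_1[OF ring_hom_shear] coeff_mult)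
  have v: "shear_coeff k 0 (var v) = var v" for v
    by (simp add: shear_coeff_def shear_def const_poly_def t_poly_def)
  then show ?thesis by (rule fun_cong[OF ring_hom_ext[OF r ring_hom_id]])
qed

definition lower_poly :: "nat \<Rightarrow> X poly \<Rightarrow> X poly" where "lower_poly k = map_poly (lower k)"

lemma coeff_lower_poly: "coeff (lower_poly k q) n = lower k (coeff q n)"
  by (simp add: lower_poly_def coeff_map_poly twisted_der_0[OF twisted_der_lower])

lemma lower_poly_add: "lower_poly k (p + q) = lower_poly k p + lower_poly k q"
  by (rule poly_eqI) (simp add: coeff_lower_poly twisted_der_add[OF twisted_der_lower])

lemma lower_poly_mult: "lower_poly k (p * q) = lower_poly k p * q + p * lower_poly k q"
  by (rule poly_eqI) (simp add: coeff_lower_poly coeff_mult twisted_der_sum[OF twisted_der_lower] twisted_der_mult[OF twisted_der_lower] sum.distrib)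

lemma lower_poly_const_poly: "lower_poly k (const_poly a) = const_poly (lower k a)" and lower_poly_t_poly: "lower_poly k t_poly = 0"
  using twisted_der_1[OF twisted_der_lower ring_hom_id, of k]
  by (auto intro!: poly_eqI simp: coeff_lower_poly const_poly_def t_poly_def coeff_pCons twisted_der_0[OF twisted_der_lower] split: nat.split)

definition poly_deriv :: "X poly \<Rightarrow> X poly" where
  "poly_deriv q = (\<Sum>i\<le>degree q. monom (of_nat i * coeff q i) (i - 1))"

lemma coeff_poly_deriv: "coeff (poly_deriv q) n = of_nat (Suc n) * coeff q (Suc n)"
proof -
  have "coeff (poly_deriv q) n = (\<Sum>i\<le>degree q. if i = Suc n then of_nat i * coeff q i else 0)"
    unfolding poly_deriv_def coeff_sum
  proof (rule sum.cong[OF refl])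
    show "coeff (monom (of_nat i * coeff q i) (i - 1)) n = (if i = Suc n then of_nat i * coeff q i else 0)" for i
      by (cases i) (simp_all del: of_nat_Suc)
  qed
  then show ?thesis
    by (auto simp: sum.delta coeff_eq_0)
qed

lemma poly_deriv_add: "poly_deriv (p + q) = poly_deriv p + poly_deriv q"
  by (rule poly_eqI) (simp add: coeff_poly_deriv distrib_left del: of_nat_Suc)

lemma poly_deriv_mult: "poly_deriv (p * q) = poly_deriv p * q + p * poly_deriv q"
proof (rule poly_eqI)
  fix n
  let ?a = "coeff p" and ?b = "coeff q"
  have "coeff (poly_deriv (p * q)) n = (\<Sum>i\<le>Suc n. of_nat (Suc n) * (?a i * ?b (Suc n - i)))"
    by (simp only: coeff_poly_deriv coeff_mult sum_distrib_left)
  also have "\<dots> = (\<Sum>i\<le>Suc n. of_nat i * (?a i * ?b (Suc n - i)) + of_nat (Suc n - i) * (?a i * ?b (Suc n - i)))"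
    by (intro sum.cong refl) (simp only: distrib_right[symmetric] of_nat_add[symmetric], simp)
  also have "\<dots> = (\<Sum>i\<le>Suc n. of_nat i * (?a i * ?b (Suc n - i))) + (\<Sum>i\<le>Suc n. of_nat (Suc n - i) * (?a i * ?b (Suc n - i)))"
    by (rule sum.distrib)
  also have "(\<Sum>i\<le>Suc n. of_nat i * (?a i * ?b (Suc n - i))) = (\<Sum>i\<le>n. (of_nat (Suc i) * ?a (Suc i)) * ?b (n - i))"
    by (subst sum.atMost_Suc_shift) (simp add: mult.assoc del: of_nat_Suc)
  also have "(\<Sum>i\<le>Suc n. of_nat (Suc n - i) * (?a i * ?b (Suc n - i))) = (\<Sum>i\<le>n. ?a i * (of_nat (Suc (n - i)) * ?b (Suc (n - i))))"
    by (subst sum.atMost_Suc) (simp add: Suc_diff_le mult.left_commute del: of_nat_Suc)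
  finally show "coeff (poly_deriv (p * q)) n = coeff (poly_deriv p * q + p * poly_deriv q) n"
    by (simp only: coeff_add coeff_mult coeff_poly_deriv)
qed

text \<open>The shears form a one parameter group with infinitesimal generator \<^const>\<open>lower\<close>.\<close>

lemma poly_deriv_shear: "poly_deriv (shear k p) = lower_poly k (shear k p)"
proof -
  have 1: "twisted_der (shear k) (\<lambda>p. poly_deriv (shear k p))"
    by (simp add: twisted_der_def additive_map_def ring_hom_add[OF ring_hom_shear] ring_hom_mult[OF ring_hom_shear] poly_deriv_add poly_deriv_mult)
  have 2: "twisted_der (shear k) (\<lambda>p. lower_poly k (shear k p))"
    by (simp add: twisted_der_def additive_map_def ring_hom_add[OF ring_hom_shear] ring_hom_mult[OF ring_hom_shear] lower_poly_add lower_poly_mult)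
  have "poly_deriv (const_poly a) = 0" "poly_deriv t_poly = 1" for a
    by (auto intro!: poly_eqI simp: coeff_poly_deriv const_poly_def t_poly_def coeff_pCons split: nat.split)
  then have v: "poly_deriv (shear k (var v)) = lower_poly k (shear k (var v))" for v
    by (cases v rule: index_cases[of _ k])
      (auto simp: var_ix shear_R poly_deriv_add poly_deriv_mult lower_poly_add lower_poly_mult lower_poly_const_poly lower_poly_t_poly lower_R)
  show ?thesis
    by (rule fun_cong[OF twisted_der_ext[OF 1 2 ring_hom_shear v]])
qed

lemma shear_coeff_lower: "of_nat (Suc j) * shear_coeff k (Suc j) p = lower k (shear_coeff k j p)"
  using arg_cong[OF poly_deriv_shear[of k p], of "\<lambda>q. coeff q j"]
  by (simp add: coeff_poly_deriv coeff_lower_poly shear_coeff_def del: of_nat_Suc)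

lemma of_nat_char2: "(of_nat n :: 'a :: char2) = of_bool (odd n)"
  by (induction n) auto

text \<open>The odd coefficients of a shear are \<^const>\<open>lower\<close> applied to something, hence null homotopic.\<close>

lemma shear_coeff_Suc: "even j \<Longrightarrow> shear_coeff k (Suc j) p = lower k (shear_coeff k j p)"
  using shear_coeff_lower[of j k p] by (simp add: of_nat_char2 del: of_nat_Suc)

lemma shear_coeff_1: "shear_coeff k (Suc 0) p = lower k p"
  using shear_coeff_Suc[of 0 k p] by simp

section \<open>Walls of positive weight\<close>

abbreviation hh :: "nat \<Rightarrow> X" where "hh k \<equiv> R k (Suc k)"

text \<open>The grade of \<open>hh k\<close> without its polynomial degree. The coefficient of \<open>t\<^sup>j\<close> in a shear lowers the grade by
  \<open>j\<close> times this.\<close>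

definition wall_grade :: "nat \<Rightarrow> nat \<Rightarrow> int" where
  "wall_grade k n = var_grade (ix k (Suc k)) n - deg1 n"

definition wall_wt :: "nat \<Rightarrow> (nat \<Rightarrow> int) \<Rightarrow> int" where
  "wall_wt k c = c (k + 2) - c (Suc k + 2)"

text \<open>The effect of \<^const>\<open>swap\<close> on grades. On the weights it is the exchange of the weights at \<open>k\<close> and \<open>k + 1\<close>.\<close>

definition reflect :: "nat \<Rightarrow> (nat \<Rightarrow> int) \<Rightarrow> nat \<Rightarrow> int" where
  "reflect k c n = c n - wall_wt k c * wall_grade k n"

lemma wall_grade_simps [simp]: "wall_grade k 0 = 0" "wall_grade k (Suc 0) = 1" "wall_wt k (wall_grade k) = 2"
  by (simp_all add: wall_grade_def var_grade_ix wall_wt_def)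

lemma wall_wt_simps:
  "wall_wt k (\<lambda>n. c n + c' n) = wall_wt k c + wall_wt k c'"
  "wall_wt k (\<lambda>n. c n - c' n) = wall_wt k c - wall_wt k c'"
  "wall_wt k (\<lambda>n. a * c n) = a * wall_wt k c"
  "wall_wt k (\<lambda>n. c n * a) = wall_wt k c * a"
  "wall_wt k deg1 = 0" "wall_wt k (\<lambda>n. 0) = 0"
  by (simp_all add: wall_wt_def algebra_simps)

lemma wall_wt_deg1 [simp]: "wall_wt k (\<lambda>n. c n - deg1 n) = wall_wt k c" "wall_wt k (\<lambda>n. c n + deg1 n) = wall_wt k c"
  by (simp_all add: wall_wt_def)

lemma wall_wt_reflect [simp]: "wall_wt k (reflect k c) = - wall_wt k c"
proof -
  have "reflect k c = (\<lambda>n. c n - wall_wt k c * wall_grade k n)" by (simp add: reflect_def fun_eq_iff)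
  then show ?thesis by (simp add: wall_wt_simps)
qed

lemma var_grade_hh: "var_grade (ix k (Suc k)) = (\<lambda>n. wall_grade k n + deg1 n)"
  by (simp add: wall_grade_def fun_eq_iff)

lemma var_grade_row: "Suc k < j \<Longrightarrow> var_grade (ix k j) n = var_grade (ix (Suc k) j) n + wall_grade k n"
  by (auto simp: wall_grade_def var_grade_ix)

lemma var_grade_col: "i < k \<Longrightarrow> var_grade (ix i (Suc k)) n = var_grade (ix i k) n + wall_grade k n"
  by (auto simp: wall_grade_def var_grade_ix)

lemma wall_wt_var_grade:
  "wall_wt k (var_grade (ix k (Suc k))) = 2"
  "Suc k < j \<Longrightarrow> wall_wt k (var_grade (ix k j)) = 1"
  "Suc k < j \<Longrightarrow> wall_wt k (var_grade (ix (Suc k) j)) = - 1"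
  "i < k \<Longrightarrow> wall_wt k (var_grade (ix i k)) = - 1"
  "i < k \<Longrightarrow> wall_wt k (var_grade (ix i (Suc k))) = 1"
  "i < k \<Longrightarrow> Suc k < j \<Longrightarrow> wall_wt k (var_grade (ix i j)) = 0"
  "i < j \<Longrightarrow> j < k \<Longrightarrow> wall_wt k (var_grade (ix i j)) = 0"
  "i < j \<Longrightarrow> Suc k < i \<Longrightarrow> wall_wt k (var_grade (ix i j)) = 0"
  by (auto simp: wall_wt_def var_grade_ix)

lemma homogeneous_hh: "homogeneous (\<lambda>n. wall_grade k n + deg1 n) (hh k)"
  using homogeneous_R[of k "Suc k"] by (simp add: var_grade_hh)

lemma dX_hh [simp]: "dX (hh k) = 0"
  by (rule dX_cases)

lemma graded_map_lower: "graded_map (\<lambda>c n. c n + - wall_grade k n) (lower k)"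
proof (rule graded_map_twisted_der[OF twisted_der_lower])
  show "homogeneous (\<lambda>n. var_grade v n + - wall_grade k n) (lower k (var v))" for v
    by (cases v rule: index_cases[of _ k])
      (auto simp: var_ix lower_R var_grade_row[of k] var_grade_col[of _ k] intro!: homogeneous_cong[OF homogeneous_R])
qed

lemma graded_map_kill_wall: "graded_map (\<lambda>c. c) (kill_wall k)"
proof (rule graded_map_ring_hom[OF ring_hom_kill_wall])
  show "homogeneous (var_grade v) (kill_wall k (var v))" for v
    by (cases v rule: index_cases[of _ k]) (auto simp: var_ix kill_wall_R intro: homogeneous_R)
qed auto

lemma graded_map_swap: "graded_map (reflect k) (swap k)"
proof (rule graded_map_ring_hom[OF ring_hom_swap])
  show "homogeneous (reflect k (var_grade v)) (swap k (var v))" for v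
    by (cases v rule: index_cases[of _ k])
      (auto simp: var_ix swap_R reflect_def wall_wt_var_grade var_grade_row[of k] var_grade_col[of _ k] intro!: homogeneous_cong[OF homogeneous_R])
qed (auto simp: reflect_def fun_eq_iff wall_wt_simps algebra_simps)

lemma graded_map_hh: "graded_map (\<lambda>c n. c n + (wall_grade k n + deg1 n)) (\<lambda>p. hh k * p)"
  unfolding graded_map_def additive_map_def
  using homogeneous_mult[OF homogeneous_mnm homogeneous_hh] by (auto simp: distrib_left mult.commute[of "hh k" "mnm _"])

lemma shear_coeff_mult: "shear_coeff k j (p * q) = (\<Sum>i\<le>j. shear_coeff k i p * shear_coeff k (j - i) q)"
  by (simp add: shear_coeff_def ring_hom_mult[OF ring_hom_shear] coeff_mult)

lemma shear_coeff_var: "shear_coeff k j (var v) = (if j = 0 then var v else if j = 1 then lower k (var v) else 0)"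
proof -
  have "shear_coeff k j (var v) = 0" if "j > Suc 0"
    using that
    by (cases v rule: index_cases[of _ k])
      (auto simp: shear_coeff_def var_ix shear_R const_poly_def t_poly_def coeff_pCons split: nat.splits)
  then show ?thesis by (auto simp: shear_coeff_1)
qed

lemma graded_map_shear_coeff: "graded_map (\<lambda>c n. c n + - (int j * wall_grade k n)) (shear_coeff k j)"
proof -
  have "homogeneous (\<lambda>n. grade m n + - (int j * wall_grade k n)) (shear_coeff k j (mnm m))" for m
  proof (induction m arbitrary: j rule: mon_induct)
    case zero
    show ?case
    proof (cases "j = 0")
      case False
      then have "shear_coeff k j (mnm 0) = 0"
        by (simp add: shear_coeff_def ring_hom_1[OF ring_hom_shear])
      then show ?thesis by simp
    qed (simp add: homogeneous_1)
  next
    case (add v m)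
    have v: "homogeneous (\<lambda>n. var_grade v n + - (int i * wall_grade k n)) (shear_coeff k i (var v))" for i
      using graded_map_homogeneous[OF graded_map_lower homogeneous_var] homogeneous_var by (auto simp: shear_coeff_var)
    have "homogeneous (\<lambda>n. grade (Poly_Mapping.single v 1 + m) n + - (int j * wall_grade k n)) (shear_coeff k i (var v) * shear_coeff k (j - i) (mnm m))"
      if "i \<le> j" for i
      by (rule homogeneous_cong[OF homogeneous_mult[OF v add]]) (use that in \<open>simp add: grade_add of_nat_diff algebra_simps\<close>)
    moreover have "shear_coeff k j (mnm (Poly_Mapping.single v 1 + m)) = (\<Sum>i\<le>j. shear_coeff k i (var v) * shear_coeff k (j - i) (mnm m))"
      by (simp only: mnm_add shear_coeff_mult flip: var_eq_mnm)
    ultimately show ?case by (auto intro!: homogeneous_sum)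
  qed
  then show ?thesis by (simp add: graded_map_def shear_coeff_additive)
qed

lemma homogeneous_shear_coeff: "homogeneous c p \<Longrightarrow> homogeneous (\<lambda>n. c n - int j * wall_grade k n) (shear_coeff k j p)"
  using graded_map_homogeneous[OF graded_map_shear_coeff] by simp

lemma euler_homogeneous:
  assumes "homogeneous c p"
  shows "euler k p = (if odd (wall_wt k c) then p else 0)"
proof -
  have v: "euler k (var v) = (if odd (wall_wt k (var_grade v)) then var v else 0)" for v
    by (cases v rule: index_cases[of _ k]) (auto simp: var_ix euler_R wall_wt_var_grade)
  have m: "euler k (mnm m) = (if odd (wall_wt k (grade m)) then mnm m else 0)" for m
  proof (induction m rule: mon_induct)
    case (add w m)
    have "euler k (mnm (Poly_Mapping.single w 1 + m)) = euler k (var w) * mnm m + var w * euler k (mnm m)"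
      by (simp add: mnm_add twisted_der_mult[OF twisted_der_euler] var_eq_mnm)
    moreover have "mnm (Poly_Mapping.single w 1 + m) = var w * mnm m"
      by (simp add: mnm_add var_eq_mnm)
    ultimately show ?case
      using add by (simp add: v grade_add wall_wt_simps)
  qed (simp add: twisted_der_1[OF twisted_der_euler ring_hom_id] wall_wt_simps)
  have "euler k p = (if odd (wall_wt k c) then (\<Sum>x\<in>Poly_Mapping.keys p. mnm x) else 0)"
    using assms
    by (subst X_eq_sum_mnm[of p]) (auto simp: twisted_der_sum[OF twisted_der_euler] m homogeneous_def intro!: sum.cong sum.neutral)
  then show ?thesis by (simp flip: X_eq_sum_mnm)
qed

text \<open>Every polynomial is congruent to its image under \<^const>\<open>kill_wall\<close> modulo \<open>hh k\<close>.\<close>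

lemma kill_wall_eq_0D:
  assumes "kill_wall k p = 0"
  obtains v where "p = hh k * v"
proof -
  have "\<exists>v. p = kill_wall k p + hh k * v" for p
  proof (induction p rule: X_induct)
    case (scalar c)
    then show ?case
      by (intro exI[of _ 0], cases c) (simp_all add: ring_hom_0[OF ring_hom_kill_wall] ring_hom_1[OF ring_hom_kill_wall])
  next
    case (var v)
    show ?case
    proof (cases "v = ix k (Suc k)")
      case True
      then show ?thesis by (intro exI[of _ 1]) (simp add: var_ix kill_wall_R)
    qed (intro exI[of _ 0], simp add: kill_wall_def)
  next
    case (add p q)
    then obtain a b where "p = kill_wall k p + hh k * a" "q = kill_wall k q + hh k * b" by auto
    then have "p + q = kill_wall k (p + q) + hh k * (a + b)"
      by (simp add: ring_hom_add[OF ring_hom_kill_wall] algebra_simps)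
    then show ?case by blast
  next
    case (mult p q)
    then obtain a b where "p = kill_wall k p + hh k * a" "q = kill_wall k q + hh k * b" by auto
    then have "p * q = (kill_wall k p + hh k * a) * (kill_wall k q + hh k * b)" by metis
    also have "\<dots> = kill_wall k (p * q) + hh k * (kill_wall k p * b + a * kill_wall k q + hh k * a * b)"
      by (simp only: ring_hom_mult[OF ring_hom_kill_wall]) (simp only: algebra_simps)
    finally have "p * q = kill_wall k (p * q) + hh k * (kill_wall k p * b + a * kill_wall k q + hh k * a * b)" .
    then show ?case by blast
  qed
  then show ?thesis using assms that by (metis add_0)
qed

text \<open>The transposed shear: conjugation by \<open>1 + E\<close> seen through the transposition, which raises wall weights
  where the shear lowers them. Its expansion by grade starts with \<^const>\<open>kill_wall\<close> and \<^const>\<open>raise\<close>.\<close>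

definition flow :: "nat \<Rightarrow> X \<Rightarrow> X" where
  "flow k p = swap k (unit_shear k (swap k p))"

lemma flow_additive: "additive_map (flow k)"
  by (simp add: additive_map_def flow_def ring_hom_add[OF ring_hom_swap] ring_hom_add[OF ring_hom_unit_shear])

lemmas flow_add = additive_add[OF flow_additive]

lemma flow_hh_mult: "flow k (hh k * p) = 0"
  by (simp add: flow_def ring_hom_mult[OF ring_hom_swap] swap_R ring_hom_0[OF ring_hom_unit_shear] ring_hom_0[OF ring_hom_swap])

lemma flow_dX: "flow k (dX p) = kill_wall k (dX (flow k p))"
  unfolding flow_def
  by (simp only: swap_dX[of k p] unit_shear_kill_wall swap_kill_wall flip: dX_unit_shear) (rule swap_dX)

text \<open>The transposition makes the positive wall weight negative and a shear lowers it further, so that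
  nothing remains in the original grade.\<close>

lemma component_unit_shear_swap:
  assumes "homogeneous c p" "wall_wt k c > 0"
  shows "component c (unit_shear k (swap k p)) = 0"
proof -
  have "component c (shear_coeff k j (swap k p)) = 0" for j
  proof (rule component_other[OF homogeneous_shear_coeff[OF graded_map_homogeneous[OF graded_map_swap assms(1)]]])
    have "wall_wt k (\<lambda>n. reflect k c n - int j * wall_grade k n) < 0"
      using assms(2) by (simp add: wall_wt_simps)
    then show "(\<lambda>n. reflect k c n - int j * wall_grade k n) \<noteq> c"
      using assms(2) by (metis less_asym)
  qed
  then show ?thesis
    unfolding unit_shear_eq_sum slice_sum by simp
qed

lemma component_flow:
  assumes "homogeneous c p"
  shows "component (\<lambda>n. c n + int i * wall_grade k n) (flow k p) = swap k (shear_coeff k i (swap k p))"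
proof -
  let ?c = "\<lambda>j n. c n + int j * wall_grade k n"
  have t: "homogeneous (?c j) (swap k (shear_coeff k j (swap k p)))" for j
    by (rule homogeneous_cong[OF graded_map_homogeneous[OF graded_map_swap homogeneous_shear_coeff[OF graded_map_homogeneous[OF graded_map_swap assms]]]])
      (simp add: reflect_def wall_wt_simps algebra_simps)
  have inj: "?c j = ?c i \<longleftrightarrow> j = i" for j
  proof
    assume "?c j = ?c i"
    then have "?c j (Suc 0) = ?c i (Suc 0)" by metis
    then show "j = i" by simp
  qed simp
  let ?D = "degree (shear k (swap k p))"
  have "component (?c i) (flow k p) = (\<Sum>j\<le>?D. component (?c i) (swap k (shear_coeff k j (swap k p))))"
    unfolding flow_def unit_shear_eq_sum ring_hom_sum[OF ring_hom_swap] slice_sum ..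
  also have "\<dots> = (\<Sum>j\<le>?D. if j = i then swap k (shear_coeff k i (swap k p)) else 0)"
    by (rule sum.cong) (use component_id[OF t] component_other[OF t] inj in auto)
  also have "\<dots> = swap k (shear_coeff k i (swap k p))"
    by (auto simp: sum.delta shear_coeff_def coeff_eq_0 ring_hom_0[OF ring_hom_swap])
  finally show ?thesis .
qed

lemma component_flow_0: "homogeneous c p \<Longrightarrow> component c (flow k p) = kill_wall k p"
  using component_flow[of c p 0 k] by simp

lemma component_flow_1:
  assumes "homogeneous (\<lambda>n. c n - wall_grade k n) p"
  shows "component c (flow k p) = kill_wall k (raise k p)"
  using component_flow[OF assms, of 1 k] by (simp add: shear_coeff_1 swap_lower_swap)

lemma component_kill_wall: "component c (kill_wall k p) = kill_wall k (component c p)"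
  using graded_map_component[OF graded_map_kill_wall] by (simp add: inj_def)

text \<open>The shears act trivially on the homology class of such a \<open>u\<close>.\<close>

definition shear_invariant :: "nat \<Rightarrow> X \<Rightarrow> bool" where
  "shear_invariant k u \<longleftrightarrow> (\<forall>j\<ge>1. boundary (shear_coeff k j u))"

text \<open>Components can be taken in a decomposition modulo boundaries and \<open>hh k\<close>; the cofactor of \<open>hh k\<close> is then
  automatically a cycle, because \<open>hh k\<close> is not a zero divisor.\<close>

lemma hh_split_homogeneous:
  assumes u: "homogeneous c u" "dX u = 0" and "u = dX b + hh k * v"
  obtains b' v' where "homogeneous (\<lambda>n. c n - deg1 n) b'" "homogeneous (\<lambda>n. c n - (wall_grade k n + deg1 n)) v'" "dX v' = 0"
    "u = dX b' + hh k * v'"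
proof -
  let ?b = "component (\<lambda>n. c n - deg1 n) b" and ?v = "component (\<lambda>n. c n - (wall_grade k n + deg1 n)) v"
  have "u = component c (dX b + hh k * v)"
    using assms component_id by metis
  also have "\<dots> = dX ?b + hh k * ?v"
    using graded_map_component[OF graded_map_hh inj_sh, of "\<lambda>n. c n - (wall_grade k n + deg1 n)" k v]
    by (simp add: slice_add component_dX')
  finally have e: "u = dX ?b + hh k * ?v" .
  have "hh k * dX ?v = dX u"
    by (subst e) (simp add: dX_add dX_mult)
  then have "var (ix k (Suc k)) * dX ?v = var (ix k (Suc k)) * 0"
    using u by (simp add: var_ix)
  then have "dX ?v = 0"
    by (rule var_mult_cancel)
  then show ?thesis using that e homogeneous_component by blast
qed

lemma shear_invariant_unit_shear:
  assumes "shear_invariant k u"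
  obtains y where "unit_shear k u = u + dX y"
proof -
  have "unit_shear k u = (\<Sum>j\<le>degree (shear k u). shear_coeff k j u)"
    by (rule unit_shear_eq_sum)
  also have "{..degree (shear k u)} = insert 0 {1..degree (shear k u)}"
    by auto
  also have "(\<Sum>j\<in>insert 0 {1..degree (shear k u)}. shear_coeff k j u) = u + (\<Sum>j\<in>{1..degree (shear k u)}. shear_coeff k j u)"
    by simp
  finally have e: "unit_shear k u = u + (\<Sum>j\<in>{1..degree (shear k u)}. shear_coeff k j u)" .
  have "boundary (\<Sum>j\<in>{1..degree (shear k u)}. shear_coeff k j u)"
    using assms by (intro boundary_sum) (auto simp: shear_invariant_def)
  then show ?thesis using that e by (auto simp: boundary_def)
qed

text \<open>Apply the braid relation to \<open>u\<close>. In the grade of \<open>u\<close> the left side vanishes because the wall weight is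
  positive, and the right side is, because the unit shear moves \<open>u\<close> by a boundary only, \<open>kill_wall k u\<close>
  plus a boundary modulo \<open>hh k\<close>.\<close>

lemma division:
  assumes u: "homogeneous c u" "dX u = 0" and w: "wall_wt k c > 0" and shear_invariant: "shear_invariant k u"
  obtains b v where "homogeneous (\<lambda>n. c n - deg1 n) b" "homogeneous (\<lambda>n. c n - (wall_grade k n + deg1 n)) v" "dX v = 0"
    "u = dX b + hh k * v"
proof -
  obtain y where "unit_shear k u = u + dX y" by (rule shear_invariant_unit_shear[OF shear_invariant])
  then have "unit_shear k (swap k u) = flow k u + flow k (dX y)"
    by (subst braid) (simp add: flow_add flip: flow_def)
  then have "component c (unit_shear k (swap k u)) = kill_wall k u + kill_wall k (dX (component (\<lambda>n. c n - deg1 n) (flow k y)))"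
    by (simp add: slice_add component_flow_0[OF u(1)] flow_dX component_kill_wall component_dX')
  then have "kill_wall k (u + dX (component (\<lambda>n. c n - deg1 n) (flow k y))) = 0"
    by (simp add: component_unit_shear_swap[OF u(1) w] ring_hom_add[OF ring_hom_kill_wall])
  then obtain v where "u + dX (component (\<lambda>n. c n - deg1 n) (flow k y)) = hh k * v"
    by (rule kill_wall_eq_0D)
  then have "u = dX (component (\<lambda>n. c n - deg1 n) (flow k y)) + hh k * v"
    by (metis add.commute add_self_left)
  then show ?thesis by (rule hh_split_homogeneous[OF u]) (rule that)
qed

text \<open>In odd wall weight \<^const>\<open>raise\<close> is a null homotopy of the multiplication by \<open>hh k\<close>.\<close>

lemma odd_hh_boundary:
  assumes "homogeneous c v" "dX v = 0" "odd (wall_wt k c)"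
  shows "boundary (hh k * v)"
  using raise_dX[of k v] assms by (auto simp: euler_homogeneous[OF assms(1)] twisted_der_0[OF twisted_der_raise] boundary_def) metis

lemma lower_cycle_boundary: "dX p = 0 \<Longrightarrow> boundary (lower k p)"
  by (simp add: lower_eq twisted_der_0[OF twisted_der_wall_pderiv])

text \<open>By induction on the height the even coefficients of the shears of \<open>u\<close> bound, as
  they have the same parity and smaller height; the odd coefficients are null homotopic. Hence \<open>u\<close> is
  divisible by \<open>hh k\<close> modulo boundaries at any wall of positive weight. The cofactor bounds by induction, or
  its product with \<open>hh k\<close> bounds because the wall weight is odd.\<close>

theorem parity:
  assumes "homogeneous c u" "dX u = 0" "odd (c 0 + c (Suc 0))"
  shows "boundary u"
  using assms
proof (induction "nat (c (Suc 0))" arbitrary: c u rule: less_induct)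
  case less
  show ?case
  proof (cases "u = 0")
    case False
    then have "Poly_Mapping.keys u \<noteq> {}" by simp
    then obtain m where m: "m \<in> Poly_Mapping.keys u" by blast
    then have c: "grade m = c" using less.prems(1) unfolding homogeneous_def by blast
    have "m \<noteq> 0"
    proof
      assume "m = 0"
      then have "c 0 + c (Suc 0) = 0" using fun_cong[OF c, of 0] fun_cong[OF c, of "Suc 0"] by simp
      then show False using less.prems(3) by simp
    qed
    then obtain k where "grade m (k + 2) > grade m (Suc k + 2)"
      using exists_descent by blast
    then have k: "wall_wt k c > 0"
      unfolding c wall_wt_def by linarith
    have smaller: "boundary p" if "homogeneous c' p" "dX p = 0" "odd (c' 0 + c' (Suc 0))" "c' (Suc 0) < c (Suc 0)" for c' p
    proof (cases "p = 0")
      case False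
      then have "c' (Suc 0) \<ge> 0" using that(1) homogeneous_heightD by blast
      then show ?thesis using less.hyps[of c' p] that by simp
    qed simp
    have "boundary (shear_coeff k j u)" if "j \<ge> 1" for j
    proof (cases "even j")
      case True
      show ?thesis
      proof (rule smaller[OF homogeneous_shear_coeff[OF less.prems(1)]])
        show "dX (shear_coeff k j u) = 0"
          by (simp add: dX_shear_coeff less.prems(2) additive_0[OF shear_coeff_additive])
        show "odd (c 0 - int j * wall_grade k 0 + (c (Suc 0) - int j * wall_grade k (Suc 0)))"
          using less.prems(3) True by simp
        show "c (Suc 0) - int j * wall_grade k (Suc 0) < c (Suc 0)"
          using that by simp
      qed
    next
      case False
      then obtain i where i: "j = Suc i" "even i" by (elim oddE) simp
      show ?thesis
        unfolding i(1) shear_coeff_Suc[OF i(2)]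
        by (rule lower_cycle_boundary) (simp add: dX_shear_coeff less.prems(2) additive_0[OF shear_coeff_additive])
    qed
    then have "shear_invariant k u" by (simp add: shear_invariant_def)
    then obtain b v where v: "homogeneous (\<lambda>n. c n - (wall_grade k n + deg1 n)) v" "dX v = 0" "u = dX b + hh k * v"
      by (rule division[OF less.prems(1,2) k])
    have "boundary (hh k * v)"
    proof (cases "odd (wall_wt k c)")
      case True
      have "wall_wt k (\<lambda>n. c n - (wall_grade k n + deg1 n)) = wall_wt k c - 2"
        by (simp add: wall_wt_simps)
      then show ?thesis
        using True by (intro odd_hh_boundary[OF v(1,2)]) simp
    next
      case False
      have "boundary v"
        by (rule smaller[OF v(1,2)]) (use less.prems(3) in simp_all)
      then show ?thesis by (simp add: boundary_mult_cycle)
    qed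
    then show ?thesis
      using v(3) boundary_add[OF boundary_dX[of b]] by (simp only:)
  qed simp
qed

section \<open>Cancellation in even wall weight\<close>

lemma lower_mult: "lower k (p * q) = lower k p * q + p * lower k q"
  by (rule twisted_der_mult[OF twisted_der_lower])

lemma lower_hh_mult: "lower k (hh k * p) = hh k * lower k p"
  by (simp add: lower_mult lower_R)

lemma raise_hh_mult: "raise k (hh k * p) = hh k * raise k p"
  by (simp add: twisted_der_mult[OF twisted_der_raise] raise_R)

lemma lower_dX: "lower k (dX p) = dX (lower k p)"
  by (simp add: lower_eq twisted_der_0[OF twisted_der_wall_pderiv] dX_add)

lemma shear_coeff_hh_mult: "shear_coeff k j (hh n * p) = hh n * shear_coeff k j p"
proof -
  have "shear k (hh n) = const_poly (hh n)"
  proof -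
    consider "n = k" | "n < k" "Suc n < k" | "Suc n = k" | "n = Suc k" | "Suc k < n"
      by linarith
    then show ?thesis
    proof cases
      case 3
      then show ?thesis using shear_R(4)[of n k] by simp
    qed (simp_all add: shear_R)
  qed
  then have "shear k (hh n * p) = smult (hh n) (shear k p)"
    by (simp add: ring_hom_mult[OF ring_hom_shear] const_poly_def)
  then show ?thesis by (simp add: shear_coeff_def)
qed

lemma hh_mult_cancel: "hh k * p = hh k * q \<Longrightarrow> p = q"
  using var_mult_cancel[of "ix k (Suc k)"] by (simp add: var_ix)

lemma dX_dX_plus_hh: "dX (dX p + hh k * q) = hh k * dX q"
  by (simp add: dX_add dX_mult)

lemma homogeneous_hh_mult: "homogeneous c p \<Longrightarrow> homogeneous (\<lambda>n. c n + wall_grade k n + deg1 n) (hh k * p)"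
  using graded_map_homogeneous[OF graded_map_hh] by (rule homogeneous_cong) simp_all

text \<open>Let \<open>hh k * u = d a\<close>. By \<open>parity\<close> all but the first two coefficients of the shear of \<open>a\<close> are boundaries
  modulo \<open>hh k\<close>. The argument of \<open>division\<close>, applied to the chain \<open>a\<close>, then shows
  \<open>a = raise k (lower k a)\<close> modulo boundaries and \<open>hh k\<close>. On even wall weights \<open>lower k\<close> and \<open>raise k\<close>
  commute, and \<open>lower k\<close> squares to zero; so applying \<open>lower k\<close> to this equation shows that \<open>lower k a\<close>
  vanishes modulo boundaries and \<open>hh k\<close>, and then so does \<open>a\<close>. Thus \<open>a\<close> is a boundary plus \<open>hh k * c\<close>, and
  \<open>u = d c\<close> because \<open>hh k\<close> can be cancelled.\<close>

lemma even_hh_cancel: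
  assumes u: "homogeneous c u" "dX u = 0" and w: "even (wall_wt k c)" "wall_wt k c \<ge> 0" and shear_invariant: "shear_invariant k u"
    and b: "boundary (hh k * u)"
  shows "boundary u"
proof (cases "odd (c 0 + c (Suc 0))")
  case True
  then show ?thesis using parity u by blast
next
  case False
  define ca where "ca = (\<lambda>n. c n + wall_grade k n)"
  obtain a where a: "homogeneous ca a" "hh k * u = dX a"
  proof (rule boundary_homE[OF b homogeneous_hh_mult[OF u(1)]])
    fix y assume "homogeneous (\<lambda>n. c n + wall_grade k n + deg1 n - deg1 n) y" "hh k * u = dX y"
    then show thesis by (intro that) (simp_all add: ca_def)
  qed
  have T: "\<exists>Y z. shear_coeff k j a = hh k * Y + dX z" if "j \<ge> 2" for j
  proof -
    have collapse: "\<exists>Y z. shear_coeff k i a = hh k * Y + dX z" if i: "even i" "i \<ge> 1" for i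
    proof -
      have "boundary (shear_coeff k i u)" using shear_invariant i by (simp add: shear_invariant_def)
      then obtain y where y: "homogeneous (\<lambda>n. c n - int i * wall_grade k n - deg1 n) y" "shear_coeff k i u = dX y"
        by (rule boundary_homE[OF _ homogeneous_shear_coeff[OF u(1)]])
      have cyc: "dX (shear_coeff k i a + hh k * y) = 0"
        using a(2) y(2) by (simp add: dX_shear_coeff dX_add dX_mult shear_coeff_hh_mult flip: a(2))
      \<comment> \<open>The cycle has the parity of \<open>a\<close>, opposite to that of \<open>u\<close>, since \<open>i\<close> is even.\<close>
      have "homogeneous (\<lambda>n. ca n - int i * wall_grade k n) (shear_coeff k i a + hh k * y)"
        by (intro homogeneous_add homogeneous_shear_coeff[OF a(1)] homogeneous_cong[OF homogeneous_hh_mult[OF y(1)]]) (simp add: ca_def)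
      then have "boundary (shear_coeff k i a + hh k * y)"
        by (rule parity[OF _ cyc]) (use i False in \<open>simp add: ca_def\<close>)
      then obtain z where "shear_coeff k i a + hh k * y = dX z" by (auto simp: boundary_def)
      then have "shear_coeff k i a = hh k * y + dX z"
        by (metis add.commute add_self_left)
      then show ?thesis by blast
    qed
    show ?thesis
    proof (cases "even j")
      case True
      then show ?thesis using collapse that by simp
    next
      case False
      then obtain i where i: "j = Suc i" "even i" by (elim oddE) simp
      then have "i \<ge> 1" using that by simp
      then obtain Y z where "shear_coeff k i a = hh k * Y + dX z" using collapse i by blast
      then have "shear_coeff k j a = hh k * lower k Y + dX (lower k z)"
        unfolding i(1) shear_coeff_Suc[OF i(2)]
        by (simp add: lower_hh_mult lower_dX twisted_der_add[OF twisted_der_lower])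
      then show ?thesis by blast
    qed
  qed
  obtain Y Z where e: "unit_shear k a = a + lower k a + hh k * Y + dX Z"
  proof -
    let ?D = "degree (shear k a)"
    have "\<forall>j. \<exists>Y z. j \<ge> 2 \<longrightarrow> shear_coeff k j a = hh k * Y + dX z" using T by blast
    then obtain Y z where Yz: "\<And>j. j \<ge> 2 \<Longrightarrow> shear_coeff k j a = hh k * Y j + dX (z j)" by metis
    have "unit_shear k a = (\<Sum>j\<le>Suc ?D. shear_coeff k j a)"
      unfolding unit_shear_eq_sum
      by (rule sum.mono_neutral_left) (auto simp: shear_coeff_def coeff_eq_0)
    also have "{..Suc ?D} = {0, 1} \<union> {2..Suc ?D}" by auto
    also have "(\<Sum>j\<in>\<dots>. shear_coeff k j a) = a + lower k a + (\<Sum>j\<in>{2..Suc ?D}. shear_coeff k j a)"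
      by (subst sum.union_disjoint) (auto simp: shear_coeff_1)
    also have "(\<Sum>j\<in>{2..Suc ?D}. shear_coeff k j a) = hh k * (\<Sum>j\<in>{2..Suc ?D}. Y j) + dX (\<Sum>j\<in>{2..Suc ?D}. z j)"
      by (simp add: Yz sum_distrib_left dX_sum sum.distrib del: sum.cl_ivl_Suc)
    finally show thesis by (intro that) (simp add: add.assoc)
  qed
  have th: "homogeneous (\<lambda>n. ca n - wall_grade k n) (lower k a)"
    using graded_map_homogeneous[OF graded_map_lower a(1)] by simp
  \<comment> \<open>The grade of \<open>a\<close> has wall weight two more than that of \<open>u\<close>, so that weight zero is allowed.\<close>
  have "wall_wt k ca > 0" using w by (simp add: ca_def wall_wt_simps)
  then have "0 = component ca (unit_shear k (swap k a))"
    by (simp add: component_unit_shear_swap[OF a(1)])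
  also have "\<dots> = component ca (flow k (unit_shear k a))"
    by (subst braid) (simp flip: flow_def)
  also have "\<dots> = kill_wall k a + kill_wall k (raise k (lower k a)) + kill_wall k (dX (component (\<lambda>n. ca n - deg1 n) (flow k Z)))"
    unfolding e
    by (simp add: flow_add slice_add component_flow_0[OF a(1)] component_flow_1[OF th] flow_hh_mult flow_dX
        component_kill_wall component_dX')
  finally have "kill_wall k (a + (raise k (lower k a) + dX (component (\<lambda>n. ca n - deg1 n) (flow k Z)))) = 0"
    by (simp add: ring_hom_add[OF ring_hom_kill_wall] add.assoc)
  then obtain c' where "a + (raise k (lower k a) + dX (component (\<lambda>n. ca n - deg1 n) (flow k Z))) = hh k * c'"
    by (rule kill_wall_eq_0D)
  then obtain b' where a1: "a = raise k (lower k a) + dX b' + hh k * c'"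
    by (metis add.commute add_self_left)
  have "wall_wt k (\<lambda>n. ca n - wall_grade k n) = wall_wt k c" by (simp add: ca_def)
  then have "euler k (lower k a) = 0"
    using w by (simp add: euler_homogeneous[OF th])
  then have 0: "lower k (raise k (lower k a)) = 0"
    using lower_raise[of k "lower k a"] by (simp add: twisted_der_0[OF twisted_der_raise])
  have "lower k a = lower k (raise k (lower k a) + dX b' + hh k * c')"
    using a1 by metis
  then have t1: "lower k a = dX (lower k b') + hh k * lower k c'"
    by (simp add: twisted_der_add[OF twisted_der_lower] 0 lower_dX lower_hh_mult)
  have "raise k (lower k a) = raise k (dX (lower k b')) + hh k * raise k (lower k c')"
    by (subst t1) (simp add: twisted_der_add[OF twisted_der_raise] raise_hh_mult)
  also have "raise k (dX (lower k b')) = dX (raise k (lower k b')) + hh k * euler k (lower k b')"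
    using raise_dX[of k "lower k b'"] by (metis add.commute add_self_left)
  finally have "a = dX (raise k (lower k b')) + hh k * euler k (lower k b') + hh k * raise k (lower k c')
      + dX b' + hh k * c'"
    using a1 by metis
  also have "\<dots> = dX (raise k (lower k b') + b') + hh k * (euler k (lower k b') + raise k (lower k c') + c')"
    by (simp only: dX_add distrib_left add_ac)
  finally have a2: "a = dX (raise k (lower k b') + b') + hh k * (euler k (lower k b') + raise k (lower k c') + c')" .
  have "dX a = hh k * dX (euler k (lower k b') + raise k (lower k c') + c')"
    by (subst a2) (rule dX_dX_plus_hh)
  then have "hh k * u = hh k * dX (euler k (lower k b') + raise k (lower k c') + c')"
    using a(2) by (rule trans[rotated])
  then have "u = dX (euler k (lower k b') + raise k (lower k c') + c')"
    by (rule hh_mult_cancel)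
  then show ?thesis by (auto simp: boundary_def)
qed

section \<open>Contraction of cones\<close>

lemma twisted_der_var_power: "twisted_der (\<lambda>p. p) D \<Longrightarrow> D (p ^ n) = of_nat n * p ^ (n - 1) * D p"
  for D :: "X \<Rightarrow> X"
proof (induction n)
  case 0
  then show ?case using twisted_der_1[OF 0 ring_hom_id] by simp
next
  case (Suc n)
  then show ?case
    by (cases n) (simp_all add: twisted_der_mult algebra_simps)
qed

lemma mnm_single: "mnm (Poly_Mapping.single v n) = var v ^ n"
proof (induction n)
  case (Suc n)
  have "Poly_Mapping.single v (Suc n) = Poly_Mapping.single v 1 + Poly_Mapping.single v n"
    by (simp flip: single_add)
  then show ?case using Suc by (simp add: mnm_add var_eq_mnm)
qed simp

text \<open>In characteristic two the complex generated by \<open>x\<close> and \<open>y = D x\<close> is not contractible, since the squares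
  \<open>x\<^sup>2\<close> are cycles. This map is the homotopy that contracts it to the monomials that are free of \<open>y\<close> and even
  in \<open>x\<close>: it turns one factor \<open>y\<close> back into \<open>x\<close> when the exponent of \<open>x\<close> is even, and is zero otherwise.\<close>

definition cone_contraction :: "index \<Rightarrow> index \<Rightarrow> X \<Rightarrow> X" where
  "cone_contraction x y = linear_ext (\<lambda>m. if Poly_Mapping.lookup m y > 0 \<and> even (Poly_Mapping.lookup m x)
     then mnm (m - Poly_Mapping.single y 1 + Poly_Mapping.single x 1) else 0)"

definition cone_triv :: "index \<Rightarrow> index \<Rightarrow> mon \<Rightarrow> bool" where
  "cone_triv x y m \<longleftrightarrow> Poly_Mapping.lookup m y = 0 \<and> even (Poly_Mapping.lookup m x)"

definition free_of :: "index set \<Rightarrow> X \<Rightarrow> bool" where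
  "free_of V p \<longleftrightarrow> (\<forall>m\<in>Poly_Mapping.keys p. \<forall>v\<in>V. Poly_Mapping.lookup m v = 0)"

lemma free_of_mnm: "free_of V (mnm m) \<longleftrightarrow> (\<forall>v\<in>V. Poly_Mapping.lookup m v = 0)"
  by (simp add: free_of_def)

lemma free_of_0 [simp]: "free_of V 0"
  by (simp add: free_of_def)

lemma free_of_add: "free_of V p \<Longrightarrow> free_of V q \<Longrightarrow> free_of V (p + q)"
  using keys_add[of p q] by (auto simp: free_of_def)

lemma free_of_sum: "(\<And>x. x \<in> S \<Longrightarrow> free_of V (f x)) \<Longrightarrow> free_of V (\<Sum>x\<in>S. f x)"
  by (induction S rule: infinite_finite_induct) (auto intro: free_of_add)

lemma free_of_mult: "free_of V p \<Longrightarrow> free_of V q \<Longrightarrow> free_of V (p * q)"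
  using keys_mult[of p q] by (fastforce simp: free_of_def lookup_add)

lemma free_of_var: "v \<notin> V \<Longrightarrow> free_of V (var v)"
  by (auto simp: var_eq_mnm free_of_mnm lookup_single when_def)

lemma cone_contraction_additive: "additive_map (cone_contraction x y)"
  unfolding cone_contraction_def by (rule linear_ext_additive)

lemma cone_contraction_free_mult:
  assumes "free_of {x, y} q"
  shows "cone_contraction x y (q * p) = q * cone_contraction x y p"
proof -
  note [simp] = additive_0[OF cone_contraction_additive] additive_add[OF cone_contraction_additive]
  have *: "cone_contraction x y (mnm n * mnm m) = mnm n * cone_contraction x y (mnm m)"
    if n: "Poly_Mapping.lookup n x = 0" "Poly_Mapping.lookup n y = 0" for n m
  proof -
    have "n + m - Poly_Mapping.single y 1 + Poly_Mapping.single x 1 =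
        n + (m - Poly_Mapping.single y 1 + Poly_Mapping.single x 1)" if "Poly_Mapping.lookup m y > 0"
      by (rule poly_mapping_eqI) (use that in \<open>auto simp: lookup_add lookup_minus lookup_single when_def\<close>)
    then show ?thesis
      unfolding mnm_add[symmetric] by (auto simp: cone_contraction_def lookup_add n simp flip: mnm_add)
  qed
  have mq: "cone_contraction x y (mnm n * p) = mnm n * cone_contraction x y p" if "n \<in> Poly_Mapping.keys q" for n
    by (induction p rule: X_mono_induct)
      (use assms that in \<open>simp_all add: * free_of_def distrib_left\<close>)
  show ?thesis
    by (rule additive_ext[where p = q and F = "\<lambda>q. cone_contraction x y (q * p)" and G = "\<lambda>q. q * cone_contraction x y p"])
      (simp_all add: additive_map_def distrib_right mq)
qed

text \<open>Both sides commute with multiplication by the other variables, because the derivation of these does not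
  involve \<open>x\<close> and \<open>y\<close>. This leaves the monomials in \<open>x\<close> and \<open>y\<close> alone.\<close>

lemma cone_homotopy:
  assumes D: "twisted_der (\<lambda>p. p) D" and xy: "x \<noteq> y" "D (var x) = var y" "D (var y) = 0"
    and fr: "\<And>v. v \<notin> {x, y} \<Longrightarrow> free_of {x, y} (D (var v))"
  shows "D (cone_contraction x y p) + cone_contraction x y (D p) = p + slice (cone_triv x y) True p"
proof -
  let ?s = "cone_contraction x y" and ?r = "slice (cone_triv x y) True"
  note s_simps = additive_0[OF cone_contraction_additive] additive_add[OF cone_contraction_additive]
  define A where "A p = D (?s p) + ?s (D p)" for p
  have A_mult: "A (var v * p) = var v * A p" if v: "v \<notin> {x, y}" for v p
  proof -
    have "?s (var v * p) = var v * ?s p"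
      by (rule cone_contraction_free_mult[OF free_of_var[OF v]])
    then have 1: "D (?s (var v * p)) = D (var v) * ?s p + var v * D (?s p)"
      by (simp add: twisted_der_mult[OF D])
    have 2: "?s (D (var v * p)) = D (var v) * ?s p + var v * ?s (D p)"
      using cone_contraction_free_mult[OF fr[OF v]] cone_contraction_free_mult[OF free_of_var[OF v]]
      by (simp add: twisted_der_mult[OF D] s_simps)
    show ?thesis
      unfolding A_def 1 2 by (simp add: algebra_simps)
  qed
  have base: "A (mnm (Poly_Mapping.single x e + Poly_Mapping.single y f)) =
      mnm (Poly_Mapping.single x e + Poly_Mapping.single y f)
      + (if f = 0 \<and> even e then mnm (Poly_Mapping.single x e + Poly_Mapping.single y f) else 0)" for e f
  proof -
    have DB: "D (mnm (Poly_Mapping.single x i + Poly_Mapping.single y j)) =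
      (if odd i then mnm (Poly_Mapping.single x (i - 1) + Poly_Mapping.single y (Suc j)) else 0)" for i j
      by (simp add: mnm_add mnm_single twisted_der_mult[OF D] twisted_der_var_power[OF D] xy of_nat_char2 algebra_simps)
    have l: "Poly_Mapping.lookup (Poly_Mapping.single x i + Poly_Mapping.single y j) x = i"
      "Poly_Mapping.lookup (Poly_Mapping.single x i + Poly_Mapping.single y j) y = j" for i j :: nat
      using xy(1) by (simp_all add: lookup_add lookup_single when_def)
    have sh: "Poly_Mapping.single x i + Poly_Mapping.single y j - Poly_Mapping.single y 1 + Poly_Mapping.single x 1
        = Poly_Mapping.single x (Suc i) + Poly_Mapping.single y (j - 1)" for i j :: nat
      by (rule poly_mapping_eqI) (use xy(1) in \<open>auto simp: lookup_add lookup_minus lookup_single when_def\<close>)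
    have sB: "?s (mnm (Poly_Mapping.single x i + Poly_Mapping.single y j)) =
      (if j > 0 \<and> even i then mnm (Poly_Mapping.single x (Suc i) + Poly_Mapping.single y (j - 1)) else 0)" for i j
      unfolding cone_contraction_def linear_ext_mnm l sh ..
    have "D (mnm (Poly_Mapping.single x e)) = (if odd e then mnm (Poly_Mapping.single x (e - 1) + Poly_Mapping.single y (Suc 0)) else 0)"
      "?s (mnm (Poly_Mapping.single x e)) = 0"
      using DB[of e 0] sB[of e 0] by (simp_all del: One_nat_def)
    then show ?thesis
      by (cases "odd e"; cases "f = 0") (auto simp: A_def DB sB s_simps twisted_der_0[OF D] elim: oddE)
  qed
  have A_additive: "additive_map A"
    by (simp add: additive_map_def A_def s_simps twisted_der_add[OF D] algebra_simps)
  have mon: "A (mnm (n + (Poly_Mapping.single x e + Poly_Mapping.single y f))) =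
      mnm n * A (mnm (Poly_Mapping.single x e + Poly_Mapping.single y f))"
    if "Poly_Mapping.lookup n x = 0" "Poly_Mapping.lookup n y = 0" for n e f
    using that
  proof (induction n rule: mon_induct)
    case (add v n)
    then have v: "v \<notin> {x, y}" and n: "Poly_Mapping.lookup n x = 0" "Poly_Mapping.lookup n y = 0"
      by (auto simp: lookup_add lookup_single when_def split: if_splits)
    have "A (mnm (Poly_Mapping.single v 1 + n + (Poly_Mapping.single x e + Poly_Mapping.single y f))) =
        A (var v * mnm (n + (Poly_Mapping.single x e + Poly_Mapping.single y f)))"
      by (simp add: var_eq_mnm add.assoc flip: mnm_add)
    then show ?case
      by (simp add: A_mult[OF v] add.IH[OF n]) (simp add: var_eq_mnm mnm_add mult.assoc)
  qed simp
  have "A p = p + ?r p"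
  proof (rule additive_ext[where p = p and F = A and G = "\<lambda>p. p + ?r p"])
    show "additive_map (\<lambda>p. p + ?r p)"
      by (simp add: additive_map_def slice_add algebra_simps)
    fix m :: mon
    define e f where "e = Poly_Mapping.lookup m x" and "f = Poly_Mapping.lookup m y"
    define n where "n = m - Poly_Mapping.single x e - Poly_Mapping.single y f"
    let ?B = "Poly_Mapping.single x e + Poly_Mapping.single y f"
    have n: "Poly_Mapping.lookup n x = 0" "Poly_Mapping.lookup n y = 0"
      using xy(1) by (auto simp: n_def e_def f_def lookup_minus lookup_single when_def)
    have m: "n + ?B = m"
      by (rule poly_mapping_eqI)
        (use xy(1) in \<open>auto simp: n_def e_def f_def lookup_add lookup_minus lookup_single when_def\<close>)
    have "A (mnm (n + ?B)) = mnm n * (mnm ?B + (if f = 0 \<and> even e then mnm ?B else 0))"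
      by (simp only: mon[OF n] base)
    also have "\<dots> = mnm (n + ?B) + (if f = 0 \<and> even e then mnm (n + ?B) else 0)"
      by (auto simp: distrib_left mnm_add)
    finally have "A (mnm m) = mnm m + (if cone_triv x y m then mnm m else 0)"
      unfolding m by (simp only: cone_triv_def e_def f_def)
    moreover have "?r (mnm m) = (if cone_triv x y m then mnm m else 0)"
      using slice_id[of "mnm m" "cone_triv x y" True] slice_other[of "mnm m" "cone_triv x y" True] by simp
    ultimately show "A (mnm m) = mnm m + ?r (mnm m)" by simp
  qed (rule A_additive)
  then show ?thesis by (simp add: A_def)
qed

section \<open>Splitting the differential at a wall\<close>

text \<open>After inverting \<open>h = hh k\<close>, the boundary of \<open>R k j\<close> may replace the variable \<open>R (k + 1) j\<close>, and the boundary
  of \<open>R i (k + 1)\<close> may replace \<open>R i k\<close>; moreover \<open>h * R i j + R i (k + 1) * R k j\<close> may replace a variable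
  \<open>R i j\<close> that straddles the wall. To stay within \<^typ>\<open>X\<close> the substitution is factored into the involution
  \<open>straighten k\<close> and the map \<open>scale k\<close>, which is inverted only up to a power of \<open>h\<close>.\<close>

definition scale :: "nat \<Rightarrow> X \<Rightarrow> X" where
  "scale k = substitute (\<lambda>v. if lo v = Suc k \<or> hi v = k \<or> lo v < k \<and> Suc k < hi v then hh k * var v else var v)"

definition straighten :: "nat \<Rightarrow> X \<Rightarrow> X" where
  "straighten k = substitute (\<lambda>v. if lo v = Suc k then var v + (\<Sum>l\<in>{Suc k<..<hi v}. R k l * R l (hi v))
     else if hi v = k then var v + (\<Sum>l\<in>{lo v<..<k}. R (lo v) l * R l (Suc k))
     else if lo v < k \<and> Suc k < hi v then var v + R (lo v) (Suc k) * R k (hi v) else var v)"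

text \<open>The differential in the new variables: the pairs \<open>R k j\<close>, \<open>R (k + 1) j\<close> and \<open>R i (k + 1)\<close>, \<open>R i k\<close> are cones,
  \<open>hh k\<close> is constant, and the variables whose indices differ from \<open>k\<close> and \<open>k + 1\<close> form a copy of the
  original algebra in which sums omit these two indices.\<close>

definition split_d :: "nat \<Rightarrow> X \<Rightarrow> X" where
  "split_d k = extend_deriv (\<lambda>v. if on_row k v then R (Suc k) (hi v)
     else if on_col k v then R (lo v) k
     else if lo v = Suc k \<or> hi v = k \<or> v = ix k (Suc k) then 0
     else (\<Sum>l\<in>{lo v<..<hi v} - {k, Suc k}. R (lo v) l * R l (hi v)))"

definition change_vars :: "nat \<Rightarrow> X \<Rightarrow> X" where
  "change_vars k p = scale k (straighten k p)"

lemma ring_hom_scale: "ring_hom (scale k)" and ring_hom_straighten: "ring_hom (straighten k)"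
  unfolding scale_def straighten_def by (rule ring_hom_substitute)+

lemma ring_hom_change_vars: "ring_hom (change_vars k)"
  using ring_hom_comp[OF ring_hom_scale ring_hom_straighten] unfolding change_vars_def .

lemma twisted_der_split_d: "twisted_der (\<lambda>p. p) (split_d k)"
  unfolding split_d_def by (rule extend_deriv_twisted_der)

lemma scale_R:
  "scale k (R k (Suc k)) = R k (Suc k)"
  "Suc k < j \<Longrightarrow> scale k (R k j) = R k j"
  "Suc k < j \<Longrightarrow> scale k (R (Suc k) j) = hh k * R (Suc k) j"
  "i < k \<Longrightarrow> scale k (R i k) = hh k * R i k"
  "i < k \<Longrightarrow> scale k (R i (Suc k)) = R i (Suc k)"
  "i < k \<Longrightarrow> Suc k < j \<Longrightarrow> scale k (R i j) = hh k * R i j"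
  "i < j \<Longrightarrow> j < k \<Longrightarrow> scale k (R i j) = R i j"
  "i < j \<Longrightarrow> Suc k < i \<Longrightarrow> scale k (R i j) = R i j"
  by (auto simp: scale_def substitute_R var_ix)

lemma straighten_R:
  "straighten k (R k (Suc k)) = R k (Suc k)"
  "Suc k < j \<Longrightarrow> straighten k (R k j) = R k j"
  "Suc k < j \<Longrightarrow> straighten k (R (Suc k) j) = R (Suc k) j + (\<Sum>l\<in>{Suc k<..<j}. R k l * R l j)"
  "i < k \<Longrightarrow> straighten k (R i k) = R i k + (\<Sum>l\<in>{i<..<k}. R i l * R l (Suc k))"
  "i < k \<Longrightarrow> straighten k (R i (Suc k)) = R i (Suc k)"
  "i < k \<Longrightarrow> Suc k < j \<Longrightarrow> straighten k (R i j) = R i j + R i (Suc k) * R k j"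
  "i < j \<Longrightarrow> j < k \<Longrightarrow> straighten k (R i j) = R i j"
  "i < j \<Longrightarrow> Suc k < i \<Longrightarrow> straighten k (R i j) = R i j"
  by (auto simp: straighten_def substitute_R var_ix)

lemma split_d_R:
  "split_d k (R k (Suc k)) = 0"
  "Suc k < j \<Longrightarrow> split_d k (R k j) = R (Suc k) j"
  "Suc k < j \<Longrightarrow> split_d k (R (Suc k) j) = 0"
  "i < k \<Longrightarrow> split_d k (R i k) = 0"
  "i < k \<Longrightarrow> split_d k (R i (Suc k)) = R i k"
  "i < k \<Longrightarrow> Suc k < j \<Longrightarrow> split_d k (R i j) = (\<Sum>l\<in>{i<..<k}. R i l * R l j) + (\<Sum>l\<in>{Suc k<..<j}. R i l * R l j)"
  "i < j \<Longrightarrow> j < k \<Longrightarrow> split_d k (R i j) = (\<Sum>l\<in>{i<..<j}. R i l * R l j)"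
  "i < j \<Longrightarrow> Suc k < i \<Longrightarrow> split_d k (R i j) = (\<Sum>l\<in>{i<..<j}. R i l * R l j)"
proof -
  show "split_d k (R i j) = (\<Sum>l\<in>{i<..<k}. R i l * R l j) + (\<Sum>l\<in>{Suc k<..<j}. R i l * R l j)"
    if "i < k" "Suc k < j"
  proof -
    have "{i<..<j} - {k, Suc k} = {i<..<k} \<union> {Suc k<..<j}" using that by auto
    then have "(\<Sum>l\<in>{i<..<j} - {k, Suc k}. R i l * R l j) = (\<Sum>l\<in>{i<..<k}. R i l * R l j) + (\<Sum>l\<in>{Suc k<..<j}. R i l * R l j)"
      by (simp only:) (rule sum.union_disjoint, auto)
    then show ?thesis
      using that by (auto simp: split_d_def ext_R on_defs ix_eq_iff)
  qed
qed (auto simp: split_d_def ext_R on_defs ix_eq_iff intro!: sum.cong)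

text \<open>The correction terms consist of variables that the substitution fixes.\<close>

lemma straighten_straighten: "straighten k (straighten k p) = p"
proof -
  note L = ring_hom_add[OF ring_hom_straighten] ring_hom_mult[OF ring_hom_straighten] ring_hom_sum[OF ring_hom_straighten]
  have v: "straighten k (straighten k (var v)) = var v" for v
  proof (cases v rule: index_cases[of _ k])
    case (row' j)
    have "straighten k (\<Sum>l\<in>{Suc k<..<j}. R k l * R l j) = (\<Sum>l\<in>{Suc k<..<j}. R k l * R l j)"
      unfolding L by (rule sum.cong) (auto simp: L straighten_R)
    then show ?thesis using row' by (simp add: var_ix straighten_R L(1) add.assoc)
  next
    case (col i)
    have "straighten k (\<Sum>l\<in>{i<..<k}. R i l * R l (Suc k)) = (\<Sum>l\<in>{i<..<k}. R i l * R l (Suc k))"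
      unfolding L by (rule sum.cong) (auto simp: L straighten_R)
    then show ?thesis using col by (simp add: var_ix straighten_R L(1) add.assoc)
  qed (auto simp: var_ix straighten_R L add.assoc)
  show ?thesis
    by (rule fun_cong[OF ring_hom_ext[OF ring_hom_comp[OF ring_hom_straighten ring_hom_straighten] ring_hom_id v]])
qed

lemma change_vars_R:
  "change_vars k (R k (Suc k)) = R k (Suc k)"
  "Suc k < j \<Longrightarrow> change_vars k (R k j) = R k j"
  "Suc k < j \<Longrightarrow> change_vars k (R (Suc k) j) = dX (R k j)"
  "i < k \<Longrightarrow> change_vars k (R i k) = dX (R i (Suc k))"
  "i < k \<Longrightarrow> change_vars k (R i (Suc k)) = R i (Suc k)"
  "i < k \<Longrightarrow> Suc k < j \<Longrightarrow> change_vars k (R i j) = hh k * R i j + R i (Suc k) * R k j"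
  "i < j \<Longrightarrow> j < k \<Longrightarrow> change_vars k (R i j) = R i j"
  "i < j \<Longrightarrow> Suc k < i \<Longrightarrow> change_vars k (R i j) = R i j"
  by (auto simp: change_vars_def straighten_R scale_R ring_hom_add[OF ring_hom_scale] ring_hom_mult[OF ring_hom_scale] ring_hom_sum[OF ring_hom_scale]
      dX_cases[where k=k] intro!: sum.cong)

lemma dX_change_vars: "dX (change_vars k p) = change_vars k (split_d k p)"
proof -
  note L = ring_hom_0[OF ring_hom_change_vars] ring_hom_add[OF ring_hom_change_vars] ring_hom_mult[OF ring_hom_change_vars] ring_hom_sum[OF ring_hom_change_vars]
  have v: "dX (change_vars k (var v)) = change_vars k (split_d k (var v))" for v
  proof (cases v rule: index_cases[of _ k])
    case (across i j)
    have "change_vars k (split_d k (R i j)) =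
        (\<Sum>l\<in>{i<..<k}. R i l * (hh k * R l j + R l (Suc k) * R k j)) +
        (\<Sum>l\<in>{Suc k<..<j}. (hh k * R i l + R i (Suc k) * R k l) * R l j)"
      using across by (simp add: split_d_R L change_vars_R cong: sum.cong_simp)
    also have "\<dots> = hh k * ((\<Sum>l\<in>{i<..<k}. R i l * R l j) + (\<Sum>l\<in>{Suc k<..<j}. R i l * R l j))
        + (\<Sum>l\<in>{i<..<k}. R i l * R l (Suc k)) * R k j + R i (Suc k) * (\<Sum>l\<in>{Suc k<..<j}. R k l * R l j)"
      by (simp add: algebra_simps sum.distrib sum_distrib_left sum_distrib_right)
    also have "\<dots> = dX (hh k * R i j + R i (Suc k) * R k j)"
      using across by (simp add: dX_add dX_mult dX_cases[where k=k]) (simp add: algebra_simps)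
    finally show ?thesis
      using across by (simp add: var_ix change_vars_R)
  qed (auto simp: var_ix split_d_R change_vars_R L dX_cases(7,8)[where k=k] intro!: sum.cong)
  show ?thesis
    by (rule fun_cong[OF twisted_der_ext[OF twisted_der_ring_hom_right[OF ring_hom_change_vars dX_twisted_der] twisted_der_ring_hom_left[OF ring_hom_change_vars twisted_der_split_d] ring_hom_change_vars v]])
qed

section \<open>Bounds on heights\<close>

lemma weight_mono: "(\<And>v. f v \<le> g v) \<Longrightarrow> weight f m \<le> weight g m"
  unfolding weight_def by (intro sum_mono mult_left_mono) auto

text \<open>A bound that need not be attained, for maps such as \<open>straighten\<close> that do not respect the full grading.\<close>

definition below :: "(index \<Rightarrow> int) \<Rightarrow> int \<Rightarrow> X \<Rightarrow> bool" where
  "below f b p \<longleftrightarrow> (\<forall>m\<in>Poly_Mapping.keys p. weight f m \<le> b)"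

lemma below_0 [simp]: "below f b 0"
  by (simp add: below_def)

lemma below_1: "below f 0 1"
  using keys_mnm[of 0] by (simp add: below_def)

lemma below_add: "below f b p \<Longrightarrow> below f b q \<Longrightarrow> below f b (p + q)"
  using keys_add[of p q] by (auto simp: below_def)

lemma below_sum: "(\<And>x. x \<in> S \<Longrightarrow> below f b (g x)) \<Longrightarrow> below f b (\<Sum>x\<in>S. g x)"
  by (induction S rule: infinite_finite_induct) (auto intro: below_add)

lemma below_mult: "below f b p \<Longrightarrow> below f b' q \<Longrightarrow> below f (b + b') (p * q)"
  using keys_mult[of p q] by (fastforce simp: below_def weight_add intro: add_mono)

lemma below_var: "below f (f v) (var v)"
  by (simp add: below_def var_eq_mnm)

lemma below_mono: "below f b p \<Longrightarrow> b \<le> b' \<Longrightarrow> below f b' p"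
  by (auto simp: below_def)

lemma below_ring_hom:
  assumes "ring_hom F" "\<And>v. below f (g v) (F (var v))" "below g b p"
  shows "below f b (F p)"
proof -
  have m: "below f (weight g m) (F (mnm m))" for m
  proof (induction m rule: mon_induct)
    case (add v m)
    have "F (mnm (Poly_Mapping.single v 1 + m)) = F (var v) * F (mnm m)"
      by (simp add: mnm_add var_eq_mnm ring_hom_mult[OF assms(1)])
    then show ?case
      using below_mult[OF assms(2) add] by (simp add: weight_add)
  qed (simp add: ring_hom_1[OF assms(1)] below_1)
  have "F p = (\<Sum>m\<in>Poly_Mapping.keys p. F (mnm m))"
    by (subst X_eq_sum_mnm[of p]) (simp add: ring_hom_sum[OF assms(1)])
  then show ?thesis
    using assms(3) by (auto simp: below_def[of g] intro!: below_sum intro: below_mono[OF m])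
qed

text \<open>The factor by which \<open>scale k\<close> multiplies a monomial is \<open>hh k\<close> to this power.\<close>

definition scale_deg :: "nat \<Rightarrow> mon \<Rightarrow> nat" where
  "scale_deg k m = nat (weight (\<lambda>v. of_bool (lo v = Suc k \<or> hi v = k \<or> lo v < k \<and> Suc k < hi v)) m)"

lemma scale_deg_0 [simp]: "scale_deg k 0 = 0"
  by (simp add: scale_deg_def)

lemma scale_deg_add: "scale_deg k (m + m') = scale_deg k m + scale_deg k m'"
  by (simp add: scale_deg_def weight_add nat_add_distrib weight_nonneg)

lemma scale_mnm: "scale k (mnm m) = hh k ^ scale_deg k m * mnm m"
proof (induction m rule: mon_induct)
  case (add v m)
  have "scale_deg k (Poly_Mapping.single v 1) = of_bool (lo v = Suc k \<or> hi v = k \<or> lo v < k \<and> Suc k < hi v)"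
    by (simp add: scale_deg_def)
  moreover have "scale k (var v) = (if lo v = Suc k \<or> hi v = k \<or> lo v < k \<and> Suc k < hi v then hh k * var v else var v)"
    by (simp add: scale_def)
  ultimately have "scale k (var v) = hh k ^ scale_deg k (Poly_Mapping.single v 1) * var v"
    by simp
  moreover have "mnm (Poly_Mapping.single v 1 + m) = var v * mnm m"
    by (simp add: mnm_add var_eq_mnm)
  ultimately show ?case
    by (simp only: ring_hom_mult[OF ring_hom_scale] add scale_deg_add power_add) (simp only: mult_ac)
qed (simp add: ring_hom_1[OF ring_hom_scale])

lemma scale_deg_hh_power [simp]: "scale_deg k (Poly_Mapping.single (ix k (Suc k)) n) = 0"
  by (simp add: scale_deg_def)

text \<open>Distinct monomials have distinct images: the power of \<open>hh k\<close> that is added can be read off from the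
  other exponents.\<close>

lemma scale_eq_0D:
  assumes "scale k p = 0"
  shows "p = 0"
proof -
  let ?g = "\<lambda>m. Poly_Mapping.single (ix k (Suc k)) (scale_deg k m) + m"
  have "scale k p = (\<Sum>m\<in>Poly_Mapping.keys p. mnm (?g m))"
    by (subst X_eq_sum_mnm[of p]) (simp add: ring_hom_sum[OF ring_hom_scale] scale_mnm mnm_add mnm_single var_ix)
  also have inj: "inj ?g"
  proof (rule injI)
    fix m m' assume e: "?g m = ?g m'"
    let ?i = "Poly_Mapping.single (ix k (Suc k))"
    have "m + ?i (scale_deg k m) = m' + ?i (scale_deg k m')" using e by (simp add: add.commute)
    then have "scale_deg k (m + ?i (scale_deg k m)) = scale_deg k (m' + ?i (scale_deg k m'))" by metis
    then have "scale_deg k m = scale_deg k m'" unfolding scale_deg_add scale_deg_hh_power by simp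
    then show "m = m'" using e by simp
  qed
  then have "(\<Sum>m\<in>Poly_Mapping.keys p. mnm (?g m)) = (\<Sum>m\<in>?g ` Poly_Mapping.keys p. mnm m)"
    by (subst sum.reindex) (auto intro: inj_on_subset)
  finally have "Poly_Mapping.keys (\<Sum>m\<in>?g ` Poly_Mapping.keys p. mnm m) = {}"
    using assms by simp
  then show ?thesis
    by (simp add: keys_sum_mnm)
qed

lemma change_vars_inj: "change_vars k p = change_vars k q \<Longrightarrow> p = q"
proof -
  assume "change_vars k p = change_vars k q"
  then have "scale k (straighten k (p + q)) = 0"
    by (simp add: change_vars_def ring_hom_add[OF ring_hom_scale] ring_hom_add[OF ring_hom_straighten])
  then have "straighten k (straighten k (p + q)) = 0"
    using scale_eq_0D ring_hom_0[OF ring_hom_straighten] by metis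
  then show ?thesis by (simp add: straighten_straighten char2_eqI)
qed

lemma split_d_split_d [simp]: "split_d k (split_d k p) = 0"
  by (rule change_vars_inj[of k]) (simp add: ring_hom_0[OF ring_hom_change_vars] flip: dX_change_vars)

text \<open>An inverse image under \<open>scale k\<close> of \<open>p\<close> times the \<open>N\<close>-th power of \<open>hh k\<close>, for \<open>N\<close> large.\<close>

definition unscale :: "nat \<Rightarrow> nat \<Rightarrow> X \<Rightarrow> X" where
  "unscale k N = linear_ext (\<lambda>m. hh k ^ (N - scale_deg k m) * mnm m)"

lemma scale_unscale:
  assumes "\<And>m. m \<in> Poly_Mapping.keys p \<Longrightarrow> scale_deg k m \<le> N"
  shows "scale k (unscale k N p) = hh k ^ N * p"
proof (rule additive_ext[where p = p and F = "\<lambda>p. scale k (unscale k N p)" and G = "\<lambda>p. hh k ^ N * p"])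
  show "additive_map (\<lambda>p. scale k (unscale k N p))"
    by (simp add: additive_map_def unscale_def additive_add[OF linear_ext_additive] ring_hom_add[OF ring_hom_scale])
  fix m assume "m \<in> Poly_Mapping.keys p"
  then have "hh k ^ N = hh k ^ (N - scale_deg k m) * hh k ^ scale_deg k m"
    using assms by (simp flip: power_add)
  then show "scale k (unscale k N (mnm m)) = hh k ^ N * mnm m"
    by (simp add: unscale_def ring_hom_mult[OF ring_hom_scale] ring_hom_power[OF ring_hom_scale] scale_R scale_mnm mult.assoc)
qed (simp add: additive_map_def distrib_left)

text \<open>The numbering of the indices after \<open>k\<close>, \<open>k + 1\<close> and \<open>k + 2\<close> have been pushed together to the single
  position \<open>k\<close>. Heights measured in this numbering do not see the wall; they are preserved by
  \<open>straighten k\<close>, and they agree with the height in the smaller copy of the algebra.\<close>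

definition squash :: "nat \<Rightarrow> nat \<Rightarrow> nat" where
  "squash k i = (if i \<le> k then i else if i = Suc k then k else i - 2)"

definition short_height :: "nat \<Rightarrow> index \<Rightarrow> int" where
  "short_height k v = int (squash k (hi v)) - int (squash k (lo v))"

lemma below_R: "i < j \<Longrightarrow> below (short_height k) (int (squash k j) - int (squash k i)) (R i j)"
  using below_var[of "short_height k" "ix i j"] by (simp add: var_ix short_height_def)

lemma below_RR: "i < l \<Longrightarrow> l < j \<Longrightarrow> below (short_height k) (int (squash k j) - int (squash k i)) (R i l * R l j)"
  using below_mult[OF below_R[of i l k] below_R[of l j k]] by simp

lemma below_straighten:
  assumes "below (short_height k) b p"
  shows "below (short_height k) b (straighten k p)"
proof (rule below_ring_hom[OF ring_hom_straighten _ assms])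
  fix v
  show "below (short_height k) (short_height k v) (straighten k (var v))"
  proof (cases v rule: index_cases[of _ k])
    case (row' j)
    have "below (short_height k) (int (squash k j) - int (squash k (Suc k))) (R k l * R l j)" if "Suc k < l" "l < j" for l
      using below_RR[of k l j k] that by (simp add: squash_def)
    then show ?thesis
      using row' by (auto simp: var_ix straighten_R short_height_def intro!: below_add below_sum below_R)
  next
    case (col i)
    have "below (short_height k) (int (squash k k) - int (squash k i)) (R i l * R l (Suc k))" if "i < l" "l < k" for l
      using below_RR[of i l "Suc k" k] that by (simp add: squash_def)
    then show ?thesis
      using col by (auto simp: var_ix straighten_R short_height_def intro!: below_add below_sum below_R)
  next
    case (across i j)
    have "below (short_height k) (int (squash k j) - int (squash k i)) (R i (Suc k) * R k j)"
      using below_mult[OF below_R[of i "Suc k" k] below_R[of k j k]] across by (simp add: squash_def)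
    then show ?thesis
      using across by (auto simp: var_ix straighten_R short_height_def intro!: below_add below_R)
  qed (auto simp: var_ix straighten_R short_height_def intro!: below_R)
qed

lemma below_unscale:
  assumes "below (short_height k) b p"
  shows "below (short_height k) b (unscale k N p)"
proof -
  have "below (short_height k) 0 (hh k)"
    using below_R[of k "Suc k" k] by (simp add: squash_def)
  then have h: "below (short_height k) 0 (hh k ^ n)" for n
    by (induction n) (use below_1 below_mult[of "short_height k" 0 _ 0] in auto)
  show ?thesis
    unfolding unscale_def linear_ext_def
  proof (rule below_sum)
    fix m assume "m \<in> Poly_Mapping.keys p"
    then have "below (short_height k) b (mnm m)" using assms by (simp add: below_def)
    then show "below (short_height k) b (hh k ^ (N - scale_deg k m) * mnm m)"
      using below_mult[OF h] by fastforce
  qed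
qed

lemma short_height_le: "2 * short_height k v + wall_wt k (var_grade v) \<le> 2 * var_grade v (Suc 0)"
  by (cases v rule: index_cases[of _ k]) (auto simp: wall_wt_var_grade short_height_def squash_def var_grade_ix)

lemma weight_wall_wt: "weight (\<lambda>v. wall_wt k (var_grade v)) m = wall_wt k (grade m)"
  by (simp add: wall_wt_def grade_def weight_def right_diff_distrib sum_subtractf)

text \<open>Positive wall weight forces a factor \<open>R i j\<close> that crosses the wall, whose height shrinks.\<close>

lemma short_height_less_height:
  assumes "wall_wt k (grade m) > 0"
  shows "weight (short_height k) m < grade m (Suc 0)"
proof -
  have "weight (\<lambda>v. 2 * short_height k v + wall_wt k (var_grade v)) m \<le> weight (\<lambda>v. 2 * var_grade v (Suc 0)) m"
    by (rule weight_mono) (rule short_height_le)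
  moreover have "weight (\<lambda>v. 2 * short_height k v + wall_wt k (var_grade v)) m = 2 * weight (short_height k) m + wall_wt k (grade m)"
    by (simp add: weight_def distrib_left sum.distrib mult.left_commute flip: weight_wall_wt sum_distrib_left)
  moreover have "weight (\<lambda>v. 2 * var_grade v (Suc 0)) m = 2 * grade m (Suc 0)"
    by (simp add: grade_def weight_def mult.left_commute flip: sum_distrib_left)
  ultimately show ?thesis using assms by linarith
qed

section \<open>Removing a wall\<close>

definition far :: "nat \<Rightarrow> nat \<Rightarrow> bool" where
  "far k i \<longleftrightarrow> i \<noteq> k \<and> i \<noteq> Suc k"

abbreviation core :: "nat \<Rightarrow> index \<Rightarrow> bool" where
  "core k v \<equiv> far k (lo v) \<and> far k (hi v)"

text \<open>The order isomorphism from the indices other than \<open>k\<close>, \<open>k + 1\<close> to all indices, and its inverse.\<close>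

definition down :: "nat \<Rightarrow> nat \<Rightarrow> nat" where
  "down k i = (if i < k then i else i - 2)"

definition up :: "nat \<Rightarrow> nat \<Rightarrow> nat" where
  "up k i = (if i < k then i else i + 2)"

lemma down_up [simp]: "down k (up k i) = i"
  and far_up [simp]: "far k (up k i)"
  and up_down: "far k i \<Longrightarrow> up k (down k i) = i"
  and up_less [simp]: "up k i < up k j \<longleftrightarrow> i < j"
  and down_less: "far k i \<Longrightarrow> far k j \<Longrightarrow> i < j \<Longrightarrow> down k i < down k j"
  by (auto simp: down_def up_def far_def)

text \<open>The copy of the algebra on the indices other than \<open>k\<close>, \<open>k + 1\<close> is identified with \<^typ>\<open>X\<close>. In the
  direction to \<^typ>\<open>X\<close> all remaining variables become \<open>1\<close>; this loses nothing on a slice in which their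
  exponents are fixed.\<close>

definition collapse :: "nat \<Rightarrow> X \<Rightarrow> X" where
  "collapse k = substitute (\<lambda>v. if core k v then R (down k (lo v)) (down k (hi v)) else 1)"

definition spread :: "nat \<Rightarrow> X \<Rightarrow> X" where
  "spread k = substitute (\<lambda>v. R (up k (lo v)) (up k (hi v)))"

lemma ring_hom_collapse: "ring_hom (collapse k)" and ring_hom_spread: "ring_hom (spread k)"
  unfolding collapse_def spread_def by (rule ring_hom_substitute)+

lemma collapse_var: "collapse k (var v) = (if core k v then R (down k (lo v)) (down k (hi v)) else 1)"
  by (simp add: collapse_def)

lemma spread_R: "i < j \<Longrightarrow> spread k (R i j) = R (up k i) (up k j)"
  by (simp add: spread_def substitute_R)

lemma collapse_spread: "collapse k (spread k p) = p"
proof -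
  have v: "collapse k (spread k (var v)) = var v" for v
    using lo_less_hi[of v] by (simp add: var_eq_R[of v] spread_R) (simp add: var_ix[symmetric] collapse_var)
  show ?thesis
    by (rule fun_cong[OF ring_hom_ext[OF ring_hom_comp[OF ring_hom_collapse ring_hom_spread] ring_hom_id v]])
qed

lemma spread_collapse_var: "core k v \<Longrightarrow> spread k (collapse k (var v)) = var v"
  using lo_less_hi[of v] by (simp add: collapse_var spread_R down_less up_down) (simp add: var_eq_R)

lemma split_d_spread: "split_d k (spread k p) = spread k (dX p)"
proof -
  have v: "split_d k (spread k (var v)) = spread k (dX (var v))" for v
  proof -
    define i j where "i = lo v" and "j = hi v"
    have ij: "i < j" using lo_less_hi by (simp add: i_def j_def)
    have img: "{up k i<..<up k j} - {k, Suc k} = up k ` {i<..<j}"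
    proof (intro equalityI subsetI)
      fix l assume l: "l \<in> {up k i<..<up k j} - {k, Suc k}"
      then have "far k l" by (auto simp: far_def)
      then have "l = up k (down k l)" by (simp add: up_down)
      then show "l \<in> up k ` {i<..<j}" using l up_less by (metis DiffD1 greaterThanLessThan_iff image_eqI)
    qed (auto simp: up_def)
    have "split_d k (R (up k i) (up k j)) = (\<Sum>l\<in>{up k i<..<up k j} - {k, Suc k}. R (up k i) l * R l (up k j))"
    proof -
      have "far k (up k i)" "far k (up k j)" by simp_all
      then show ?thesis
        using ij by (auto simp: split_d_def ext_R on_defs ix_eq_iff far_def simp del: far_up)
    qed
    also have "\<dots> = (\<Sum>l\<in>{i<..<j}. R (up k i) (up k l) * R (up k l) (up k j))"
      unfolding img by (subst sum.reindex) (auto simp: inj_on_def dest: arg_cong[of _ _ "down k"])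
    also have "\<dots> = spread k (\<Sum>l\<in>{i<..<j}. R i l * R l j)"
      by (simp add: ring_hom_sum[OF ring_hom_spread] ring_hom_mult[OF ring_hom_spread] spread_R)
    finally show ?thesis
      using ij by (simp add: var_eq_R spread_R dX_R i_def j_def)
  qed
  show ?thesis
    by (rule fun_cong[OF twisted_der_ext[OF twisted_der_ring_hom_right[OF ring_hom_spread twisted_der_split_d] twisted_der_ring_hom_left[OF ring_hom_spread dX_twisted_der] ring_hom_spread v]])
qed

lemma below_collapse:
  assumes "below (short_height k) b p"
  shows "below (\<lambda>v. var_grade v (Suc 0)) b (collapse k p)"
proof (rule below_ring_hom[OF ring_hom_collapse _ assms])
  fix v
  show "below (\<lambda>v. var_grade v (Suc 0)) (short_height k v) (collapse k (var v))"
  proof (cases "core k v")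
    case True
    then have "int (down k (hi v)) - int (down k (lo v)) = short_height k v"
      using lo_less_hi[of v] by (auto simp: short_height_def squash_def down_def far_def)
    then show ?thesis
      using True below_var[of "\<lambda>v. var_grade v (Suc 0)" "ix (down k (lo v)) (down k (hi v))"] lo_less_hi[of v]
      by (simp add: collapse_var var_ix var_grade_ix down_less)
  next
    case False
    have "short_height k v \<ge> 0"
      using lo_less_hi[of v] by (auto simp: short_height_def squash_def)
    then show ?thesis
      using False below_mono[OF below_1] by (auto simp: collapse_var)
  qed
qed

text \<open>The part of a monomial that \<^const>\<open>collapse\<close> forgets.\<close>

definition inert :: "nat \<Rightarrow> mon \<Rightarrow> mon" where
  "inert k m = Poly_Mapping.mapp (\<lambda>v e. if core k v then 0 else e) m"

lemma lookup_inert: "Poly_Mapping.lookup (inert k m) v = (if core k v then 0 else Poly_Mapping.lookup m v)"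
  by (simp add: inert_def lookup_mapp when_def in_keys_iff)

lemma inert_add: "inert k (m + m') = inert k m + inert k m'"
  by (rule poly_mapping_eqI) (simp add: lookup_inert lookup_add)

lemma inert_0 [simp]: "inert k 0 = 0"
  by (rule poly_mapping_eqI) (simp add: lookup_inert)

lemma inert_single: "inert k (Poly_Mapping.single v n) = (if core k v then 0 else Poly_Mapping.single v n)"
  by (rule poly_mapping_eqI) (auto simp: lookup_inert lookup_single when_def)

lemma mnm_decomp: "mnm m = mnm (inert k m) * spread k (collapse k (mnm m))"
proof (induction m rule: mon_induct)
  case (add v m)
  have e: "mnm (Poly_Mapping.single v 1 + m) = var v * mnm m"
    by (simp add: mnm_add var_eq_mnm)
  have "mnm (inert k (Poly_Mapping.single v 1 + m)) = (if core k v then 1 else var v) * mnm (inert k m)"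
    by (auto simp: inert_add inert_single mnm_add var_eq_mnm)
  moreover have "spread k (collapse k (var v)) = (if core k v then var v else 1)"
      using spread_collapse_var[of k v] by (auto simp: collapse_var ring_hom_1[OF ring_hom_spread])
  ultimately have "mnm (inert k (Poly_Mapping.single v 1 + m)) * spread k (collapse k (var v * mnm m))
      = var v * (mnm (inert k m) * spread k (collapse k (mnm m)))"
    by (auto simp: ring_hom_mult[OF ring_hom_collapse] ring_hom_mult[OF ring_hom_spread] mult_ac)
  then show ?case
    unfolding e using add by metis
qed (simp add: ring_hom_1[OF ring_hom_collapse] ring_hom_1[OF ring_hom_spread])

lemma inert_spread: "m \<in> Poly_Mapping.keys (spread k p) \<Longrightarrow> inert k m = 0"
proof -
  have "\<forall>m\<in>Poly_Mapping.keys (spread k p). inert k m = 0"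
  proof (induction p rule: X_induct)
    case (scalar c)
    then show ?case
      using keys_mnm[of 0] by (cases c) (simp_all add: ring_hom_0[OF ring_hom_spread] ring_hom_1[OF ring_hom_spread])
  next
    case (var v)
    have "spread k (var v) = var (ix (up k (lo v)) (up k (hi v)))"
      by (simp add: spread_def var_ix)
    then show ?case
      using lo_less_hi[of v] by (simp add: var_eq_mnm inert_single)
  next
    case (add p q)
    then show ?case
      using keys_add[of "spread k p" "spread k q"] by (auto simp: ring_hom_add[OF ring_hom_spread])
  next
    case (mult p q)
    then show ?case
      using keys_mult[of "spread k p" "spread k q"] by (force simp: ring_hom_mult[OF ring_hom_spread] inert_add)
  qed
  then show "m \<in> Poly_Mapping.keys (spread k p) \<Longrightarrow> inert k m = 0" by blast
qed

lemma inert_mnm_mult_spread: "m \<in> Poly_Mapping.keys (mnm \<mu> * spread k p) \<Longrightarrow> inert k m = inert k \<mu>"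
  using keys_mult[of "mnm \<mu>" "spread k p"] by (force simp: inert_add inert_spread)

lemma inert_inert [simp]: "inert k (inert k m) = inert k m"
  by (rule poly_mapping_eqI) (simp add: lookup_inert)

lemma collapse_inert: "collapse k (mnm (inert k m)) = 1"
proof -
  have "collapse k (mnm (inert k m)) = (\<Prod>v\<in>Poly_Mapping.keys (inert k m). 1)"
    unfolding collapse_def substitute_mnm subst_mon_def
    by (rule prod.cong) (auto simp: in_keys_iff lookup_inert split: if_splits)
  then show ?thesis by simp
qed

definition partner :: "nat \<Rightarrow> index \<Rightarrow> index" where
  "partner k v = (if on_row k v then ix (Suc k) (hi v) else ix (lo v) k)"

definition side :: "nat \<Rightarrow> index \<Rightarrow> bool" where
  "side k v \<longleftrightarrow> on_row k v \<or> on_col k v"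

text \<open>The monomials that survive the contraction of all cones. On their inert parts the new differential
  vanishes, because these are products of squares and constants.\<close>

definition triv :: "nat \<Rightarrow> mon \<Rightarrow> bool" where
  "triv k m \<longleftrightarrow> (\<forall>v. side k v \<longrightarrow> cone_triv v (partner k v) m)"

lemma split_d_inert:
  assumes "triv k m"
  shows "split_d k (mnm (inert k m)) = 0"
proof -
  have z: "Poly_Mapping.single (inert k m - Poly_Mapping.single v 1) (of_nat (Poly_Mapping.lookup (inert k m) v)) * split_d k (var v) = 0"
    if "v \<in> Poly_Mapping.keys (inert k m)" for v
  proof (cases "side k v")
    case True
    then have "even (Poly_Mapping.lookup m v)"
      using assms by (auto simp: triv_def cone_triv_def)
    then have "even (Poly_Mapping.lookup (inert k m) v)"
      by (simp add: lookup_inert)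
    then have "(of_nat (Poly_Mapping.lookup (inert k m) v) :: bit) = 0"
      by (simp add: of_nat_char2)
    then show ?thesis by (simp only: single_zero mult_zero_left)
  next
    case False
    have "\<not> core k v" using that by (auto simp: in_keys_iff lookup_inert)
    then have "split_d k (var v) = 0"
      using False by (cases v rule: index_cases[of _ k]) (auto simp: side_def on_defs var_ix split_d_R far_def)
    then show ?thesis by simp
  qed
  have "split_d k (mnm (inert k m)) = (\<Sum>v\<in>Poly_Mapping.keys (inert k m).
     Poly_Mapping.single (inert k m - Poly_Mapping.single v 1) (of_nat (Poly_Mapping.lookup (inert k m) v)) * split_d k (var v))"
    unfolding split_d_def by (simp add: mnm_def extend_deriv_single mono_deriv_def extend_deriv_var)
  also have "\<dots> = 0" by (rule sum.neutral) (use z in blast)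
  finally show ?thesis .
qed

lemma split_d_triv:
  assumes "triv k m"
  shows "split_d k (mnm m) = mnm (inert k m) * spread k (dX (collapse k (mnm m)))"
  by (subst mnm_decomp[of m k])
    (simp add: twisted_der_mult[OF twisted_der_split_d] split_d_inert[OF assms] split_d_spread)

lemma slice_comm:
  assumes "additive_map F"
    and "\<And>m m'. m \<in> Poly_Mapping.keys p \<Longrightarrow> m' \<in> Poly_Mapping.keys (F (mnm m)) \<Longrightarrow> f m' = f m"
  shows "slice f c (F p) = F (slice f c p)"
proof (rule additive_ext[where p = p and F = "\<lambda>p. slice f c (F p)" and G = "\<lambda>p. F (slice f c p)"])
  fix m assume m: "m \<in> Poly_Mapping.keys p"
  show "slice f c (F (mnm m)) = F (slice f c (mnm m))"
  proof (cases "f m = c")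
    case True
    have "slice f c (F (mnm m)) = F (mnm m)" by (rule slice_id) (use assms(2)[OF m] True in auto)
    moreover have "slice f c (mnm m) = mnm m" by (rule slice_id) (use True in auto)
    ultimately show ?thesis by simp
  next
    case False
    have "slice f c (F (mnm m)) = 0" by (rule slice_other) (use assms(2)[OF m] False in auto)
    moreover have "slice f c (mnm m) = 0" by (rule slice_other) (use False in auto)
    ultimately show ?thesis using additive_0[OF assms(1)] by simp
  qed
qed (use assms(1) in \<open>simp_all add: additive_map_def slice_add\<close>)

lemma slice_var_mult:
  assumes "\<And>m. f (Poly_Mapping.single v 1 + m) = f m"
  shows "slice f c (var v * p) = var v * slice f c p"
  by (rule slice_comm) (use assms in \<open>auto simp: additive_map_def distrib_left keys_var_mult\<close>)

text \<open>The assertion to be proved by induction on the bound \<open>H\<close> for the height: \<open>h\<^sub>n\<^sup>2 x = 0\<close> in homology implies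
  \<open>h\<^sub>n x = 0\<close>. It is stated for all \<open>x\<close> and not only for cycles, as \<open>h\<^sub>n\<^sup>2 x\<close> being a cycle forces \<open>x\<close> to be one.\<close>

definition torsion_simple :: "int \<Rightarrow> bool" where
  "torsion_simple H \<longleftrightarrow>
     (\<forall>n x y. below (\<lambda>v. var_grade v (Suc 0)) H x \<longrightarrow> hh n * (hh n * x) = dX y \<longrightarrow> boundary (hh n * x))"

text \<open>For polynomials in the surviving monomials the equation splits into equations for the coefficients of the
  inert monomials. Those are equations in the smaller copy of the algebra, which is isomorphic to \<^typ>\<open>X\<close>.\<close>

lemma trivial_descent:
  assumes ts: "torsion_simple H" and P: "below (short_height k) H P"
    and triv: "\<And>m. m \<in> Poly_Mapping.keys P \<Longrightarrow> triv k m" "\<And>m. m \<in> Poly_Mapping.keys Q \<Longrightarrow> triv k m"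
    and n: "far k n" "far k (Suc n)" and eq: "hh n * (hh n * P) = split_d k Q"
  shows "\<exists>Z. hh n * P = split_d k Z"
proof -
  \<comment> \<open>The index of \<open>hh n\<close> in the smaller copy of the algebra.\<close>
  define n' where "n' = down k n"
  have hn: "hh n = spread k (hh n')" "collapse k (hh n) = hh n'"
  proof -
    have "up k n' = n" "up k (Suc n') = Suc n" "down k (Suc n) = Suc n'"
      using n by (auto simp: n'_def up_def down_def far_def)
    then show "hh n = spread k (hh n')" by (simp add: spread_R)
    then show "collapse k (hh n) = hh n'" by (simp add: collapse_spread)
  qed
  have core_n: "core k (ix n (Suc n))" using n by simp
  have "\<exists>Z. hh n * slice (inert k) \<mu> P = split_d k Z" if \<mu>: "\<mu> \<in> inert k ` Poly_Mapping.keys P" for \<mu>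
  proof -
    obtain m0 where m0: "\<mu> = inert k m0" "triv k m0" using \<mu> triv by auto
    let ?P = "slice (inert k) \<mu> P" and ?Q = "slice (inert k) \<mu> Q"
    have "slice (inert k) \<mu> (hh n * p) = hh n * slice (inert k) \<mu> p" for p
      using slice_var_mult[of "inert k" "ix n (Suc n)"] core_n by (simp add: inert_add inert_single var_ix)
    then have "hh n * (hh n * ?P) = slice (inert k) \<mu> (split_d k Q)"
      by (simp flip: eq)
    also have "\<dots> = split_d k ?Q"
      by (rule slice_comm[OF twisted_der_additive[OF twisted_der_split_d]])
        (use triv in \<open>auto simp: split_d_triv dest: inert_mnm_mult_spread\<close>)
    also have "\<dots> = mnm \<mu> * spread k (dX (collapse k ?Q))"
      by (rule additive_ext[where p = ?Q and F = "split_d k" and G = "\<lambda>q. mnm \<mu> * spread k (dX (collapse k q))"])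
        (use triv in \<open>auto simp: twisted_der_add[OF twisted_der_split_d] additive_map_def ring_hom_add[OF ring_hom_collapse]
           ring_hom_add[OF ring_hom_spread] dX_add distrib_left keys_slice split_d_triv\<close>)
    finally have e: "hh n * (hh n * ?P) = mnm \<mu> * spread k (dX (collapse k ?Q))" .
    have "collapse k (hh n * (hh n * ?P)) = collapse k (mnm \<mu> * spread k (dX (collapse k ?Q)))"
      using e by metis
    then have "hh n' * (hh n' * collapse k ?P) = dX (collapse k ?Q)"
      by (simp add: ring_hom_mult[OF ring_hom_collapse] hn(2) m0(1) collapse_inert collapse_spread)
    moreover have "below (short_height k) H ?P" using P by (auto simp: below_def keys_slice)
    then have "below (\<lambda>v. var_grade v (Suc 0)) H (collapse k ?P)" by (rule below_collapse)
    ultimately have "boundary (hh n' * collapse k ?P)"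
      using ts unfolding torsion_simple_def by blast
    then obtain z where z: "hh n' * collapse k ?P = dX z"
      unfolding boundary_def by blast
    have "?P = mnm \<mu> * spread k (collapse k ?P)"
      by (rule additive_ext[where p = ?P and F = "\<lambda>q. q" and G = "\<lambda>q. mnm \<mu> * spread k (collapse k q)"])
        (auto simp: additive_map_def ring_hom_add[OF ring_hom_collapse] ring_hom_add[OF ring_hom_spread] distrib_left keys_slice
          simp flip: mnm_decomp)
    then have "hh n * ?P = mnm \<mu> * spread k (hh n' * collapse k ?P)"
      by (simp add: ring_hom_mult[OF ring_hom_spread] flip: hn(1)) (metis mult.left_commute)
    also have "\<dots> = split_d k (mnm \<mu> * spread k z)"
      unfolding z by (simp add: twisted_der_mult[OF twisted_der_split_d] m0 split_d_inert split_d_spread)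
    finally show ?thesis by blast
  qed
  then obtain Z where Z: "\<And>\<mu>. \<mu> \<in> inert k ` Poly_Mapping.keys P \<Longrightarrow> hh n * slice (inert k) \<mu> P = split_d k (Z \<mu>)"
    by metis
  have "hh n * P = (\<Sum>\<mu>\<in>inert k ` Poly_Mapping.keys P. hh n * slice (inert k) \<mu> P)"
    by (subst X_eq_sum_slice[of P "inert k"]) (simp add: sum_distrib_left)
  also have "\<dots> = split_d k (\<Sum>\<mu>\<in>inert k ` Poly_Mapping.keys P. Z \<mu>)"
    by (simp add: Z twisted_der_sum[OF twisted_der_split_d])
  finally show ?thesis by blast
qed

section \<open>Localisation at a distant wall\<close>

lemma free_of_R: "ix i j \<notin> V \<Longrightarrow> free_of V (R i j)"
  using free_of_var[of "ix i j" V] by (simp add: var_ix)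

lemma cone_split:
  assumes "side k v"
  shows "split_d k (cone_contraction v (partner k v) p) + cone_contraction v (partner k v) (split_d k p) = p + slice (cone_triv v (partner k v)) True p"
proof -
  have v: "(\<exists>j. v = ix k j \<and> partner k v = ix (Suc k) j \<and> Suc k < j) \<or> (\<exists>i. v = ix i (Suc k) \<and> partner k v = ix i k \<and> i < k)"
    using assms by (cases v rule: index_cases[of _ k]) (auto simp: side_def on_defs partner_def ix_eq_iff)
  show ?thesis
  proof (rule cone_homotopy[OF twisted_der_split_d])
    show "v \<noteq> partner k v" "split_d k (var v) = var (partner k v)" "split_d k (var (partner k v)) = 0"
      using v by (auto simp: var_ix split_d_R ix_eq_iff)
    show "free_of {v, partner k v} (split_d k (var w))" if "w \<notin> {v, partner k v}" for w
      using that v by (cases w rule: index_cases[of _ k])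
        (auto simp: var_ix split_d_R ix_eq_iff intro!: free_of_add free_of_sum free_of_mult free_of_R)
  qed
qed

text \<open>Finitely many cones are contracted one after the other. The retraction onto the surviving monomials is a
  chain map homotopic to the identity.\<close>

definition trivial_part :: "nat \<Rightarrow> index set \<Rightarrow> X \<Rightarrow> X" where
  "trivial_part k S = slice (\<lambda>m. \<forall>v\<in>S. cone_triv v (partner k v) m) True"

lemma trivial_part_insert: "trivial_part k (insert v S) p = slice (cone_triv v (partner k v)) True (trivial_part k S p)"
  by (rule poly_mapping_eqI) (auto simp: trivial_part_def lookup_slice)

lemma trivial_part_empty: "trivial_part k {} p = p"
  unfolding trivial_part_def by (rule slice_id) simp

lemma split_d_cone_slice:
  assumes "side k v"
  shows "split_d k (slice (cone_triv v (partner k v)) True p) = slice (cone_triv v (partner k v)) True (split_d k p)"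
proof -
  let ?r = "slice (cone_triv v (partner k v)) True" and ?s = "cone_contraction v (partner k v)"
  have "split_d k (p + ?r p) = split_d k (?s (split_d k p))"
    by (simp add: twisted_der_add[OF twisted_der_split_d] flip: cone_split[OF assms])
  also have "\<dots> = split_d k p + ?r (split_d k p)"
    using cone_split[OF assms, of "split_d k p"] by (simp add: additive_0[OF cone_contraction_additive])
  finally show ?thesis by (simp add: twisted_der_add[OF twisted_der_split_d])
qed

lemma split_d_trivial_part:
  assumes "finite S" "\<And>v. v \<in> S \<Longrightarrow> side k v"
  shows "split_d k (trivial_part k S p) = trivial_part k S (split_d k p)"
  using assms by (induction S rule: finite_induct) (simp_all add: trivial_part_empty trivial_part_insert split_d_cone_slice)

lemma trivial_part_homotopic:
  assumes "finite S" "\<And>v. v \<in> S \<Longrightarrow> side k v" "split_d k w = 0"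
  shows "\<exists>Z. w + trivial_part k S w = split_d k Z"
  using assms
proof (induction S rule: finite_induct)
  case empty
  show ?case by (intro exI[of _ 0]) (simp add: trivial_part_empty twisted_der_0[OF twisted_der_split_d])
next
  case (insert v S)
  then obtain Z where Z: "w + trivial_part k S w = split_d k Z" by auto
  have "split_d k (trivial_part k S w) = 0"
    using insert by (simp add: split_d_trivial_part) (simp add: trivial_part_def)
  then have "trivial_part k S w + trivial_part k (insert v S) w = split_d k (cone_contraction v (partner k v) (trivial_part k S w))"
    using cone_split[of k v "trivial_part k S w"] insert.prems
    by (simp add: trivial_part_insert additive_0[OF cone_contraction_additive])
  then have "(w + trivial_part k S w) + (trivial_part k S w + trivial_part k (insert v S) w) = split_d k (Z + cone_contraction v (partner k v) (trivial_part k S w))"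
    by (simp add: Z twisted_der_add[OF twisted_der_split_d])
  then have "w + trivial_part k (insert v S) w = split_d k (Z + cone_contraction v (partner k v) (trivial_part k S w))"
    by (simp add: add.assoc)
  then show ?case by blast
qed

lemma finite_hi: "finite {v. hi v \<le> N}"
proof (rule finite_subset)
  show "{v. hi v \<le> N} \<subseteq> (\<lambda>(i, j). ix i j) ` ({..N} \<times> {..N})"
  proof
    fix v assume "v \<in> {v. hi v \<le> N}"
    then show "v \<in> (\<lambda>(i, j). ix i j) ` ({..N} \<times> {..N})"
      using lo_less_hi[of v] by (intro image_eqI[of _ _ "(lo v, hi v)"]) auto
  qed
qed simp

lemma change_vars_hh_far: "far k n \<Longrightarrow> far k (Suc n) \<Longrightarrow> change_vars k (hh n) = hh n"
proof -
  assume "far k n" "far k (Suc n)"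
  then have "Suc n < k \<or> Suc k < n" by (auto simp: far_def)
  then show ?thesis by (auto simp: change_vars_R)
qed

text \<open>Multiply \<open>x\<close> and \<open>y\<close> by a power of \<open>hh k\<close> to write them in the new variables. Contracting the cones reduces
  the equation to the surviving monomials and thus to polynomials of smaller height over the remaining
  indices, to which the induction hypothesis applies. Since \<open>n\<close> and \<open>n + 1\<close> are among these indices, \<open>hh n\<close> is
  unaffected by the change of variables.\<close>

lemma localise:
  assumes ts: "torsion_simple H" and n: "far k n" "far k (Suc n)"
    and eq: "hh n * (hh n * x) = dX y"
    and x: "\<And>m. m \<in> Poly_Mapping.keys x \<Longrightarrow> grade m (Suc 0) \<le> H + 1 \<and> wall_wt k (grade m) > 0"
  shows "\<exists>i. boundary (hh k ^ i * (hh n * x))"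
proof -
  obtain N where N: "\<And>m. m \<in> Poly_Mapping.keys x \<union> Poly_Mapping.keys y \<Longrightarrow> scale_deg k m \<le> N"
    using finite_nat_set_iff_bounded_le[of "scale_deg k ` (Poly_Mapping.keys x \<union> Poly_Mapping.keys y)"] by auto
  define P Q where "P = straighten k (unscale k N x)" and "Q = straighten k (unscale k N y)"
  have PQ: "change_vars k P = hh k ^ N * x" "change_vars k Q = hh k ^ N * y"
    unfolding P_def Q_def change_vars_def straighten_straighten using N by (auto intro!: scale_unscale)
  have hk: "dX (hh k ^ N) = 0"
    by (simp add: twisted_der_var_power[OF dX_twisted_der])
  have "change_vars k (hh n * (hh n * P)) = change_vars k (split_d k Q)"
    using eq by (simp add: ring_hom_mult[OF ring_hom_change_vars] change_vars_hh_far[OF n] PQ dX_mult hk flip: dX_change_vars)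
      (metis mult.left_commute)
  then have PQ_eq: "hh n * (hh n * P) = split_d k Q"
    by (rule change_vars_inj)
  have "below (short_height k) H x"
    unfolding below_def using x short_height_less_height by fastforce
  then have P: "below (short_height k) H P"
    unfolding P_def by (intro below_straighten below_unscale)
  obtain M where M: "\<And>m v. m \<in> Poly_Mapping.keys P \<union> Poly_Mapping.keys Q \<Longrightarrow> v \<in> Poly_Mapping.keys m \<Longrightarrow> hi v \<le> M"
  proof -
    have "finite (hi ` (\<Union>m\<in>Poly_Mapping.keys P \<union> Poly_Mapping.keys Q. Poly_Mapping.keys m))"
      by simp
    then show thesis
      using that unfolding finite_nat_set_iff_bounded_le by blast
  qed
  \<comment> \<open>The maximum with \<open>k + 1\<close> makes \<open>S\<close> contain all columns, so that a cone outside \<open>S\<close> is of the form \<open>R k j\<close>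
    with \<open>j\<close> larger than all indices that occur.\<close>
  define S where "S = {v. side k v \<and> hi v \<le> max M (Suc k)}"
  have S: "finite S" "\<And>v. v \<in> S \<Longrightarrow> side k v"
    using finite_subset[OF _ finite_hi[of "max M (Suc k)"]] by (auto simp: S_def)
  have triv: "triv k m" if m: "m \<in> Poly_Mapping.keys (trivial_part k S p)" and p: "p = P \<or> p = Q" for m p
    unfolding triv_def
  proof (intro allI impI)
    fix v assume v: "side k v"
    have mp: "m \<in> Poly_Mapping.keys P \<union> Poly_Mapping.keys Q" "\<forall>v\<in>S. cone_triv v (partner k v) m"
      using m p by (auto simp: trivial_part_def keys_slice)
    show "cone_triv v (partner k v) m"
    proof (cases "v \<in> S")
      case False
      then have h: "hi v > M" "hi v > Suc k" using v by (auto simp: S_def)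
      then have "hi (partner k v) = hi v"
        using v by (auto simp: side_def on_defs partner_def)
      then have "v \<notin> Poly_Mapping.keys m" "partner k v \<notin> Poly_Mapping.keys m"
        using M[OF mp(1)] h(1) by (metis not_le)+
      then show ?thesis by (simp add: cone_triv_def in_keys_iff)
    qed (use mp in blast)
  qed
  have rho_hh: "trivial_part k S (hh n * p) = hh n * trivial_part k S p" for p
  proof -
    have c: "cone_triv v (partner k v) (Poly_Mapping.single (ix n (Suc n)) 1 + m) = cone_triv v (partner k v) m"
      if "side k v" for v m
    proof -
      have "ix n (Suc n) \<noteq> v" "ix n (Suc n) \<noteq> partner k v"
        using that n by (auto simp: side_def on_defs partner_def far_def ix_eq_iff)
      then show ?thesis by (simp add: cone_triv_def lookup_add lookup_single)
    qed
    show ?thesis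
      unfolding trivial_part_def var_ix[symmetric]
      by (intro slice_var_mult ball_cong refl c S(2))
  qed
  have "\<exists>Z. hh n * trivial_part k S P = split_d k Z"
  proof (rule trivial_descent[OF ts])
    show "below (short_height k) H (trivial_part k S P)" using P by (auto simp: below_def trivial_part_def keys_slice)
    show "hh n * (hh n * trivial_part k S P) = split_d k (trivial_part k S Q)"
      by (simp add: split_d_trivial_part[OF S] flip: PQ_eq rho_hh)
  qed (use triv n in auto)
  then obtain Z where Z: "hh n * trivial_part k S P = split_d k Z" by blast
  have dn: "split_d k (hh n * p) = hh n * split_d k p" for p
  proof -
    have "split_d k (hh n) = 0"
      by (rule change_vars_inj[of k]) (simp add: change_vars_hh_far[OF n] ring_hom_0[OF ring_hom_change_vars] flip: dX_change_vars)
    then show ?thesis by (simp add: twisted_der_mult[OF twisted_der_split_d])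
  qed
  have "hh n * split_d k (hh n * P) = hh n * 0"
    using arg_cong[OF PQ_eq, of "split_d k"] by (simp add: dn)
  then have "split_d k (hh n * P) = 0"
    by (rule hh_mult_cancel)
  then obtain Z' where "hh n * P + trivial_part k S (hh n * P) = split_d k Z'"
    using trivial_part_homotopic[OF S] by blast
  then have "hh n * P = split_d k (Z' + Z)"
    by (simp add: rho_hh Z twisted_der_add[OF twisted_der_split_d]) (metis add.assoc add.right_neutral add_self)
  then have "change_vars k (hh n * P) = dX (change_vars k (Z' + Z))"
    by (simp add: dX_change_vars)
  then have "boundary (hh k ^ N * (hh n * x))"
    by (simp add: ring_hom_mult[OF ring_hom_change_vars] change_vars_hh_far[OF n] PQ boundary_def) (metis mult.left_commute)
  then show ?thesis by blast
qed

section \<open>Torsion of the classes of height one\<close>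

lemma component_hh_mult: "component (\<lambda>n. c n + (wall_grade k n + deg1 n)) (hh k * p) = hh k * component c p"
  by (rule graded_map_component[OF graded_map_hh inj_sh])

lemma hh_adjacent_boundary: "boundary (hh n * hh (Suc n))"
proof -
  have "{n<..<Suc (Suc n)} = {Suc n}" by auto
  then have "hh n * hh (Suc n) = dX (R n (Suc (Suc n)))"
    by (simp add: dX_R)
  then show ?thesis unfolding boundary_def by blast
qed

lemma shear_invariant_hh_mult: "shear_invariant k u \<Longrightarrow> shear_invariant k (hh n * u)"
  by (simp add: shear_invariant_def shear_coeff_hh_mult boundary_mult_cycle)

text \<open>Multiplication by \<open>hh k\<close> raises the wall weight by two, so powers can be cancelled one factor at a time.\<close>

lemma even_hh_power_cancel:
  assumes "homogeneous c u" "dX u = 0" "even (wall_wt k c)" "wall_wt k c \<ge> 0" "shear_invariant k u" "boundary (hh k ^ i * u)"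
  shows "boundary u"
  using assms
proof (induction i arbitrary: c u)
  case (Suc i)
  let ?c = "\<lambda>n. c n + wall_grade k n + deg1 n"
  have w: "wall_wt k ?c = wall_wt k c + 2" by (simp add: wall_wt_simps)
  have "boundary (hh k * u)"
  proof (rule Suc.IH[of ?c])
    show "homogeneous ?c (hh k * u)" by (rule homogeneous_hh_mult[OF Suc.prems(1)])
    show "boundary (hh k ^ i * (hh k * u))" using Suc.prems(6) by (simp add: mult_ac)
  qed (use Suc.prems w in \<open>simp_all add: dX_mult shear_invariant_hh_mult\<close>)
  then show ?case
    by (rule even_hh_cancel[OF Suc.prems(1-5)])
qed simp

text \<open>All shear coefficients of \<open>h\<^sub>n x\<close> are \<open>h\<^sub>n\<close> times those of \<open>x\<close>, which have smaller height, so they bound by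
  the induction hypothesis; this makes \<open>division\<close> and \<open>even_hh_cancel\<close> available at every wall of positive
  weight. If that weight is odd, division suffices. If it is even, it is enough that some power of \<open>h\<^sub>k\<close>
  annihilates \<open>h\<^sub>n x\<close>: the first power does so if \<open>k = n\<close>, by hypothesis, and if \<open>k\<close> is adjacent to \<open>n\<close>, because
  \<open>h\<^sub>n h\<^sub>n\<^sub>+\<^sub>1 = 0\<close>; for the other walls this is \<open>localise\<close>.\<close>

lemma homogeneous_case:
  assumes ts: "torsion_simple (H - 1)" and x: "homogeneous c x" "c (Suc 0) \<le> H" and eq: "hh n * (hh n * x) = dX y"
  shows "boundary (hh n * x)"
proof (cases "x = 0")
  case False
  let ?u = "hh n * x"
  define cu where "cu = (\<lambda>i. c i + wall_grade n i + deg1 i)"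
  have u: "homogeneous cu ?u" unfolding cu_def by (rule homogeneous_hh_mult[OF x(1)])
  have "hh n * (hh n * dX x) = hh n * (hh n * 0)"
    using arg_cong[OF eq, of dX] by (simp add: dX_mult)
  then have "hh n * dX x = hh n * 0" by (rule hh_mult_cancel)
  then have dx: "dX x = 0" by (rule hh_mult_cancel)
  then have du: "dX ?u = 0" by (simp add: dX_mult)
  have shear_invariant: "shear_invariant k ?u" for k
    unfolding shear_invariant_def
  proof (intro allI impI)
    fix j :: nat assume j: "j \<ge> 1"
    have "homogeneous (\<lambda>i. c i - int j * wall_grade k i) (shear_coeff k j x)" by (rule homogeneous_shear_coeff[OF x(1)])
    then have "below (\<lambda>v. var_grade v (Suc 0)) (H - 1) (shear_coeff k j x)"
      using x(2) j by (auto simp: below_def homogeneous_def simp flip: grade_def)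
    moreover have "hh n * (hh n * shear_coeff k j x) = dX (shear_coeff k j y)"
      using arg_cong[OF eq, of "shear_coeff k j"] by (simp add: shear_coeff_hh_mult dX_shear_coeff)
    ultimately show "boundary (shear_coeff k j ?u)"
      using ts unfolding shear_coeff_hh_mult torsion_simple_def by blast
  qed
  have "Poly_Mapping.keys x \<noteq> {}" using False by simp
  then obtain m where m: "m \<in> Poly_Mapping.keys x" "grade m = c"
    using x(1) unfolding homogeneous_def by blast
  have "\<exists>k. wall_wt k cu > 0"
  proof -
    have "grade (Poly_Mapping.single (ix n (Suc n)) 1 + m) = cu"
      by (simp add: grade_add m cu_def var_grade_hh fun_eq_iff)
    moreover have "Poly_Mapping.single (ix n (Suc n)) 1 + m \<noteq> 0"
    proof
      assume "Poly_Mapping.single (ix n (Suc n)) 1 + m = 0"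
      then have "Poly_Mapping.lookup (Poly_Mapping.single (ix n (Suc n)) 1 + m) (ix n (Suc n)) = 0" by simp
      then show False by (simp add: lookup_add)
    qed
    ultimately obtain k where "cu (k + 2) > cu (Suc k + 2)"
      using exists_descent by metis
    then show ?thesis unfolding wall_wt_def by (intro exI[of _ k]) linarith
  qed
  then obtain k where k: "wall_wt k cu > 0" by blast
  show ?thesis
  proof (cases "odd (wall_wt k cu)")
    case True
    obtain b v where v: "homogeneous (\<lambda>i. cu i - (wall_grade k i + deg1 i)) v" "dX v = 0" "?u = dX b + hh k * v"
      by (rule division[OF u du k shear_invariant])
    have "wall_wt k (\<lambda>i. cu i - (wall_grade k i + deg1 i)) = wall_wt k cu - 2"
      by (simp add: wall_wt_simps)
    then have "boundary (hh k * v)"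
      using True by (intro odd_hh_boundary[OF v(1,2)]) simp
    then show ?thesis unfolding v(3) by (rule boundary_add[OF boundary_dX])
  next
    case False
    have "\<exists>i. boundary (hh k ^ i * ?u)"
    proof -
      consider "k = n" | "k = Suc n" | "n = Suc k" | "far k n" "far k (Suc n)"
        by (auto simp: far_def)
      then show ?thesis
      proof cases
        case 1
        then show ?thesis using eq by (intro exI[of _ 1]) (simp add: boundary_def, metis)
      next
        case 2
        then have "hh k ^ 1 * ?u = x * (hh n * hh (Suc n))" by (simp add: mult_ac)
        then show ?thesis using boundary_mult_cycle[OF hh_adjacent_boundary dx] by metis
      next
        case 3
        then have "hh k ^ 1 * ?u = x * (hh k * hh (Suc k))" by (simp add: mult_ac)
        then show ?thesis using boundary_mult_cycle[OF hh_adjacent_boundary dx] by metis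
      next
        case 4
        have "wall_wt k (wall_grade n) = 0"
          using 4 by (auto simp: wall_wt_def wall_grade_def var_grade_ix far_def)
        then have "wall_wt k c > 0" using k by (simp add: cu_def wall_wt_simps)
        then show ?thesis
          using x by (intro localise[OF ts 4 eq]) (auto simp: homogeneous_def)
      qed
    qed
    then show ?thesis
      using even_hh_power_cancel[OF u du _ _ shear_invariant] False k by auto
  qed
qed simp

theorem torsion_simple: "torsion_simple (int N - 1)"
proof (induction N)
  case 0
  have "boundary (hh n * x)" if "below (\<lambda>v. var_grade v (Suc 0)) (- 1) x" for n x
  proof -
    have "Poly_Mapping.keys x = {}"
    proof (rule equals0I)
      fix m assume "m \<in> Poly_Mapping.keys x"
      then have "grade m (Suc 0) \<le> - 1" using that by (simp add: below_def grade_def)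
      then show False using height_nonneg[of m] by simp
    qed
    then show ?thesis by simp
  qed
  then show ?case by (simp add: torsion_simple_def)
next
  case (Suc N)
  show ?case
    unfolding torsion_simple_def
  proof (intro allI impI)
    fix n x y
    assume x: "below (\<lambda>v. var_grade v (Suc 0)) (int (Suc N) - 1) x" and eq: "hh n * (hh n * x) = dX y"
    have "boundary (hh n * component c x)" if c: "c \<in> grade ` Poly_Mapping.keys x" for c
    proof (rule homogeneous_case[OF Suc homogeneous_component])
      show "c (Suc 0) \<le> int N" using x c by (auto simp: below_def simp flip: grade_def)
      let ?s = "\<lambda>c i. c i + (wall_grade n i + deg1 i)"
      have "hh n * (hh n * component c x) = component (?s (?s c)) (hh n * (hh n * x))"
        by (simp only: component_hh_mult)
      also have "\<dots> = dX (component (\<lambda>i. ?s (?s c) i - deg1 i) y)"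
        unfolding eq by (rule component_dX')
      finally show "hh n * (hh n * component c x) = dX (component (\<lambda>i. ?s (?s c) i - deg1 i) y)" .
    qed
    then have "boundary (\<Sum>c\<in>grade ` Poly_Mapping.keys x. hh n * component c x)"
      by (rule boundary_sum)
    then show "boundary (hh n * x)"
      by (simp flip: sum_distrib_left X_eq_sum_slice)
  qed
qed

corollary hh_torsion_simple:
  assumes "boundary (hh n * (hh n * x))"
  shows "boundary (hh n * x)"
proof -
  obtain y where y: "hh n * (hh n * x) = dX y" using assms by (auto simp: boundary_def)
  obtain N :: int where N: "\<And>m. m \<in> Poly_Mapping.keys x \<Longrightarrow> weight (\<lambda>v. var_grade v (Suc 0)) m \<le> N"
    using Max_ge[OF finite_imageI[OF finite_keys[of x], of "weight (\<lambda>v. var_grade v (Suc 0))"]] by blast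
  have "below (\<lambda>v. var_grade v (Suc 0)) (int (Suc (nat N)) - 1) x"
    using N by (force simp: below_def)
  then show ?thesis
    using torsion_simple[of "Suc (nat N)"] y unfolding torsion_simple_def by blast
qed

lemma homologous_0_iff: "homologous p 0 \<longleftrightarrow> boundary p"
  using boundary_cycle by (auto simp: homologous_def boundary_def)

lemma h_square_mult_eq_0: "h n * (h n * x) = 0 \<Longrightarrow> h n * x = 0"
  by transfer (use hh_torsion_simple in \<open>simp add: homologous_0_iff\<close>)

theorem theorem1p1:
  fixes x :: HX and n :: nat
  assumes "h n * x \<noteq> 0"
  shows "\<forall>i\<ge>1. h n ^ i * x \<noteq> 0"
proof (intro allI impI)
  fix i :: nat assume "i \<ge> 1"
  then show "h n ^ i * x \<noteq> 0"
  proof (induction i rule: dec_induct)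
    case (step i)
    have "h n ^ i * x = h n * (h n ^ (i - 1) * x)"
      using step(1) by (cases i) (simp_all add: mult.assoc)
    then show ?case
      using h_square_mult_eq_0[of n "h n ^ (i - 1) * x"] step by (auto simp: mult.assoc)
  qed (use assms in simp)
qed

end
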